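(* Let $n\ge 1$ be an integer, let $N$ be the simply connected nilpotent Lie group with Lie algebra $\mathfrak{n}=\left[H_0(\mathbb{H}^{n})\oplus \mathrm{Im}(\mathbb{H})\right]\oplus \mathbb{H}^{n}$ (with the bracket given in the context), and let $K=\mathrm{S}^1\times \mathrm{Sp}(n)$ act on $N$ by automorphisms as described in the context. Let $\tau$ be an irreducible unitary representation of $K$. Then the triple $(K\ltimes N, K, \tau)$ is commutative if and only if $\tau\in\widehat{\mathrm{S}^1}$, i.e. $\tau$ is a character of $K$ of the form $(e^{i\theta},k)\mapsto \chi(e^{i\theta})$ for some character $\chi$ of $\mathrm{S}^1$ (equivalently, $\tau$ is trivial on $\mathrm{Sp}(n)$).
   Context: Commutative triple: let $G$ be a Lie group, $K\subset G$ a compact subgroup, and $(\tau,W_\tau)$ an irreducible unitary representation of $K$ (finite dimensional). Let $L^1_{\tau,\tau}(G,\mathrm{End}(W_\tau))$ be the space of integrable functions $F:G\to \mathrm{End}(W_\tau)$ satisfying $F(k_1xk_2)=\tau(k_2)^{-1}F(x)\tau(k_1)^{-1}$ for all $k_1,k_2\in K$, $x\in G$. It is an algebra under the convolution $(F_1*F_2)(g)=\int_G F_2(x^{-1}g)F_1(x)\,dx$ ($dx$ Haar measure on $G$; the values are composed in $\mathrm{End}(W_\tau)$). The triple $(G,K,\tau)$ is called commutative if this algebra is commutative. The Lie algebra: $\mathbb{H}$ denotes the quaternions, $\mathrm{Im}(\mathbb{H})$ the imaginary quaternions, $H_0(\mathbb{H}^n)$ the real vector space of hermitian $n\times n$ matrices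 over $\mathbb{H}$ of trace zero, and $^*$ the quaternionic conjugate transpose. The Lie algebra is the real two-step nilpotent Lie algebra $\mathfrak{n}=\mathfrak{z}\oplus V$ with $\mathfrak{z}=H_0(\mathbb{H}^{n})\oplus \mathrm{Im}(\mathbb{H})$ (the center), $V=\mathbb{H}^n$ (column vectors), and bracket $$[(z,u),(w,v)]=\big(((u i v^*-v i u^* )_0,\ u^*v-v^*u),0\big),\qquad z,w\in\mathfrak{z},\ u,v\in V,$$ where for a hermitian $n\times n$ matrix $A$, $(A)_0=A-\frac1n\mathrm{tr}(A)I$ is its trace-free part. The action: $\mathrm{S}^1$ is the circle group $\{e^{i\theta}\}\subset\mathbb{C}\subset\mathbb{H}$ and $\mathrm{Sp}(n)$ is the compact group of $n\times n$ quaternionic matrices $k$ with $kk^*=I$. The group $K=\mathrm{S}^1\times\mathrm{Sp}(n)$ acts on $\mathfrak{n}$ by automorphisms via $$(e^{i\theta},k)\cdot((A,q),v)=\big((kAk^*,\ e^{i\theta}qe^{-i\theta}),\ kve^{-i\theta}\big),\qquad A\in H_0(\mathbb{H}^n),\ q\in\mathrm{Im}(\mathbb{H}),\ v\in\mathbb{H}^n.$$ Since $N$ is simply connected, this gives an action on $N$ and the semidirect product $K\ltimes N$. *)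

theory Defs
  imports "HOL-Analysis.Analysis" "HOL-Algebra.Coset"
begin

section \<open>Quaternions\<close>

datatype quat = Quat (qRe: real) (qIm1: real) (qIm2: real) (qIm3: real)

lemma quat_eq_iff:
  "x = y \<longleftrightarrow> qRe x = qRe y \<and> qIm1 x = qIm1 y \<and> qIm2 x = qIm2 y \<and> qIm3 x = qIm3 y"
  by (cases x; cases y) auto

instantiation quat :: ring_1
begin

definition "0 = Quat 0 0 0 0"
definition "1 = Quat 1 0 0 0"
definition "x + y = Quat (qRe x + qRe y) (qIm1 x + qIm1 y) (qIm2 x + qIm2 y) (qIm3 x + qIm3 y)"
definition "- x = Quat (- qRe x) (- qIm1 x) (- qIm2 x) (- qIm3 x)"
definition "x - y = Quat (qRe x - qRe y) (qIm1 x - qIm1 y) (qIm2 x - qIm2 y) (qIm3 x - qIm3 y)"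
definition "x * y = Quat
  (qRe x * qRe y - qIm1 x * qIm1 y - qIm2 x * qIm2 y - qIm3 x * qIm3 y)
  (qRe x * qIm1 y + qIm1 x * qRe y + qIm2 x * qIm3 y - qIm3 x * qIm2 y)
  (qRe x * qIm2 y - qIm1 x * qIm3 y + qIm2 x * qRe y + qIm3 x * qIm1 y)
  (qRe x * qIm3 y + qIm1 x * qIm2 y - qIm2 x * qIm1 y + qIm3 x * qRe y)"

lemma quat_sel_ring [simp]:
  "qRe 0 = 0" "qIm1 0 = 0" "qIm2 0 = 0" "qIm3 0 = 0"
  "qRe 1 = 1" "qIm1 1 = 0" "qIm2 1 = 0" "qIm3 1 = 0"
  "qRe (x + y) = qRe x + qRe y" "qIm1 (x + y) = qIm1 x + qIm1 y"
  "qIm2 (x + y) = qIm2 x + qIm2 y" "qIm3 (x + y) = qIm3 x + qIm3 y"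
  "qRe (- x) = - qRe x" "qIm1 (- x) = - qIm1 x" "qIm2 (- x) = - qIm2 x" "qIm3 (- x) = - qIm3 x"
  "qRe (x - y) = qRe x - qRe y" "qIm1 (x - y) = qIm1 x - qIm1 y"
  "qIm2 (x - y) = qIm2 x - qIm2 y" "qIm3 (x - y) = qIm3 x - qIm3 y"
  "qRe (x * y) = qRe x * qRe y - qIm1 x * qIm1 y - qIm2 x * qIm2 y - qIm3 x * qIm3 y"
  "qIm1 (x * y) = qRe x * qIm1 y + qIm1 x * qRe y + qIm2 x * qIm3 y - qIm3 x * qIm2 y"
  "qIm2 (x * y) = qRe x * qIm2 y - qIm1 x * qIm3 y + qIm2 x * qRe y + qIm3 x * qIm1 y"
  "qIm3 (x * y) = qRe x * qIm3 y + qIm1 x * qIm2 y - qIm2 x * qIm1 y + qIm3 x * qRe y"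
  by (simp_all add: zero_quat_def one_quat_def plus_quat_def uminus_quat_def
      minus_quat_def times_quat_def)

instance
  by standard (simp_all add: quat_eq_iff algebra_simps)

end

instantiation quat :: real_vector
begin

definition "r *\<^sub>R x = Quat (r * qRe x) (r * qIm1 x) (r * qIm2 x) (r * qIm3 x)"

instance
  by standard (simp_all add: quat_eq_iff scaleR_quat_def algebra_simps)

end

instantiation quat :: euclidean_space
begin

definition "inner x y = qRe x * qRe y + qIm1 x * qIm1 y + qIm2 x * qIm2 y + qIm3 x * qIm3 y"
definition "norm (x::quat) = sqrt (inner x x)"
definition "sgn (x::quat) = x /\<^sub>R norm x"
definition "dist (x::quat) y = norm (x - y)"
definition [code del]:
  "(uniformity :: (quat \<times> quat) filter) = (INF e\<in>{0 <..}. principal {(x, y). dist x y < e})"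
definition [code del]:
  "open (U :: quat set) \<longleftrightarrow> (\<forall>x\<in>U. eventually (\<lambda>(x', y). x' = x \<longrightarrow> y \<in> U) uniformity)"
definition "Basis = {Quat 1 0 0 0, Quat 0 1 0 0, Quat 0 0 1 0, Quat 0 0 0 1}"

instance
proof
  fix x y z :: quat and r :: real
  show "inner x y = inner y x" "inner (x + y) z = inner x z + inner y z"
    "inner (r *\<^sub>R x) y = r * inner x y" "0 \<le> inner x x"
    by (simp_all add: inner_quat_def scaleR_quat_def algebra_simps)
  show "inner x x = 0 \<longleftrightarrow> x = 0"
    by (simp add: inner_quat_def quat_eq_iff add_nonneg_eq_0_iff)
  show "norm x = sqrt (inner x x)" "sgn x = x /\<^sub>R norm x" "dist x y = norm (x - y)"
    by (simp_all add: norm_quat_def sgn_quat_def dist_quat_def)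
  show "(uniformity :: (quat \<times> quat) filter) = (INF e\<in>{0 <..}. principal {(x, y). dist x y < e})"
    by (simp add: uniformity_quat_def)
  show "open U \<longleftrightarrow> (\<forall>x\<in>U. eventually (\<lambda>(x', y). x' = x \<longrightarrow> y \<in> U) uniformity)"
    for U :: "quat set"
    by (simp add: open_quat_def)
  show "(Basis :: quat set) \<noteq> {}" "finite (Basis :: quat set)"
    by (simp_all add: Basis_quat_def)
  show "inner x y = (if x = y then 1 else 0)" if "x \<in> Basis" "y \<in> Basis"
    using that unfolding Basis_quat_def inner_quat_def by (elim insertE emptyE) simp_all
  show "(\<forall>u\<in>Basis. inner x u = 0) \<longleftrightarrow> x = 0"
    by (auto simp: Basis_quat_def inner_quat_def quat_eq_iff[of x 0])
qed

end

definition qcnj :: "quat \<Rightarrow> quat" where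
  "qcnj x = Quat (qRe x) (- qIm1 x) (- qIm2 x) (- qIm3 x)"

instantiation quat :: real_normed_div_algebra
begin

definition "inverse x = qcnj x /\<^sub>R inner x x"
definition "x div (y::quat) = x * inverse y"

instance
proof
  fix x y :: quat and r :: real
  show "r *\<^sub>R x * y = r *\<^sub>R (x * y)" "x * r *\<^sub>R y = r *\<^sub>R (x * y)"
    by (simp_all only: quat_eq_iff scaleR_quat_def quat.sel quat_sel_ring) (simp_all add: algebra_simps)
  have *: "z * qcnj z = inner z z *\<^sub>R 1" "qcnj z * z = inner z z *\<^sub>R 1" for z :: quat
    by (simp_all only: quat_eq_iff qcnj_def inner_quat_def scaleR_quat_def quat.sel quat_sel_ring)
      simp_all
  have scale: "z * s *\<^sub>R w = s *\<^sub>R (z * w)" "s *\<^sub>R w * z = s *\<^sub>R (w * z)" for s and z w :: quat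
    by (simp_all only: quat_eq_iff scaleR_quat_def quat.sel quat_sel_ring) (simp_all add: algebra_simps)
  have "qcnj (x * y) = qcnj y * qcnj x"
    by (simp add: quat_eq_iff qcnj_def)
  then have "x * y * qcnj (x * y) = x * (y * qcnj y) * qcnj x"
    by (simp add: mult.assoc)
  then have "inner (x * y) (x * y) *\<^sub>R (1::quat) = (inner x x * inner y y) *\<^sub>R 1"
    by (simp only: * scale mult_1_right scaleR_scaleR mult.commute)
  then have "inner (x * y) (x * y) = inner x x * inner y y"
    by (simp add: quat_eq_iff scaleR_quat_def)
  then show "norm (x * y) = norm x * norm y"
    by (simp add: norm_quat_def real_sqrt_mult)
  show "inverse x * x = 1" "x * inverse x = 1" if "x \<noteq> 0"
    using that by (simp_all only: inverse_quat_def scale * scaleR_scaleR) simp_all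
  show "x div y = x * inverse y"
    by (simp add: divide_quat_def)
  show "inverse (0::quat) = 0"
    by (simp add: inverse_quat_def)
qed

end

definition quat_of_complex :: "complex \<Rightarrow> quat" where
  "quat_of_complex z = Quat (Re z) (Im z) 0 0"

definition Im_quat :: "quat set" where
  "Im_quat = {q. qRe q = 0}"


section \<open>The groups\<close>

definition qadj :: "quat ^ 'n ^ 'm \<Rightarrow> quat ^ 'm ^ 'n" where
  "qadj A = map_matrix qcnj (transpose A)"

definition cadj :: "complex ^ 'n ^ 'm \<Rightarrow> complex ^ 'm ^ 'n" where
  "cadj A = map_matrix cnj (transpose A)"

definition circle_group :: "complex monoid" where
  "circle_group = \<lparr>carrier = sphere 0 1, mult = (*), one = 1\<rparr>"

definition Sp_group :: "(quat ^ 'n ^ 'n) monoid" where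
  "Sp_group = \<lparr>carrier = {k. k ** qadj k = mat 1}, mult = (**), one = mat 1\<rparr>"

definition unitary_group :: "(complex ^ 'd ^ 'd) monoid" where
  "unitary_group = \<lparr>carrier = {U. U ** cadj U = mat 1}, mult = (**), one = mat 1\<rparr>"

abbreviation K_group :: "(complex \<times> (quat ^ 'n ^ 'n)) monoid" where
  "K_group \<equiv> circle_group \<times>\<times> Sp_group"

text \<open>The elements of the Lie algebra are the triples \<open>((A, q), v)\<close> with \<open>A\<close> in
  \<^term>\<open>H0\<close>, \<open>q\<close> imaginary and \<open>v\<close> an arbitrary quaternionic vector.\<close>

definition H0 :: "(quat ^ 'n ^ 'n) set" where
  "H0 = {A. qadj A = A \<and> trace A = 0}"

type_synonym 'n nalg = "((quat ^ 'n ^ 'n) \<times> quat) \<times> (quat ^ 'n)"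

definition lie_algebra_n :: "'n::finite nalg set" where
  "lie_algebra_n = (H0 \<times> Im_quat) \<times> UNIV"

definition trace_free :: "quat ^ 'n ^ 'n \<Rightarrow> quat ^ 'n ^ 'n" where
  "trace_free A = A - (1 / real CARD('n)) *\<^sub>R mat (trace A)"

text \<open>\<open>outer_i u v\<close> is the matrix \<open>u i v\<^sup>*\<close>, and \<open>qform u v\<close> is the quaternion \<open>u\<^sup>* v\<close>.\<close>

definition outer_i :: "quat ^ 'n \<Rightarrow> quat ^ 'n \<Rightarrow> quat ^ 'n ^ 'n" where
  "outer_i u v = (\<chi> a b. u $ a * quat_of_complex \<i> * qcnj (v $ b))"

definition qform :: "quat ^ 'n \<Rightarrow> quat ^ 'n \<Rightarrow> quat" where
  "qform u v = (\<Sum>a\<in>UNIV. qcnj (u $ a) * v $ a)"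

definition n_bracket :: "'n::finite nalg \<Rightarrow> 'n nalg \<Rightarrow> 'n nalg" where
  "n_bracket X Y = (case (X, Y) of ((z, u), (w, v)) \<Rightarrow>
     ((trace_free (outer_i u v - outer_i v u), qform u v - qform v u), 0))"

text \<open>The simply connected group is realised on its Lie algebra through the exponential map, which
  is a diffeomorphism. For a two-step nilpotent algebra the Baker-Campbell-Hausdorff series stops
  at the first bracket, and a Lie algebra automorphism is its own lift to the group.\<close>

definition N_group :: "'n::finite nalg monoid" where
  "N_group = \<lparr>carrier = lie_algebra_n, mult = (\<lambda>X Y. X + Y + (1/2) *\<^sub>R n_bracket X Y), one = 0\<rparr>"

definition K_action :: "complex \<times> (quat ^ 'n ^ 'n) \<Rightarrow> 'n::finite nalg \<Rightarrow> 'n nalg" where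
  "K_action = (\<lambda>(z, k) ((A, q), v).
     ((k ** A ** qadj k, quat_of_complex z * q * quat_of_complex (cnj z)),
      (\<chi> a. (k *v v) $ a * quat_of_complex (cnj z))))"

definition semidirect :: "'k monoid \<Rightarrow> 'x monoid \<Rightarrow> ('k \<Rightarrow> 'x \<Rightarrow> 'x) \<Rightarrow> ('k \<times> 'x) monoid" where
  "semidirect K N act =
     \<lparr>carrier = carrier K \<times> carrier N,
      mult = (\<lambda>(k, x) (l, y). (k \<otimes>\<^bsub>K\<^esub> l, x \<otimes>\<^bsub>N\<^esub> act k y)),
      one = (\<one>\<^bsub>K\<^esub>, \<one>\<^bsub>N\<^esub>)\<rparr>"

abbreviation KN_group :: "((complex \<times> (quat ^ 'n ^ 'n)) \<times> 'n::finite nalg) monoid" where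
  "KN_group \<equiv> semidirect K_group N_group K_action"


section \<open>Representations and commutative triples\<close>

text \<open>A group here carries the subspace topology of the topological type containing its carrier;
  the representation space is \<^typ>\<open>complex ^ 'd\<close> with its standard hermitian product.\<close>

definition unitary_rep ::
    "('k::topological_space) monoid \<Rightarrow> ('k \<Rightarrow> complex ^ 'd ^ 'd) \<Rightarrow> bool" where
  "unitary_rep K \<tau> \<longleftrightarrow> \<tau> \<in> hom K unitary_group \<and> continuous_on (carrier K) \<tau>"

definition irreducible_unitary_rep ::
    "('k::topological_space) monoid \<Rightarrow> ('k \<Rightarrow> complex ^ 'd ^ 'd) \<Rightarrow> bool" where
  "irreducible_unitary_rep K \<tau> \<longleftrightarrow> unitary_rep K \<tau> \<and>
     (\<forall>S. vec.subspace S \<and> (\<forall>k\<in>carrier K. \<forall>w\<in>S. \<tau> k *v w \<in> S) \<longrightarrow> S = {0} \<or> S = UNIV)"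

definition circle_character :: "(complex \<Rightarrow> complex) \<Rightarrow> bool" where
  "circle_character \<psi> \<longleftrightarrow>
     \<psi> \<in> hom circle_group circle_group \<and> continuous_on (carrier circle_group) \<psi>"

text \<open>Membership of \<open>\<tau>\<close> in the unitary dual of the circle, seen as representations of \<^term>\<open>K_group\<close>.\<close>

definition in_circle_dual :: "(complex \<times> (quat ^ 'n ^ 'n) \<Rightarrow> complex ^ 'd ^ 'd) \<Rightarrow> bool" where
  "in_circle_dual \<tau> \<longleftrightarrow> CARD('d) = 1 \<and>
     (\<exists>\<psi>. circle_character \<psi> \<and> (\<forall>(z, k)\<in>carrier K_group. \<tau> (z, k) = mat (\<psi> z)))"

text \<open>No regularity condition is imposed: on a second countable locally compact group every Borel
  measure that is finite on compact sets is regular.\<close>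

definition haar_measure :: "('g::topological_space) monoid \<Rightarrow> 'g measure \<Rightarrow> bool" where
  "haar_measure G \<mu> \<longleftrightarrow>
     sets \<mu> = sets (restrict_space borel (carrier G)) \<and>
     (\<forall>x\<in>carrier G. \<forall>A\<in>sets \<mu>. emeasure \<mu> (x <#\<^bsub>G\<^esub> A) = emeasure \<mu> A) \<and>
     (\<forall>C. compact C \<and> C \<subseteq> carrier G \<longrightarrow> emeasure \<mu> C < \<infinity>) \<and>
     (\<forall>U. open U \<and> U \<inter> carrier G \<noteq> {} \<longrightarrow> emeasure \<mu> (U \<inter> carrier G) > 0)"

text \<open>Below, \<open>K\<close> is a subgroup of \<open>G\<close>, \<open>\<tau>\<close> is a representation of it, and \<open>\<mu>\<close> is a Haar measure
  of \<open>G\<close>. An integrable function represents its almost everywhere class, so two elements of the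
  algebra are equal when they agree almost everywhere.\<close>

definition L1_tau ::
    "('g, 'e) monoid_scheme \<Rightarrow> 'g measure \<Rightarrow> 'g set \<Rightarrow> ('g \<Rightarrow> complex ^ 'd ^ 'd)
      \<Rightarrow> ('g \<Rightarrow> complex ^ 'd ^ 'd) set" where
  "L1_tau G \<mu> K \<tau> = {F. integrable \<mu> F \<and>
     (\<forall>k\<^sub>1\<in>K. \<forall>k\<^sub>2\<in>K. \<forall>x\<in>carrier G.
        F (k\<^sub>1 \<otimes>\<^bsub>G\<^esub> x \<otimes>\<^bsub>G\<^esub> k\<^sub>2) = matrix_inv (\<tau> k\<^sub>2) ** F x ** matrix_inv (\<tau> k\<^sub>1))}"

definition convolution ::
    "('g, 'e) monoid_scheme \<Rightarrow> 'g measure \<Rightarrow> ('g \<Rightarrow> complex ^ 'd ^ 'd)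
      \<Rightarrow> ('g \<Rightarrow> complex ^ 'd ^ 'd) \<Rightarrow> 'g \<Rightarrow> complex ^ 'd ^ 'd" where
  "convolution G \<mu> F\<^sub>1 F\<^sub>2 g = (LINT x|\<mu>. F\<^sub>2 (inv\<^bsub>G\<^esub> x \<otimes>\<^bsub>G\<^esub> g) ** F\<^sub>1 x)"

definition commutative_triple ::
    "('g, 'e) monoid_scheme \<Rightarrow> 'g measure \<Rightarrow> 'g set \<Rightarrow> ('g \<Rightarrow> complex ^ 'd ^ 'd) \<Rightarrow> bool" where
  "commutative_triple G \<mu> K \<tau> \<longleftrightarrow>
     (\<forall>F\<^sub>1\<in>L1_tau G \<mu> K \<tau>. \<forall>F\<^sub>2\<in>L1_tau G \<mu> K \<tau>.
        AE g in \<mu>. convolution G \<mu> F\<^sub>1 F\<^sub>2 g = convolution G \<mu> F\<^sub>2 F\<^sub>1 g)"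

end

theory Submission
  imports Defs
begin

text \<open>For a character of the circle the convolution algebra reduces to the \<open>K\<close>-invariant functions on
  \<open>N\<close>. Right multiplication by \<open>j\<close> on \<open>V\<close> extends to an automorphism \<open>\<sigma>\<close> of \<open>G = K \<ltimes> N\<close> such
  that \<open>X\<close> and \<open>- \<sigma> X\<close> always lie in the same \<open>K\<close>-orbit. Hence \<open>g \<mapsto> \<sigma> (g)\<^sup>-\<^sup>1\<close> is an
  anti-automorphism that fixes every function of the algebra, and Gelfand's trick applies; Haar
  measure is preserved by \<open>\<sigma>\<close> because left invariant measures are unique and \<open>\<sigma>\<close> preserves a compact
  neighbourhood.

  Conversely, some \<open>X = ((A, q), v)\<close> is stabilized only by \<open>(1, I)\<close> and \<open>(- 1, - I)\<close>, which act by
  scalars. If \<open>a X \<cdot> b X = 2 X\<close> with \<open>a, b \<in> K\<close> then strict convexity of the norm gives \<open>a X = X = b X\<close>.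
  Smearing a bump at \<open>X\<close> over its \<open>K\<close>-orbit with values \<open>\<tau> k M \<tau> k\<^sup>*\<close> therefore gives two elements of the
  algebra whose convolutions near \<open>2 X\<close> are almost proportional to \<open>M\<^sub>2 M\<^sub>1\<close> and \<open>M\<^sub>1 M\<^sub>2\<close> with the same
  factor. So commutativity forces dimension one, and a one-dimensional representation is trivial on
  \<open>Sp(n)\<close>, which is generated by reflections whose multipliers are commutators.\<close>

section \<open>Quaternionic algebra, the groups and the action\<close>

section \<open>Quaternions and quaternionic matrices\<close>

text \<open>Inversion in \<open>N\<close> is \<open>X \<mapsto> - X\<close>, and \<open>K\<close>
  moves a hermitian matrix only within its spectrum, so \<open>A\<close> and \<open>- A\<close> are
  in general not conjugate. This is why \<sigma> has to negate \<open>A\<close> itself. What remains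
  is to move \<open>q\<close> and \<open>v\<close> while \<open>A\<close> stays fixed: the circle
  turns \<open>q\<close>, and Sp(n) must supply an element that commutes with \<open>A\<close> and
  multiplies \<open>v\<close> by a prescribed unit quaternion, however \<open>v\<close> lies
  relative to the eigenspaces of \<open>A\<close>.

  In the other direction, commutativity gives equality only almost everywhere, so convolutions
  cannot be compared at the single point \<open>2 X\<close>. They are compared through one real
  integrand that is nonnegative everywhere, has integral zero, and is positive on a nonempty open
  set. Conjugation ignores scalars, so it suffices that the central element
  \<open>(- 1, - I)\<close> acts by one; this is Schur's lemma, reduced to self-adjoint matrices,
  whose eigenvectors come from compactness.

  The measure is an arbitrary left Haar measure on \<open>K \<ltimes> N\<close>; the averages over
  \<open>K\<close> use a measure that it induces on \<open>K\<close>.\<close>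

lemma qcnj_sel [simp]:
  "qRe (qcnj x) = qRe x" "qIm1 (qcnj x) = - qIm1 x" "qIm2 (qcnj x) = - qIm2 x"
  "qIm3 (qcnj x) = - qIm3 x"
  by (simp_all add: qcnj_def)

lemma scaleR_quat_sel [simp]:
  "qRe (r *\<^sub>R x) = r * qRe x" "qIm1 (r *\<^sub>R x) = r * qIm1 x" "qIm2 (r *\<^sub>R x) = r * qIm2 x"
  "qIm3 (r *\<^sub>R x) = r * qIm3 x"
  by (simp_all add: scaleR_quat_def)

lemma quat_of_complex_sel [simp]:
  "qRe (quat_of_complex z) = Re z" "qIm1 (quat_of_complex z) = Im z"
  "qIm2 (quat_of_complex z) = 0" "qIm3 (quat_of_complex z) = 0"
  by (simp_all add: quat_of_complex_def)

lemma of_real_quat_sel [simp]: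
  "qRe (of_real r) = r" "qIm1 (of_real r) = 0" "qIm2 (of_real r) = 0" "qIm3 (of_real r) = 0"
  by (simp_all add: of_real_def)

lemma qcnj_simps [simp]:
  "qcnj 0 = 0" "qcnj 1 = 1" "qcnj (- x) = - qcnj x" "qcnj (qcnj x) = x"
  "qcnj (x + y) = qcnj x + qcnj y" "qcnj (x - y) = qcnj x - qcnj y"
  "qcnj (r *\<^sub>R x) = r *\<^sub>R qcnj x" "qcnj (of_real r) = of_real r"
  "qcnj (quat_of_complex z) = quat_of_complex (cnj z)"
  by (simp_all add: quat_eq_iff)

lemma qcnj_mult: "qcnj (x * y) = qcnj y * qcnj x"
  by (simp add: quat_eq_iff)

lemma qcnj_sum: "qcnj (sum f A) = (\<Sum>a\<in>A. qcnj (f a))"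
  by (induction A rule: infinite_finite_induct) auto

lemma quat_of_complex_simps [simp]:
  "quat_of_complex 0 = 0" "quat_of_complex 1 = 1"
  "quat_of_complex (- z) = - quat_of_complex z"
  "quat_of_complex (z * w) = quat_of_complex z * quat_of_complex w"
  by (simp_all add: quat_eq_iff)

lemma qcnj_mult_self: "qcnj x * x = of_real ((norm x)\<^sup>2)" "x * qcnj x = of_real ((norm x)\<^sup>2)"
  by (simp_all add: quat_eq_iff norm_quat_def inner_quat_def)

lemma norm_qcnj [simp]: "norm (qcnj x) = norm x"
  by (simp add: norm_quat_def inner_quat_def)

lemma norm_quat_of_complex [simp]: "norm (quat_of_complex z) = norm z"
  by (simp add: norm_quat_def inner_quat_def cmod_def power2_eq_square)

lemma quat_of_real_commute: "of_real r * (x::quat) = x * of_real r"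
  by (simp add: quat_eq_iff)

lemma inner_quat_mult:
  fixes p q r :: quat
  shows "inner (p * q) r = inner q (qcnj p * r)" "inner (p * q) r = inner p (r * qcnj q)"
  by (simp_all add: inner_quat_def algebra_simps)

lemma qcnj_eq_self_iff: "qcnj x = x \<longleftrightarrow> x = of_real (qRe x)"
  by (auto simp: quat_eq_iff)

lemma matrix_mult_nth: "(A ** B) $ i $ j = (\<Sum>k\<in>UNIV. A $ i $ k * B $ k $ j)"
  by (simp add: matrix_matrix_mult_def)

lemma matrix_vector_nth: "(A *v x) $ i = (\<Sum>k\<in>UNIV. A $ i $ k * x $ k)"
  by (simp add: matrix_vector_mult_def)

lemma qadj_nth [simp]: "qadj A $ i $ j = qcnj (A $ j $ i)"
  by (simp add: qadj_def transpose_def)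

lemma cadj_nth [simp]: "cadj A $ i $ j = cnj (A $ j $ i)"
  by (simp add: cadj_def transpose_def)

lemma qadj_simps [simp]:
  "qadj (qadj A) = A" "qadj (A + B) = qadj A + qadj B" "qadj (A - B) = qadj A - qadj B"
  "qadj (- A) = - qadj A" "qadj 0 = 0" "qadj (r *\<^sub>R A) = r *\<^sub>R qadj A"
  by (simp_all add: vec_eq_iff)

lemma qadj_mat [simp]: "qadj (mat a) = mat (qcnj a)"
  by (simp add: vec_eq_iff mat_def)

lemma qadj_mult: "qadj (A ** B) = qadj B ** qadj A"
  by (simp add: vec_eq_iff matrix_mult_nth qcnj_sum qcnj_mult)

lemma inner_vec_mult: "inner ((k :: quat^'n^'m) *v w) u = inner w (qadj k *v u)"
proof -
  have "inner (k *v w) u = (\<Sum>i\<in>UNIV. \<Sum>j\<in>UNIV. inner (k $ i $ j * w $ j) (u $ i))"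
    by (simp add: inner_vec_def matrix_vector_nth inner_sum_left)
  also have "\<dots> = (\<Sum>j\<in>UNIV. \<Sum>i\<in>UNIV. inner (w $ j) (qcnj (k $ i $ j) * u $ i))"
    by (subst sum.swap) (simp add: inner_quat_mult(1))
  finally show ?thesis
    by (simp add: inner_vec_def matrix_vector_nth inner_sum_right)
qed

lemma inner_qadj: "inner (qadj A) (qadj B) = inner A B"
  unfolding inner_vec_def by (subst sum.swap) (simp add: inner_quat_def)

lemma inner_matrix_mult_left: "inner ((k :: quat^'n^'m) ** A) B = inner A (qadj k ** B)"
proof -
  have "inner (k ** A) B = (\<Sum>i\<in>UNIV. \<Sum>j\<in>UNIV. \<Sum>l\<in>UNIV. inner (k $ i $ l * A $ l $ j) (B $ i $ j))"
    by (simp add: inner_vec_def matrix_mult_nth inner_sum_left)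
  also have "\<dots> = (\<Sum>i\<in>UNIV. \<Sum>l\<in>UNIV. \<Sum>j\<in>UNIV. inner (A $ l $ j) (qcnj (k $ i $ l) * B $ i $ j))"
    by (subst (2) sum.swap) (simp add: inner_quat_mult(1))
  also have "\<dots> = (\<Sum>l\<in>UNIV. \<Sum>j\<in>UNIV. \<Sum>i\<in>UNIV. inner (A $ l $ j) (qcnj (k $ i $ l) * B $ i $ j))"
    by (subst sum.swap, subst (2) sum.swap) simp
  finally show ?thesis
    by (simp add: inner_vec_def matrix_mult_nth inner_sum_right)
qed

lemma matrix_add_rdistrib: "((A + B) ** C) = (A ** C) + ((B :: 'a::semiring_1^'n^'m) ** C)"
  by (simp add: vec_eq_iff matrix_mult_nth sum.distrib distrib_right)

lemma matrix_diff_distrib: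
  fixes A B :: "'a::ring_1^'n^'m"
  shows "(A - B) ** C = A ** C - B ** C" "D ** (A - B) = D ** A - D ** B"
  by (simp_all add: vec_eq_iff matrix_mult_nth sum_subtractf left_diff_distrib right_diff_distrib)

lemma matrix_uminus_mult:
  fixes A :: "'a::ring_1^'n^'m"
  shows "(- A) ** B = - (A ** B)" "A ** (- B) = - (A ** B)"
  by (simp_all add: vec_eq_iff matrix_mult_nth sum_negf)

lemma matrix_scaleR_mult:
  fixes A :: "'a::real_algebra_1^'n^'m"
  shows "(r *\<^sub>R A) ** B = r *\<^sub>R (A ** B)" "A ** (r *\<^sub>R B) = r *\<^sub>R (A ** B)"
  by (simp_all add: vec_eq_iff matrix_mult_nth scaleR_sum_right)

section \<open>The compact group\<close>

text \<open>Only \<open>k ** qadj k = mat 1\<close> is at hand, so the direct computation gives the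
  isometry of \<open>qadj k\<close>; that of \<open>k\<close> follows once the inverse is known to
  be two-sided.\<close>

lemma Sp_norm_preserving:
  assumes "k ** qadj k = mat 1"
  shows "norm (qadj k *v w) = norm w"
  using inner_vec_mult[of "qadj k" w "qadj k *v w"] assms
  by (simp add: matrix_vector_mul_assoc norm_eq_sqrt_inner)

text \<open>The scalars do not commute, so a one-sided inverse is two-sided by real dimension count:
  \<open>qadj k\<close> is isometric, hence bijective.\<close>

lemma Sp_left_inverse:
  fixes k :: "quat^'n^'n"
  assumes "k ** qadj k = mat 1"
  shows "qadj k ** k = mat 1"
proof -
  have "inj (\<lambda>w. qadj k *v w)"
    by (metis assms injI matrix_vector_mul_assoc matrix_vector_mul_lid)
  then have "surj (\<lambda>w. qadj k *v w)"
    by (intro linear_injective_imp_surjective) auto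
  then have "(qadj k ** k) *v u = mat 1 *v u" for u
  proof -
    obtain w where "u = qadj k *v w"
      using \<open>surj _\<close> by (metis surjD)
    then have "(qadj k ** k) *v u = qadj k *v ((k ** qadj k) *v w)"
      by (simp only: matrix_vector_mul_assoc matrix_mul_assoc)
    then show ?thesis
      by (simp add: assms \<open>u = _\<close>)
  qed
  then show ?thesis
    unfolding matrix_eq[of "qadj k ** k"] by blast
qed

lemma Sp_group_simps [simp]:
  "carrier Sp_group = {k. k ** qadj k = mat 1}" "mult Sp_group = (**)" "one Sp_group = mat 1"
  by (simp_all add: Sp_group_def)

lemma circle_group_simps [simp]:
  "carrier circle_group = sphere 0 1" "mult circle_group = (*)" "one circle_group = 1"
  by (simp_all add: circle_group_def)

lemma unitary_group_simps [simp]: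
  "carrier unitary_group = {U. U ** cadj U = mat 1}" "mult unitary_group = (**)"
  "one unitary_group = mat 1"
  by (simp_all add: unitary_group_def)

lemma group_Sp: "group (Sp_group :: (quat^'n^'n) monoid)"
proof (rule groupI)
  fix k l m :: "quat^'n^'n"
  assume k: "k \<in> carrier Sp_group"
  show "k \<otimes>\<^bsub>Sp_group\<^esub> l \<in> carrier Sp_group" if "l \<in> carrier Sp_group"
  proof -
    have "(k ** l) ** qadj (k ** l) = k ** (l ** qadj l) ** qadj k"
      by (simp only: qadj_mult matrix_mul_assoc)
    then show ?thesis using k that by simp
  qed
  show "\<exists>l\<in>carrier Sp_group. l \<otimes>\<^bsub>Sp_group\<^esub> k = \<one>\<^bsub>Sp_group\<^esub>"
    using k Sp_left_inverse[of k] by (intro bexI[of _ "qadj k"]) auto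
qed (auto simp: matrix_mul_assoc)

lemma group_circle: "group circle_group"
proof (rule groupI)
  fix z assume "z \<in> carrier circle_group"
  then show "\<exists>w\<in>carrier circle_group. w \<otimes>\<^bsub>circle_group\<^esub> z = \<one>\<^bsub>circle_group\<^esub>"
    by (intro bexI[of _ "inverse z"]) (auto simp: norm_inverse intro!: left_inverse)
qed (auto simp: norm_mult)

lemma group_K: "group K_group"
  by (intro DirProd_group group_circle group_Sp)

lemma K_group_carrier: "(z, k) \<in> carrier K_group \<longleftrightarrow> norm z = 1 \<and> k ** qadj k = mat 1"
  by (auto simp: DirProd_def)

lemma K_group_mult: "(z, k) \<otimes>\<^bsub>K_group\<^esub> (w, l) = (z * w, k ** l)"
  by (simp add: DirProd_def)

lemma K_group_one: "\<one>\<^bsub>K_group\<^esub> = (1, mat 1)"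
  by (simp add: DirProd_def)

lemma cnj_mult_unit: "norm z = 1 \<Longrightarrow> cnj z * z = 1" "norm z = 1 \<Longrightarrow> z * cnj z = 1"
  by (simp_all add: complex_norm_square[symmetric] mult.commute)

text \<open>The abstract group inverse is characterised only on the carrier. This total formula
  agrees with it there and is visibly continuous; \<open>KN_inv\<close> does the same for the
  semidirect product.\<close>

definition K_inv :: "complex \<times> (quat^'n^'n) \<Rightarrow> complex \<times> (quat^'n^'n)" where
  "K_inv a = (cnj (fst a), qadj (snd a))"

lemma K_inv_carrier: "a \<in> carrier K_group \<Longrightarrow> K_inv a \<in> carrier K_group"
  by (cases a) (simp add: K_inv_def K_group_carrier Sp_left_inverse)

lemma K_inv: "a \<in> carrier K_group \<Longrightarrow> inv\<^bsub>K_group\<^esub> a = K_inv a"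
  by (intro group.inv_equality[OF group_K] K_inv_carrier)
    (auto simp: K_inv_def DirProd_def Sp_left_inverse cnj_mult_unit)

section \<open>The nilpotent group\<close>

text \<open>Matrices act on columns from the left, so the quaternionic scalars commuting with them
  act from the right.\<close>

definition rmul :: "quat^'n \<Rightarrow> quat \<Rightarrow> quat^'n" where
  "rmul v a = (\<chi> b. v $ b * a)"

lemma rmul_nth [simp]: "rmul v a $ i = v $ i * a"
  by (simp add: rmul_def)

lemma rmul_simps:
  "rmul (v + w) a = rmul v a + rmul w a" "rmul (r *\<^sub>R v) a = r *\<^sub>R rmul v a"
  "rmul (- v) a = - rmul v a" "rmul v 1 = v" "rmul 0 a = 0"
  "rmul (rmul v a) b = rmul v (a * b)" "rmul v (- a) = - rmul v a"
  by (simp_all add: vec_eq_iff distrib_right mult.assoc)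

lemma matrix_vector_rmul: "k *v rmul v a = rmul (k *v v) a"
  by (simp add: vec_eq_iff matrix_vector_nth sum_distrib_right mult.assoc)

lemma norm_rmul: "norm (rmul v a) = norm v * norm a"
  by (simp add: norm_vec_def norm_mult L2_set_left_distrib)

lemma outer_i_nth [simp]: "outer_i u v $ i $ j = u $ i * quat_of_complex \<i> * qcnj (v $ j)"
  by (simp add: outer_i_def)

lemma outer_i_add:
  "outer_i (u + u') v = outer_i u v + outer_i u' v" "outer_i u (v + v') = outer_i u v + outer_i u v'"
  "outer_i (r *\<^sub>R u) v = r *\<^sub>R outer_i u v" "outer_i u (r *\<^sub>R v) = r *\<^sub>R outer_i u v"
  by (simp_all add: vec_eq_iff algebra_simps)

lemma qform_add:
  "qform (u + u') v = qform u v + qform u' v" "qform u (v + v') = qform u v + qform u v'"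
  "qform (r *\<^sub>R u) v = r *\<^sub>R qform u v" "qform u (r *\<^sub>R v) = r *\<^sub>R qform u v"
  by (simp_all add: qform_def algebra_simps sum.distrib scaleR_sum_right)

text \<open>The conjugate of \<open>i\<close> is \<open>- i\<close>, hence the sign. It makes
  \<open>outer_i u v - outer_i v u\<close> hermitian, as the bracket requires.\<close>

lemma qadj_outer_i: "qadj (outer_i u v) = - outer_i v u"
  by (simp add: vec_eq_iff qcnj_mult mult.assoc)

lemma qcnj_qform: "qcnj (qform u v) = qform v u"
  by (simp add: qform_def qcnj_sum qcnj_mult)

lemma outer_i_matrix: "outer_i (k *v u) (l *v v) = k ** outer_i u v ** qadj l"
proof -
  have "(k ** outer_i u v ** qadj l) $ i $ j = outer_i (k *v u) (l *v v) $ i $ j" for i j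
    by (simp add: matrix_mult_nth matrix_vector_nth qcnj_sum qcnj_mult sum_distrib_left sum_distrib_right mult.assoc)
  then show ?thesis
    by (simp add: vec_eq_iff)
qed

lemma qform_adjoint: "qform (k *v u) v = qform u (qadj k *v v)"
  by (simp add: qform_def matrix_vector_nth qcnj_sum qcnj_mult sum_distrib_left sum_distrib_right
      mult.assoc) (subst sum.swap, simp)

lemma qform_rmul: "qform (rmul u a) (rmul v b) = qcnj a * qform u v * b"
  by (simp add: qform_def qcnj_mult sum_distrib_left sum_distrib_right mult.assoc)

lemma qRe_sum: "qRe (sum f A) = (\<Sum>a\<in>A. qRe (f a))"
  by (induction A rule: infinite_finite_induct) auto

lemma qRe_qform: "qRe (qform u v) = inner u v"
  by (simp add: qform_def qRe_sum inner_vec_def inner_quat_def)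

lemma trace_quat_simps:
  fixes A B :: "'a::real_algebra_1^'n^'n"
  shows "trace (A + B) = trace A + trace B" "trace (A - B) = trace A - trace B"
    "trace (r *\<^sub>R A) = r *\<^sub>R trace A" "trace (- A) = - trace A" "trace (0 :: 'a^'n^'n) = 0"
    "trace (mat a :: 'a^'n^'n) = real CARD('n) *\<^sub>R a"
  by (simp_all add: trace_def sum.distrib sum_subtractf scaleR_sum_right sum_negf mat_def)
    (simp add: scaleR_conv_of_real)

text \<open>Over the quaternions only the real part of the trace is cyclic. For hermitian matrices
  this is enough, since their trace is real.\<close>

lemma qRe_trace_commute:
  "qRe (trace ((A :: quat^'n^'m) ** (B :: quat^'m^'n))) = qRe (trace (B ** A))"
  unfolding trace_def matrix_mult_nth qRe_sum by (subst sum.swap) (simp add: algebra_simps)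

lemma trace_hermitian:
  assumes "qadj A = A"
  shows "trace A = of_real (qRe (trace A))"
proof -
  have "qcnj (trace A) = trace (qadj A)"
    by (simp add: trace_def qcnj_sum)
  then show ?thesis
    using qcnj_eq_self_iff assms by metis
qed

lemma mat_simps:
  "mat (a + b) = mat a + (mat b :: 'a::real_algebra_1^'n^'n)"
  "mat (r *\<^sub>R a) = r *\<^sub>R (mat a :: 'a^'n^'n)" "mat (- a) = - (mat a :: 'a^'n^'n)"
  by (simp_all add: vec_eq_iff mat_def)

lemma trace_free_simps:
  fixes A B :: "quat^'n^'n"
  shows "trace_free (A + B) = trace_free A + trace_free B"
    "trace_free (r *\<^sub>R A) = r *\<^sub>R trace_free A" "trace_free (- A) = - trace_free A"
    "trace_free (0 :: quat^'n^'n) = 0"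
  by (simp_all add: trace_free_def trace_quat_simps mat_simps algebra_simps)

lemma trace_free_H0:
  assumes "qadj A = (A :: quat^'n^'n)"
  shows "trace_free A \<in> H0"
proof -
  have "trace A = of_real (qRe (trace A))" by (rule trace_hermitian[OF assms])
  then have "qcnj (trace A) = trace A" by (metis qcnj_simps(8))
  then show ?thesis
    using assms by (simp add: trace_free_def H0_def trace_quat_simps)
qed

lemma Sp_conj_H0:
  fixes A k :: "quat^'n^'n"
  assumes "k ** qadj k = mat 1" "qadj A = A"
  shows "qadj (k ** A ** qadj k) = k ** A ** qadj k" "trace (k ** A ** qadj k) = trace A"
proof -
  show *: "qadj (k ** A ** qadj k) = k ** A ** qadj k"
    by (simp add: qadj_mult assms matrix_mul_assoc)
  have "qRe (trace (k ** A ** qadj k)) = qRe (trace (qadj k ** k ** A))"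
    using qRe_trace_commute[of "k ** A" "qadj k"] by (simp add: matrix_mul_assoc)
  then show "trace (k ** A ** qadj k) = trace A"
    using trace_hermitian[OF *] trace_hermitian[OF assms(2)] Sp_left_inverse[OF assms(1)] by simp
qed

lemma mat_of_real_commute: "k ** mat (of_real r) = mat (of_real r) ** (k :: quat^'n^'n)"
proof -
  have "mat (of_real r) = r *\<^sub>R (mat 1 :: quat^'n^'n)"
    by (simp add: vec_eq_iff mat_def quat_eq_iff)
  then show ?thesis by (simp add: matrix_scaleR_mult)
qed

lemma trace_free_conj:
  fixes A k :: "quat^'n^'n"
  assumes "k ** qadj k = mat 1" "qadj A = A"
  shows "trace_free (k ** A ** qadj k) = k ** trace_free A ** qadj k"
proof -
  have "k ** mat (trace A) ** qadj k = mat (trace A) ** (k ** qadj k)"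
    by (subst (1 2) trace_hermitian[OF assms(2)]) (simp add: mat_of_real_commute matrix_mul_assoc)
  then show ?thesis
    by (simp add: trace_free_def Sp_conj_H0[OF assms] matrix_diff_distrib matrix_scaleR_mult assms)
qed

lemma n_bracket_alt:
  "n_bracket X Y = ((trace_free (outer_i (snd X) (snd Y) - outer_i (snd Y) (snd X)),
     qform (snd X) (snd Y) - qform (snd Y) (snd X)), 0)"
  by (simp add: n_bracket_def split_beta)

lemma n_bracket_bilinear:
  "n_bracket (X + X') Y = n_bracket X Y + n_bracket X' Y"
  "n_bracket X (Y + Y') = n_bracket X Y + n_bracket X Y'"
  "n_bracket (r *\<^sub>R X) Y = r *\<^sub>R n_bracket X Y" "n_bracket X (r *\<^sub>R Y) = r *\<^sub>R n_bracket X Y"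
  by (simp_all add: n_bracket_alt outer_i_add qform_add prod_eq_iff trace_free_simps(1)[symmetric]
      trace_free_simps(2)[symmetric] algebra_simps)

lemma n_bracket_simps [simp]:
  "n_bracket (n_bracket X Y) Z = 0" "n_bracket X (n_bracket Y Z) = 0" "n_bracket X X = 0"
  "n_bracket 0 X = 0" "n_bracket X 0 = 0"
  "n_bracket (- X) Y = - n_bracket X Y" "n_bracket X (- Y) = - n_bracket X Y"
proof -
  show 0: "n_bracket 0 X = 0" "n_bracket X 0 = 0" for X :: "'n::finite nalg"
    using n_bracket_bilinear(3)[of 0 X X] n_bracket_bilinear(4)[of X 0 X] by simp_all
  have "n_bracket (0, 0) X = 0" "n_bracket X (0, 0) = 0"  for X :: "'n::finite nalg"
    using 0[of X] by (simp_all add: zero_prod_def)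
  then show "n_bracket (n_bracket X Y) Z = 0" "n_bracket X (n_bracket Y Z) = 0"
    by (simp_all add: n_bracket_alt zero_prod_def)
  show "n_bracket X X = 0"
    by (simp add: n_bracket_alt trace_free_simps zero_prod_def)
  show "n_bracket (- X) Y = - n_bracket X Y" "n_bracket X (- Y) = - n_bracket X Y"
    using n_bracket_bilinear(3)[of "- 1" X Y] n_bracket_bilinear(4)[of X "- 1" Y] by simp_all
qed

lemma n_bracket_closed: "n_bracket X Y \<in> lie_algebra_n"
  using qcnj_qform[of "snd X" "snd Y"]
  by (auto simp: n_bracket_alt lie_algebra_n_def Im_quat_def quat_eq_iff qadj_outer_i
      intro!: trace_free_H0)

lemma subspace_lie_algebra_n: "subspace lie_algebra_n"
  by (auto simp: subspace_def lie_algebra_n_def H0_def Im_quat_def zero_prod_def trace_quat_simps)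

lemma N_group_simps [simp]:
  "carrier N_group = lie_algebra_n" "mult N_group X Y = X + Y + (1/2) *\<^sub>R n_bracket X Y"
  "one N_group = 0"
  by (simp_all add: N_group_def)

text \<open>Double brackets vanish, so both ways of multiplying three elements give their sum plus
  half of the three pairwise brackets. The inverse is the negative because
  \<open>n_bracket X X = 0\<close>.\<close>

lemma group_N: "group N_group"
proof (rule groupI)
  fix X Y Z :: "'n::finite nalg"
  assume X: "X \<in> carrier N_group"
  show "X \<otimes>\<^bsub>N_group\<^esub> Y \<in> carrier N_group" if "Y \<in> carrier N_group"
    using X that n_bracket_closed[of X Y]
    by (auto intro!: subspace_add[OF subspace_lie_algebra_n] subspace_scale[OF subspace_lie_algebra_n])
  show "X \<otimes>\<^bsub>N_group\<^esub> Y \<otimes>\<^bsub>N_group\<^esub> Z = X \<otimes>\<^bsub>N_group\<^esub> (Y \<otimes>\<^bsub>N_group\<^esub> Z)"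
    by (simp add: n_bracket_bilinear algebra_simps)
  show "\<exists>Y\<in>carrier N_group. Y \<otimes>\<^bsub>N_group\<^esub> X = \<one>\<^bsub>N_group\<^esub>"
    using X subspace_lie_algebra_n by (intro bexI[of _ "- X"]) (auto intro: subspace_neg)
qed (auto intro: subspace_0[OF subspace_lie_algebra_n])

lemma N_inv: "X \<in> lie_algebra_n \<Longrightarrow> inv\<^bsub>N_group\<^esub> X = - X"
  by (intro group.inv_equality[OF group_N]) (auto intro: subspace_neg[OF subspace_lie_algebra_n])

section \<open>The action of \<open>K\<close> by isometric automorphisms\<close>

lemma K_action_simp:
  "K_action (z, k) ((A, q), v) = ((k ** A ** qadj k,
     quat_of_complex z * q * quat_of_complex (cnj z)), rmul (k *v v) (quat_of_complex (cnj z)))"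
  by (simp add: K_action_def rmul_def)

lemma K_action_alt:
  "K_action a X = ((snd a ** fst (fst X) ** qadj (snd a),
     quat_of_complex (fst a) * snd (fst X) * quat_of_complex (cnj (fst a))),
     rmul (snd a *v snd X) (quat_of_complex (cnj (fst a))))"
  by (cases a; cases X; cases "fst X") (simp add: K_action_simp)

lemma K_action_linear:
  "K_action a (X + Y) = K_action a X + K_action a Y"
  "K_action a (r *\<^sub>R X) = r *\<^sub>R K_action a X"
proof -
  have *: "k *v (r *\<^sub>R v) = r *\<^sub>R (k *v v)" for k :: "quat^'n^'n" and v
    by (simp add: vec_eq_iff matrix_vector_nth scaleR_sum_right)
  show "K_action a (X + Y) = K_action a X + K_action a Y"
    "K_action a (r *\<^sub>R X) = r *\<^sub>R K_action a X"
    by (simp_all add: K_action_alt prod_eq_iff matrix_add_rdistrib matrix_add_ldistrib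
        matrix_vector_right_distrib rmul_simps algebra_simps matrix_scaleR_mult *)
qed

lemma K_action_0 [simp]: "K_action a 0 = 0"
  using K_action_linear(2)[of a 0 0] by simp

lemma K_action_closed:
  assumes "a \<in> carrier K_group" "X \<in> lie_algebra_n"
  shows "K_action a X \<in> lie_algebra_n"
proof -
  obtain z k A q v where a: "a = (z, k)" and X: "X = ((A, q), v)"
    by (metis prod.exhaust)
  have "qRe (quat_of_complex z * q * quat_of_complex (cnj z)) = (norm z)\<^sup>2 * qRe q"
    by (subst cmod_power2) (simp add: power2_eq_square algebra_simps)
  then show ?thesis
    using assms Sp_conj_H0[of k A]
    by (simp add: a X K_action_simp lie_algebra_n_def H0_def Im_quat_def K_group_carrier)
qed

text \<open>The circle factor commutes with the \<open>i\<close> inside \<open>outer_i\<close> and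
  cancels there, while it conjugates \<open>qform\<close>, which is how the circle acts on the
  imaginary coordinate. The symplectic factor conjugates \<open>outer_i\<close> and drops out of
  \<open>qform\<close>.\<close>

lemma K_action_bracket:
  assumes "a \<in> carrier K_group"
  shows "n_bracket (K_action a X) (K_action a Y) = K_action a (n_bracket X Y)"
proof -
  obtain z k where a: "a = (z, k)" by force
  with assms have z: "norm z = 1" and k: "k ** qadj k = mat 1" by (auto simp: K_group_carrier)
  have *: "outer_i (rmul u (quat_of_complex (cnj z))) (rmul v (quat_of_complex (cnj z))) = outer_i u v"
    for u v
  proof -
    have "cnj z * \<i> * z = \<i>"
      using cnj_mult_unit(1)[OF z] by (simp add: algebra_simps)
    then have "quat_of_complex (cnj z) * quat_of_complex \<i> * quat_of_complex z = quat_of_complex \<i>"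
      by (metis quat_of_complex_simps(4))
    then show ?thesis
      by (simp add: vec_eq_iff qcnj_mult) (metis mult.assoc)
  qed
  have **: "outer_i (k *v u) (k *v v) - outer_i (k *v v) (k *v u) =
      k ** (outer_i u v - outer_i v u) ** qadj k" for u v
    by (simp add: outer_i_matrix matrix_diff_distrib)
  have "qform (k *v u) (k *v v) = qform u v" for u v
    by (simp add: qform_adjoint matrix_vector_mul_assoc Sp_left_inverse[OF k])
  then show ?thesis
    by (simp add: a n_bracket_alt K_action_alt * ** trace_free_conj[OF k] qadj_outer_i
        qform_rmul matrix_vector_mult_0_right rmul_simps algebra_simps)
qed

lemma K_action_mult:
  assumes "a \<in> carrier K_group"
  shows "K_action a (X \<otimes>\<^bsub>N_group\<^esub> Y) = K_action a X \<otimes>\<^bsub>N_group\<^esub> K_action a Y"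
  by (simp add: K_action_linear K_action_bracket[OF assms])

lemma quat_of_complex_commute:
  "quat_of_complex z * quat_of_complex w = quat_of_complex w * quat_of_complex z"
  by (simp add: quat_eq_iff)

lemma K_action_comp: "K_action (a \<otimes>\<^bsub>K_group\<^esub> b) X = K_action a (K_action b X)"
  by (cases a; cases b)
    (simp add: K_group_mult K_action_alt  qadj_mult matrix_mul_assoc matrix_vector_rmul rmul_simps
      matrix_vector_mul_assoc mult.assoc quat_of_complex_commute)

lemma K_action_one: "K_action \<one>\<^bsub>K_group\<^esub> X = X"
  by (simp add: K_group_one K_action_alt rmul_simps)

lemma norm_K_action:
  fixes X :: "'n::finite nalg"
  assumes "a \<in> carrier K_group"
  shows "norm (snd (K_action a X)) = norm (snd X)" 
    "norm (fst (fst (K_action a X))) = norm (fst (fst X))"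
    "norm (snd (fst (K_action a X))) = norm (snd (fst X))"
    "norm (K_action a X) = norm X"
proof -
  obtain z k where a: "a = (z, k)" by force
  with assms have z: "norm z = 1" and k: "k ** qadj k = mat 1" by (auto simp: K_group_carrier)
  have "norm (k *v v) = norm v" for v
    using Sp_norm_preserving[of "qadj k"] Sp_left_inverse[OF k] by simp
  then show 1: "norm (snd (K_action a X)) = norm (snd X)"
    by (simp add: a K_action_alt norm_rmul z)
  have *: "norm (k ** A) = norm A" for A :: "quat^'n^'n"
    using inner_matrix_mult_left[of k A "k ** A"]
    by (simp add: norm_eq_sqrt_inner matrix_mul_assoc Sp_left_inverse[OF k])
  have "norm (qadj A) = norm A" for A :: "quat^'n^'n"
    by (simp add: norm_eq_sqrt_inner inner_qadj)
  then have "norm (A ** qadj k) = norm A" for A :: "quat^'n^'n"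
    by (metis * qadj_mult qadj_simps(1))
  with * show 2: "norm (fst (fst (K_action a X))) = norm (fst (fst X))"
    by (simp add: a K_action_alt)
  show 3: "norm (snd (fst (K_action a X))) = norm (snd (fst X))"
    by (simp add: a K_action_alt norm_mult z)
  show "norm (K_action a X) = norm X"
    using 1 2 3 by (cases X; cases "K_action a X") (simp add: norm_prod_def)
qed

section \<open>Semidirect products\<close>

locale semidirect_product = K: group K + N: group N for K :: "'k monoid" and N :: "'x monoid" +
  fixes act :: "'k \<Rightarrow> 'x \<Rightarrow> 'x"
  assumes act_closed: "k \<in> carrier K \<Longrightarrow> x \<in> carrier N \<Longrightarrow> act k x \<in> carrier N"
    and act_hom: "k \<in> carrier K \<Longrightarrow> x \<in> carrier N \<Longrightarrow> y \<in> carrier N \<Longrightarrow>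
      act k (x \<otimes>\<^bsub>N\<^esub> y) = act k x \<otimes>\<^bsub>N\<^esub> act k y"
    and act_comp: "k \<in> carrier K \<Longrightarrow> l \<in> carrier K \<Longrightarrow> x \<in> carrier N \<Longrightarrow>
      act (k \<otimes>\<^bsub>K\<^esub> l) x = act k (act l x)"
    and act_one: "x \<in> carrier N \<Longrightarrow> act \<one>\<^bsub>K\<^esub> x = x"
begin

lemma act_N_one: "k \<in> carrier K \<Longrightarrow> act k \<one>\<^bsub>N\<^esub> = \<one>\<^bsub>N\<^esub>"
  using act_hom[of k "\<one>\<^bsub>N\<^esub>" "\<one>\<^bsub>N\<^esub>"] act_closed[of k "\<one>\<^bsub>N\<^esub>"]
    N.r_cancel_one'[of "act k \<one>\<^bsub>N\<^esub>" "act k \<one>\<^bsub>N\<^esub>"] by simp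

lemma left_inverse:
  assumes "k \<in> carrier K" "x \<in> carrier N"
  shows "(inv\<^bsub>K\<^esub> k, act (inv\<^bsub>K\<^esub> k) (inv\<^bsub>N\<^esub> x)) \<otimes>\<^bsub>semidirect K N act\<^esub> (k, x) =
    \<one>\<^bsub>semidirect K N act\<^esub>"
  using assms act_hom[of "inv\<^bsub>K\<^esub> k" "inv\<^bsub>N\<^esub> x" x]
  by (simp add: semidirect_def act_N_one)

lemma group_semidirect: "group (semidirect K N act)"
proof (rule groupI)
  fix g assume "g \<in> carrier (semidirect K N act)"
  then obtain k x where "g = (k, x)" "k \<in> carrier K" "x \<in> carrier N"
    by (auto simp: semidirect_def)
  then show "\<exists>h\<in>carrier (semidirect K N act). h \<otimes>\<^bsub>semidirect K N act\<^esub> g = \<one>\<^bsub>semidirect K N act\<^esub>"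
    using left_inverse[of k x]
    by (intro bexI[of _ "(inv\<^bsub>K\<^esub> k, act (inv\<^bsub>K\<^esub> k) (inv\<^bsub>N\<^esub> x))"]) (auto simp: semidirect_def act_closed)
qed (auto simp: semidirect_def act_closed act_hom act_comp act_one K.m_assoc N.m_assoc)

lemma semidirect_inv:
  assumes "k \<in> carrier K" "x \<in> carrier N"
  shows "inv\<^bsub>semidirect K N act\<^esub> (k, x) = (inv\<^bsub>K\<^esub> k, act (inv\<^bsub>K\<^esub> k) (inv\<^bsub>N\<^esub> x))"
  using assms left_inverse[OF assms]
  by (intro group.inv_equality[OF group_semidirect]) (auto simp: semidirect_def act_closed)

end

interpretation KN: semidirect_product "K_group :: (complex \<times> (quat^'n^'n)) monoid" N_group K_action
  by (intro semidirect_product.intro semidirect_product_axioms.intro group_K group_N K_action_mult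
      K_action_comp K_action_one) (simp_all only: N_group_simps K_action_closed)

lemma KN_carrier: "(a, X) \<in> carrier KN_group \<longleftrightarrow> a \<in> carrier K_group \<and> X \<in> lie_algebra_n"
  by (simp add: semidirect_def)

lemma KN_mult: "(a, X) \<otimes>\<^bsub>KN_group\<^esub> (b, Y) =
    (a \<otimes>\<^bsub>K_group\<^esub> b, X \<otimes>\<^bsub>N_group\<^esub> K_action a Y)"
  by (simp add: semidirect_def)

definition KN_inv :: "(complex \<times> (quat^'n^'n)) \<times> 'n::finite nalg \<Rightarrow> (complex \<times> (quat^'n^'n)) \<times> 'n nalg" where
  "KN_inv g = (K_inv (fst g), K_action (K_inv (fst g)) (- snd g))"

lemma KN_inv:
  assumes "g \<in> carrier KN_group"
  shows "inv\<^bsub>KN_group\<^esub> g = KN_inv g"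
  using assms by (cases g) (simp add: KN_carrier KN.semidirect_inv K_inv N_inv KN_inv_def)

declare carrier_DirProd [simp del]

section \<open>Continuity and compactness\<close>

lemma continuous_on_matrix_mult [continuous_intros]:
  fixes f :: "'b::topological_space \<Rightarrow> 'a::real_normed_algebra_1^'n^'m"
  assumes "continuous_on S f" "continuous_on S g"
  shows "continuous_on S (\<lambda>x. f x ** g x)"
  unfolding matrix_matrix_mult_def by (intro continuous_intros assms)

lemma continuous_on_matrix_vector_mult [continuous_intros]:
  fixes f :: "'b::topological_space \<Rightarrow> 'a::real_normed_algebra_1^'n^'m"
  assumes "continuous_on S f" "continuous_on S g"
  shows "continuous_on S (\<lambda>x. f x *v g x)"
  unfolding matrix_vector_mult_def by (intro continuous_intros assms)

lemma linear_qcnj: "linear qcnj"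
  by (rule linearI) simp_all

lemma linear_quat_of_complex: "linear quat_of_complex"
  by (rule linearI) (simp_all add: quat_eq_iff)

lemma linear_qadj: "linear (qadj :: quat^'n^'m \<Rightarrow> _)"
  by (rule linearI) simp_all

lemma linear_cadj: "linear (cadj :: complex^'n^'m \<Rightarrow> _)"
  by (rule linearI) (simp_all add: vec_eq_iff)

lemma linear_mat: "linear (mat :: quat \<Rightarrow> quat^'n^'n)"
  by (rule linearI) (simp_all add: mat_simps)

lemma linear_trace: "linear (trace :: quat^'n^'n \<Rightarrow> quat)"
  by (rule linearI) (simp_all add: trace_quat_simps)

lemmas continuous_on_linear_maps [continuous_intros] =
  bounded_linear.continuous_on[OF linear_qcnj[THEN linear_conv_bounded_linear[THEN iffD1]]]
  bounded_linear.continuous_on[OF linear_quat_of_complex[THEN linear_conv_bounded_linear[THEN iffD1]]]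
  bounded_linear.continuous_on[OF linear_qadj[THEN linear_conv_bounded_linear[THEN iffD1]]]
  bounded_linear.continuous_on[OF linear_cadj[THEN linear_conv_bounded_linear[THEN iffD1]]]
  bounded_linear.continuous_on[OF linear_mat[THEN linear_conv_bounded_linear[THEN iffD1]]]
  bounded_linear.continuous_on[OF linear_trace[THEN linear_conv_bounded_linear[THEN iffD1]]]

lemma continuous_on_rmul [continuous_intros]:
  "continuous_on S f \<Longrightarrow> continuous_on S g \<Longrightarrow> continuous_on S (\<lambda>x. rmul (f x) (g x))"
  unfolding rmul_def by (intro continuous_intros)

lemma continuous_on_n_bracket [continuous_intros]:
  "continuous_on S f \<Longrightarrow> continuous_on S g \<Longrightarrow> continuous_on S (\<lambda>x. n_bracket (f x) (g x))"
  unfolding n_bracket_alt trace_free_def outer_i_def qform_def by (intro continuous_intros)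

lemma continuous_on_K_action [continuous_intros]:
  "continuous_on S f \<Longrightarrow> continuous_on S g \<Longrightarrow> continuous_on S (\<lambda>x. K_action (f x) (g x))"
  unfolding K_action_alt by (intro continuous_intros)

lemma continuous_on_K_inv [continuous_intros]:
  "continuous_on S f \<Longrightarrow> continuous_on S (\<lambda>x. K_inv (f x))"
  unfolding K_inv_def by (intro continuous_intros)

lemma continuous_on_K_mult [continuous_intros]:
  "continuous_on S f \<Longrightarrow> continuous_on S g \<Longrightarrow> continuous_on S (\<lambda>x. f x \<otimes>\<^bsub>K_group\<^esub> g x)"
  unfolding DirProd_def by (simp add: split_beta) (intro continuous_intros)

lemma continuous_on_KN_mult [continuous_intros]:
  "continuous_on S f \<Longrightarrow> continuous_on S g \<Longrightarrow> continuous_on S (\<lambda>x. f x \<otimes>\<^bsub>KN_group\<^esub> g x)"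
  unfolding semidirect_def by (simp add: split_beta) (intro continuous_intros)

lemma continuous_on_KN_inv [continuous_intros]:
  "continuous_on S f \<Longrightarrow> continuous_on S (\<lambda>x. KN_inv (f x))"
  unfolding KN_inv_def by (intro continuous_intros)

text \<open>Every element has the same Hilbert-Schmidt norm as the identity, which gives
  boundedness.\<close>

lemma compact_Sp: "compact (carrier (Sp_group :: (quat^'n^'n) monoid))"
proof -
  have "closed {k :: quat^'n^'n. k ** qadj k = mat 1}"
    by (intro closed_Collect_eq continuous_intros)
  moreover have "norm k \<le> norm (mat 1 :: quat^'n^'n)" if "k ** qadj k = mat 1" for k :: "quat^'n^'n"
    using inner_matrix_mult_left[of k "mat 1" k] Sp_left_inverse[OF that]
    by (simp add: norm_eq_sqrt_inner)
  then have "bounded {k :: quat^'n^'n. k ** qadj k = mat 1}"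
    unfolding bounded_iff by blast
  ultimately show ?thesis
    by (simp add: compact_eq_bounded_closed)
qed

lemma compact_K: "compact (carrier (K_group :: (complex \<times> (quat^'n^'n)) monoid))"
  unfolding DirProd_def using compact_Sp by (auto intro!: compact_Times)

lemma closed_lie_algebra_n: "closed (lie_algebra_n :: 'n::finite nalg set)"
  by (intro closed_subspace subspace_lie_algebra_n)

lemma closed_KN: "closed (carrier (KN_group :: ((complex \<times> (quat^'n^'n)) \<times> 'n::finite nalg) monoid))"
  by (simp only: semidirect_def partial_object.simps N_group_simps)
    (intro closed_Times closed_lie_algebra_n compact_imp_closed[OF compact_K])

text \<open>These compact sets exhaust the group. As \<open>K\<close> and \<sigma> act isometrically
  on the Lie algebra, left translations by \<open>K\<close> and the map \<sigma> preserve
  them.\<close>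

definition KN_ball :: "real \<Rightarrow> ((complex \<times> (quat^'n^'n)) \<times> 'n::finite nalg) set" where
  "KN_ball r = carrier K_group \<times> (lie_algebra_n \<inter> cball 0 r)"

lemma compact_KN_ball: "compact (KN_ball r)"
  unfolding KN_ball_def by (intro compact_Times compact_K closed_Int_compact closed_lie_algebra_n) simp

lemma KN_ball_subset: "KN_ball r \<subseteq> carrier KN_group"
  by (auto simp: KN_ball_def semidirect_def)

lemma KN_eq_Union_ball: "carrier KN_group = (\<Union>n. KN_ball (real n))"
proof -
  have "\<exists>n. norm X \<le> real n" for X :: "'a nalg" by (rule real_arch_simple)
  then show ?thesis by (auto simp: KN_ball_def semidirect_def)
qed

section \<open>Sufficiency: the automorphism and Gelfand's trick\<close>

section \<open>An automorphism reversing the central variables\<close>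

definition qj :: quat where "qj = Quat 0 0 1 0"

lemma qj_sel [simp]: "qRe qj = 0" "qIm1 qj = 0" "qIm2 qj = 1" "qIm3 qj = 0"
  by (simp_all add: qj_def)

text \<open>Right multiplication by \<open>j\<close> on \<open>V\<close> forces the rest through the
  bracket: \<open>j i\<close> times the conjugate of \<open>j\<close> is \<open>- i\<close>, so the
  hermitian part changes sign, and \<open>qform\<close> is conjugated by \<open>j\<close>, whose
  inverse is \<open>- j\<close>.\<close>

definition sigma_n :: "'n nalg \<Rightarrow> 'n::finite nalg" where
  "sigma_n X = ((- fst (fst X), - (qj * snd (fst X) * qj)), rmul (snd X) qj)"

text \<open>Moving \<open>j\<close> past a complex number conjugates it, so \<sigma> intertwines the
  action of \<open>z\<close> with that of its conjugate.\<close>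

definition sigma_K :: "complex \<times> (quat^'n^'n) \<Rightarrow> complex \<times> (quat^'n^'n)" where
  "sigma_K a = (cnj (fst a), snd a)"

definition sigma :: "(complex \<times> (quat^'n^'n)) \<times> 'n::finite nalg \<Rightarrow> (complex \<times> (quat^'n^'n)) \<times> 'n nalg" where
  "sigma g = (sigma_K (fst g), sigma_n (snd g))"

lemma continuous_on_sigma: "continuous_on S f \<Longrightarrow> continuous_on S (\<lambda>x. sigma (f x))"
  unfolding sigma_def sigma_K_def sigma_n_def by (intro continuous_intros)

lemma sigma_n_linear: "sigma_n (X + Y) = sigma_n X + sigma_n Y" "sigma_n (r *\<^sub>R X) = r *\<^sub>R sigma_n X"
  by (simp_all add: sigma_n_def rmul_simps algebra_simps)

lemma sigma_n_bracket:
  fixes X Y :: "'n::finite nalg"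
  shows "n_bracket (sigma_n X) (sigma_n Y) = sigma_n (n_bracket X Y)"
proof -
  have "qj * quat_of_complex \<i> * qcnj qj = - quat_of_complex \<i>"
    by (simp add: quat_eq_iff)
  then have "outer_i (rmul u qj) (rmul v qj) = - outer_i u v" for u v :: "quat^'n"
    by (simp add: vec_eq_iff qcnj_mult) (metis mult.assoc mult_minus_left mult_minus_right)
  moreover have "qcnj qj = - qj"
    by (simp add: quat_eq_iff)
  ultimately show ?thesis
    by (simp add: sigma_n_def n_bracket_alt trace_free_simps(3)[symmetric] qform_rmul rmul_simps
        left_diff_distrib right_diff_distrib)
qed

lemma sigma_n_closed: "X \<in> lie_algebra_n \<Longrightarrow> sigma_n X \<in> lie_algebra_n"
  by (auto simp: sigma_n_def lie_algebra_n_def H0_def Im_quat_def trace_quat_simps)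

lemma norm_sigma_n: "norm (sigma_n X) = norm X"
proof -
  have "norm qj = 1" by (simp add: norm_quat_def inner_quat_def)
  then show ?thesis
    by (cases X; cases "fst X") (simp add: sigma_n_def norm_prod_def norm_mult norm_rmul)
qed

lemma sigma_K_action: "sigma_n (K_action a X) = K_action (sigma_K a) (sigma_n X)"
proof -
  have *: "quat_of_complex (cnj w) * qj = qj * quat_of_complex w"
    "qj * quat_of_complex (cnj w) = quat_of_complex w * qj" for w
    by (simp_all add: quat_eq_iff)
  have "qj * (quat_of_complex w * (q * (quat_of_complex (cnj w) * qj))) =
      quat_of_complex (cnj w) * (qj * (q * (qj * quat_of_complex w)))" for w q
    using * by (metis (no_types) complex_cnj_cnj mult.assoc)
  then show ?thesis
    by (simp add: sigma_n_def sigma_K_def K_action_alt rmul_simps * matrix_vector_rmul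
        matrix_uminus_mult mult.assoc)
qed

lemma sigma_hom: "sigma (g \<otimes>\<^bsub>KN_group\<^esub> h) = sigma g \<otimes>\<^bsub>KN_group\<^esub> sigma h"
  by (cases g; cases h)
    (simp add: sigma_def KN_mult sigma_n_linear sigma_n_bracket[symmetric] sigma_K_action,
     simp add: sigma_K_def DirProd_def split_beta)

lemma sigma_K_closed: "a \<in> carrier K_group \<Longrightarrow> sigma_K a \<in> carrier K_group"
  by (cases a) (simp add: sigma_K_def K_group_carrier)

lemma sigma_closed: "g \<in> carrier KN_group \<Longrightarrow> sigma g \<in> carrier KN_group"
  by (cases g) (simp add: sigma_def KN_carrier sigma_K_closed sigma_n_closed)

lemma sigma_in_KN_ball: "g \<in> carrier KN_group \<Longrightarrow> sigma g \<in> KN_ball r \<longleftrightarrow> g \<in> KN_ball r"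
  by (cases g)
    (simp add: sigma_def KN_carrier sigma_K_closed sigma_n_closed KN_ball_def norm_sigma_n)

section \<open>Uniqueness of left invariant measures\<close>

text \<open>Haar measures are given by invariance on cosets, whereas substitution in integrals needs
  the image measure. The preimage of \<open>A\<close> under translation by \<open>x\<close> is the
  coset of \<open>A\<close> by \<open>inv x\<close>.\<close>

lemma distr_left_translation:
  fixes G (structure)
  assumes "group G" "space M = carrier G" "x \<in> carrier G" "(\<lambda>y. x \<otimes> y) \<in> measurable M M"
    and inv: "\<And>z A. z \<in> carrier G \<Longrightarrow> A \<in> sets M \<Longrightarrow> emeasure M (z <# A) = emeasure M A"
  shows "distr M M (\<lambda>y. x \<otimes> y) = M"
proof (rule measure_eqI)
  interpret group G by fact
  fix A assume "A \<in> sets (distr M M (\<lambda>y. x \<otimes> y))"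
  then have A: "A \<in> sets M" by simp
  then have sub: "A \<subseteq> carrier G"
    using assms(2) sets.sets_into_space by blast
  have "(\<lambda>y. x \<otimes> y) -` A \<inter> space M = inv x <# A"
  proof (intro equalityI subsetI)
    fix y assume "y \<in> (\<lambda>y. x \<otimes> y) -` A \<inter> space M"
    then have "x \<otimes> y \<in> A" "y = inv x \<otimes> (x \<otimes> y)"
      using assms(2,3) by (auto simp: m_assoc[symmetric])
    then show "y \<in> inv x <# A"
      unfolding l_coset_def by blast
  next
    fix y assume "y \<in> inv x <# A"
    then show "y \<in> (\<lambda>y. x \<otimes> y) -` A \<inter> space M"
      using assms(2,3) sub by (auto simp: l_coset_def m_assoc[symmetric])
  qed
  then show "emeasure (distr M M (\<lambda>y. x \<otimes> y)) A = emeasure M A"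
    using A assms by (simp add: emeasure_distr)
qed simp

text \<open>With \<open>w x = M {t. t x \<in> C}\<close> and \<open>h x y = f x * 1\<^sub>C (y x) / w x\<close>, the substitutions
  \<open>x \<mapsto> y\<^sup>-\<^sup>1 x\<close> and \<open>y \<mapsto> x y\<close> in the double integral of \<open>h\<close> give
  \<open>\<integral>f dP = P C * \<integral>f (y\<^sup>-\<^sup>1) / w (y\<^sup>-\<^sup>1) dM\<close>, whose second factor does not depend on \<open>P\<close>.\<close>

lemma left_invariant_measure_unique:
  fixes G (structure) and M N :: "'g measure"
  assumes "group G" and spM: "space M = carrier G" and sets_N: "sets N = sets M"
    and mult [measurable]: "(\<lambda>p. fst p \<otimes> snd p) \<in> measurable (M \<Otimes>\<^sub>M M) M"
    and invm [measurable]: "(\<lambda>x. inv x) \<in> measurable M M"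
    and M: "sigma_finite_measure M" "\<And>x. x \<in> carrier G \<Longrightarrow> distr M M (\<lambda>y. x \<otimes> y) = M"
    and N: "sigma_finite_measure N" "\<And>x. x \<in> carrier G \<Longrightarrow> distr N N (\<lambda>y. x \<otimes> y) = N"
    and C [measurable]: "C \<in> sets M" and NC: "emeasure N C = emeasure M C"
    and pos: "\<And>x. x \<in> carrier G \<Longrightarrow> 0 < emeasure M {t \<in> carrier G. t \<otimes> x \<in> C}"
    and fin: "\<And>x. x \<in> carrier G \<Longrightarrow> emeasure M {t \<in> carrier G. t \<otimes> x \<in> C} < \<infinity>"
  shows "N = M"
proof -
  interpret group G by fact
  have mult' [measurable]: "(\<lambda>y. f y \<otimes> g y) \<in> measurable L M"
    if [measurable]: "f \<in> measurable L M" "g \<in> measurable L M" for f g and L :: "'b measure"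
    using measurable_compose[OF measurable_Pair[OF that] mult] by simp
  define w where "w x = (\<integral>\<^sup>+t. indicator C (t \<otimes> x) \<partial>M)" for x
  have w_eq: "w x = emeasure M {t \<in> carrier G. t \<otimes> x \<in> C}" if "x \<in> carrier G" for x
  proof -
    have [measurable]: "x \<in> space M" using that spM by simp
    have "w x = (\<integral>\<^sup>+t. indicator {t \<in> space M. t \<otimes> x \<in> C} t \<partial>M)"
      unfolding w_def by (intro nn_integral_cong) (auto split: split_indicator)
    also have "\<dots> = emeasure M {t \<in> space M. t \<otimes> x \<in> C}"
      by (rule nn_integral_indicator) measurable
    finally show ?thesis by (simp add: spM)
  qed
  interpret M: sigma_finite_measure M by fact
  have [measurable]: "w \<in> borel_measurable M"
    unfolding w_def by measurable
  define J where "J A = (\<integral>\<^sup>+y. indicator A (inv y) / w (inv y) \<partial>M)" for A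
  have main: "emeasure P A = emeasure P C * J A"
    if P: "sigma_finite_measure P" "\<And>x. x \<in> carrier G \<Longrightarrow> distr P P (\<lambda>y. x \<otimes> y) = P"
      and sets_P: "sets P = sets M" and A: "A \<in> sets M" for P A
  proof -
    interpret P: sigma_finite_measure P by fact
    interpret PM: pair_sigma_finite P M by unfold_locales
    note sets_P [measurable_cong] A [measurable]
    have spP: "space P = carrier G" using sets_eq_imp_space_eq[OF sets_P] spM by simp
    have transl: "(\<integral>\<^sup>+y. f (x \<otimes> y) \<partial>L) = (\<integral>\<^sup>+y. f y \<partial>L)"
      if [measurable]: "f \<in> borel_measurable M" "x \<in> space M" and L: "distr L L (\<lambda>y. x \<otimes> y) = L"
        and [measurable_cong]: "sets L = sets M" for f x L
    proof -
      have "(\<integral>\<^sup>+y. f y \<partial>L) = (\<integral>\<^sup>+y. f y \<partial>distr L L (\<lambda>y. x \<otimes> y))" by (simp only: L)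
      also have "\<dots> = (\<integral>\<^sup>+y. f (x \<otimes> y) \<partial>L)" by (rule nn_integral_distr) measurable
      finally show ?thesis ..
    qed
    define h where "h x y = indicator A x * indicator C (y \<otimes> x) / w x" for x y
    have h [measurable]: "(\<lambda>p. h (f p) (g p)) \<in> borel_measurable L"
      if [measurable]: "f \<in> measurable L M" "g \<in> measurable L M" for f g and L :: "'b measure"
      unfolding h_def by measurable
    have "emeasure P A = (\<integral>\<^sup>+x. indicator A x \<partial>P)"
      by simp
    also have "\<dots> = (\<integral>\<^sup>+x. (\<integral>\<^sup>+y. h x y \<partial>M) \<partial>P)"
    proof (rule nn_integral_cong)
      fix x assume x: "x \<in> space P"
      then have [measurable]: "x \<in> space M" using spP spM by simp
      have x': "x \<in> carrier G" using x spP by simp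
      have "(\<integral>\<^sup>+y. h x y \<partial>M) = (\<integral>\<^sup>+y. (indicator A x / w x) * indicator C (y \<otimes> x) \<partial>M)"
        unfolding h_def by (intro nn_integral_cong) (auto split: split_indicator)
      also have "\<dots> = indicator A x / w x * w x"
        unfolding w_def by (rule nn_integral_cmult) measurable
      \<comment> \<open>Cancelling \<open>w x\<close> requires it to be positive and finite; this is
        where \<open>pos\<close> and \<open>fin\<close> enter.\<close>
      also have "\<dots> = indicator A x"
        using pos[OF x'] fin[OF x'] w_eq[OF x'] by (simp add: ennreal_divide_times mult_divide_eq_ennreal less_top)
      finally show "indicator A x = (\<integral>\<^sup>+y. h x y \<partial>M)" ..
    qed
    also have "\<dots> = (\<integral>\<^sup>+y. (\<integral>\<^sup>+x. h x y \<partial>P) \<partial>M)"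
      by (rule PM.Fubini'[symmetric]) measurable
    also have "\<dots> = (\<integral>\<^sup>+y. (\<integral>\<^sup>+x. h (inv y \<otimes> x) y \<partial>P) \<partial>M)"
    proof (rule nn_integral_cong)
      fix y assume y [measurable]: "y \<in> space M"
      then have "inv y \<in> space M" using spM by simp
      moreover have "(\<lambda>x. h x y) \<in> borel_measurable M" by measurable
      ultimately show "(\<integral>\<^sup>+x. h x y \<partial>P) = (\<integral>\<^sup>+x. h (inv y \<otimes> x) y \<partial>P)"
        using transl[of "\<lambda>x. h x y" "inv y" P] P(2)[of "inv y"] sets_P spM by simp
    qed
    also have "\<dots> = (\<integral>\<^sup>+x. (\<integral>\<^sup>+y. h (inv y \<otimes> x) y \<partial>M) \<partial>P)"
      by (rule PM.Fubini') measurable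
    also have "\<dots> = (\<integral>\<^sup>+x. (\<integral>\<^sup>+y. h (inv (x \<otimes> y) \<otimes> x) (x \<otimes> y) \<partial>M) \<partial>P)"
    proof (rule nn_integral_cong)
      fix x assume x: "x \<in> space P"
      then have x' [measurable]: "x \<in> space M" using spP spM by simp
      have "(\<lambda>y. h (inv y \<otimes> x) y) \<in> borel_measurable M" by measurable
      then show "(\<integral>\<^sup>+y. h (inv y \<otimes> x) y \<partial>M) = (\<integral>\<^sup>+y. h (inv (x \<otimes> y) \<otimes> x) (x \<otimes> y) \<partial>M)"
        using transl[of "\<lambda>y. h (inv y \<otimes> x) y" x M] M(2)[of x] x' spM by simp
    qed
    also have "\<dots> = (\<integral>\<^sup>+x. (\<integral>\<^sup>+y. indicator C x * (indicator A (inv y) / w (inv y)) \<partial>M) \<partial>P)"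
    proof (intro nn_integral_cong)
      fix x y assume "x \<in> space P" "y \<in> space M"
      then have *: "x \<in> carrier G" "y \<in> carrier G" using spP spM by auto
      then have "inv (x \<otimes> y) \<otimes> x = inv y" "x \<otimes> y \<otimes> inv y = x"
        by (simp_all add: inv_mult_group m_assoc)
      then show "h (inv (x \<otimes> y) \<otimes> x) (x \<otimes> y) = indicator C x * (indicator A (inv y) / w (inv y))"
        unfolding h_def by (auto split: split_indicator)
    qed
    also have "\<dots> = (\<integral>\<^sup>+x. indicator C x * J A \<partial>P)"
      unfolding J_def by (intro nn_integral_cong nn_integral_cmult) measurable
    also have "\<dots> = emeasure P C * J A"
      by (subst nn_integral_multc) auto
    finally show ?thesis .
  qed
  show ?thesis
  proof (rule measure_eqI)
    show "emeasure N A = emeasure M A" if "A \<in> sets N" for A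
      using main[OF N sets_N, of A] main[OF M refl, of A] NC sets_N that by simp
  qed (rule sets_N)
qed

text \<open>The order is four rather than two, because the square of \<sigma> is \<open>- 1\<close>
  on \<open>V\<close>. The cube of \<sigma> is therefore its inverse.\<close>

lemma sigma_sigma:
  fixes g :: "(complex \<times> (quat^'n^'n)) \<times> 'n::finite nalg"
  shows "sigma (sigma (sigma (sigma g))) = g"
proof -
  have "- (qj * - (qj * - (qj * - (qj * q * qj) * qj) * qj) * qj) = q" "qj * qj * qj * qj = 1" for q
    by (simp_all add: quat_eq_iff)
  then have "sigma_n (sigma_n (sigma_n (sigma_n X))) = X" for X :: "'n nalg"
    by (simp only: sigma_n_def fst_conv snd_conv rmul_simps minus_minus prod.collapse flip: mult.assoc)
  then show ?thesis
    by (simp only: sigma_def sigma_K_def fst_conv snd_conv complex_cnj_cnj prod.collapse)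
qed

section \<open>The Haar measure\<close>

locale KN_haar =
  fixes \<mu> :: "((complex \<times> (quat^'n^'n)) \<times> 'n::finite nalg) measure"
  assumes haar: "haar_measure KN_group \<mu>"
begin

lemma sets_mu: "sets \<mu> = sets (restrict_space borel (carrier KN_group))"
  using haar by (simp add: haar_measure_def)

lemma space_mu: "space \<mu> = carrier KN_group"
  using sets_eq_imp_space_eq[OF sets_mu] by (simp add: space_restrict_space)

lemma carrier_borel: "carrier (KN_group :: ((complex \<times> (quat^'n^'n)) \<times> 'n nalg) monoid) \<in> sets borel"
  by (intro borel_closed closed_KN)

lemma compact_in_sets: "compact C \<Longrightarrow> C \<subseteq> carrier KN_group \<Longrightarrow> C \<in> sets \<mu>"
  unfolding sets_mu using carrier_borel by (subst sets_restrict_space_iff) (auto intro: borel_compact)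

lemma open_in_sets: "open U \<Longrightarrow> U \<inter> carrier KN_group \<in> sets \<mu>"
  unfolding sets_mu using carrier_borel by (subst sets_restrict_space_iff) auto

lemma compact_finite: "compact C \<Longrightarrow> C \<subseteq> carrier KN_group \<Longrightarrow> emeasure \<mu> C < \<infinity>"
  using haar by (simp add: haar_measure_def)

lemma open_positive: "open U \<Longrightarrow> U \<inter> carrier KN_group \<noteq> {} \<Longrightarrow> emeasure \<mu> (U \<inter> carrier KN_group) > 0"
  using haar by (simp add: haar_measure_def)

lemma measurable_id_borel: "(\<lambda>x. x) \<in> measurable \<mu> borel"
  unfolding measurable_cong_sets[OF sets_mu refl]
  by (rule measurable_restrict_space1) simp

lemma measurable_continuous:
  fixes f :: "_ \<Rightarrow> 'b::topological_space"
  assumes "continuous_on (carrier KN_group) f"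
  shows "f \<in> measurable \<mu> borel"
  unfolding measurable_cong_sets[OF sets_mu refl]
  by (rule borel_measurable_continuous_on_restrict[OF assms])

lemma measurable_into:
  assumes "f \<in> measurable L borel" "\<And>x. x \<in> space L \<Longrightarrow> f x \<in> carrier KN_group"
  shows "f \<in> measurable L \<mu>"
  unfolding measurable_cong_sets[OF refl sets_mu]
  using assms by (intro measurable_restrict_space2) auto

text \<open>Multiplication is continuous, and by second countability the Borel sets of the product
  space are those of the product sigma-algebra.\<close>

lemma measurable_mult [measurable]: "(\<lambda>p. fst p \<otimes>\<^bsub>KN_group\<^esub> snd p) \<in> measurable (\<mu> \<Otimes>\<^sub>M \<mu>) \<mu>"
proof (rule measurable_into)
  have "(\<lambda>p. (fst p, snd p)) \<in> measurable (\<mu> \<Otimes>\<^sub>M \<mu>) (borel \<Otimes>\<^sub>M borel)"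
    by (intro measurable_Pair measurable_compose[OF _ measurable_id_borel] measurable_fst measurable_snd)
  moreover have "(\<lambda>p. fst p \<otimes>\<^bsub>KN_group\<^esub> snd p) \<in>
      borel_measurable (borel :: (((complex \<times> (quat^'n^'n)) \<times> 'n nalg) \<times> _) measure)"
    by (intro borel_measurable_continuous_onI continuous_intros)
  ultimately show "(\<lambda>p. fst p \<otimes>\<^bsub>KN_group\<^esub> snd p) \<in> measurable (\<mu> \<Otimes>\<^sub>M \<mu>) borel"
    unfolding borel_prod using measurable_compose by fastforce
  interpret group "KN_group :: ((complex \<times> (quat^'n^'n)) \<times> 'n nalg) monoid" by (rule KN.group_semidirect)
  show "\<And>x. x \<in> space (\<mu> \<Otimes>\<^sub>M \<mu>) \<Longrightarrow> fst x \<otimes>\<^bsub>KN_group\<^esub> snd x \<in> carrier KN_group"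
    by (auto simp: space_pair_measure space_mu)
qed

lemma measurable_inv [measurable]: "(\<lambda>x. inv\<^bsub>KN_group\<^esub> x) \<in> measurable \<mu> \<mu>"
proof -
  interpret group "KN_group :: ((complex \<times> (quat^'n^'n)) \<times> 'n nalg) monoid" by (rule KN.group_semidirect)
  have "KN_inv \<in> measurable \<mu> \<mu>"
    by (intro measurable_into measurable_continuous continuous_intros)
       (simp add: space_mu KN_inv[symmetric])
  then show ?thesis
    by (subst measurable_cong[where g=KN_inv]) (auto simp: space_mu KN_inv)
qed

lemma measurable_translate:
  assumes "x \<in> carrier KN_group"
  shows "(\<lambda>y. x \<otimes>\<^bsub>KN_group\<^esub> y) \<in> measurable \<mu> \<mu>" "(\<lambda>y. y \<otimes>\<^bsub>KN_group\<^esub> x) \<in> measurable \<mu> \<mu>"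
proof -
  have "x \<in> space \<mu>" using assms by (simp only: space_mu)
  then have "(\<lambda>y. (x, y)) \<in> measurable \<mu> (\<mu> \<Otimes>\<^sub>M \<mu>)" "(\<lambda>y. (y, x)) \<in> measurable \<mu> (\<mu> \<Otimes>\<^sub>M \<mu>)"
    by measurable
  from this[THEN measurable_compose, OF measurable_mult]
  show "(\<lambda>y. x \<otimes>\<^bsub>KN_group\<^esub> y) \<in> measurable \<mu> \<mu>" "(\<lambda>y. y \<otimes>\<^bsub>KN_group\<^esub> x) \<in> measurable \<mu> \<mu>"
    by (simp_all only: fst_conv snd_conv)
qed

lemma distr_translate:
  assumes "x \<in> carrier KN_group"
  shows "distr \<mu> \<mu> (\<lambda>y. x \<otimes>\<^bsub>KN_group\<^esub> y) = \<mu>"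
proof (rule distr_left_translation[OF KN.group_semidirect space_mu assms measurable_translate(1)[OF assms]])
  show "emeasure \<mu> (z <#\<^bsub>KN_group\<^esub> A) = emeasure \<mu> A" if "z \<in> carrier KN_group" "A \<in> sets \<mu>" for z A
    using haar that unfolding haar_measure_def by blast
qed

lemma KN_ball_sets: "KN_ball r \<in> sets \<mu>"
  by (intro compact_in_sets compact_KN_ball KN_ball_subset)

lemma KN_ball_finite: "emeasure \<mu> (KN_ball r) \<noteq> \<infinity>"
  using compact_finite[OF compact_KN_ball KN_ball_subset, of r] by simp

lemma sigma_finite_mu: "sigma_finite_measure \<mu>"
proof
  show "\<exists>A. countable A \<and> A \<subseteq> sets \<mu> \<and> \<Union> A = space \<mu> \<and> (\<forall>a\<in>A. emeasure \<mu> a \<noteq> \<infinity>)"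
    using KN_ball_sets KN_ball_finite
    by (intro exI[of _ "range (\<lambda>n. KN_ball (real n))"]) (auto simp: space_mu KN_eq_Union_ball)
qed

lemma sigma_measurable [measurable]: "sigma \<in> measurable \<mu> \<mu>"
  using sigma_closed
  by (intro measurable_into measurable_continuous continuous_on_sigma continuous_intros) (simp add: space_mu)

lemma distr_sigma: "distr \<mu> \<mu> sigma = \<mu>"
proof (rule left_invariant_measure_unique[where G=KN_group and C="KN_ball 1"])
  interpret group "KN_group :: ((complex \<times> (quat^'n^'n)) \<times> 'n nalg) monoid" by (rule KN.group_semidirect)
  let ?N = "distr \<mu> \<mu> sigma"
  show C: "KN_ball 1 \<in> sets \<mu>"
    by (rule KN_ball_sets)
  \<comment> \<open>Being isometric, \<sigma> has each ball as its own preimage. This gives the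
    image measure the same mass on the unit ball and finite mass on the exhaustion.\<close>
  have pre: "sigma -` KN_ball r \<inter> space \<mu> = KN_ball r" for r
    unfolding space_mu using sigma_in_KN_ball KN_ball_subset by blast
  show "emeasure ?N (KN_ball 1) = emeasure \<mu> (KN_ball 1)"
    by (simp add: emeasure_distr C pre)
  show "sigma_finite_measure ?N"
  proof
    have "emeasure ?N (KN_ball (real n)) \<noteq> \<infinity>" for n
      using KN_ball_finite by (simp only: emeasure_distr[OF sigma_measurable KN_ball_sets] pre) simp
    then show "\<exists>A. countable A \<and> A \<subseteq> sets ?N \<and> \<Union> A = space ?N \<and> (\<forall>a\<in>A. emeasure ?N a \<noteq> \<infinity>)"
      using KN_ball_sets
      by (intro exI[of _ "range (\<lambda>n. KN_ball (real n))"]) (auto simp: space_mu KN_eq_Union_ball)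
  qed
  show "distr ?N ?N (\<lambda>y. x \<otimes>\<^bsub>KN_group\<^esub> y) = ?N" if x: "x \<in> carrier KN_group" for x
  proof -
    \<comment> \<open>The preimage of \<open>x\<close>: translation by \<open>x\<close> after
      \<sigma> is \<sigma> after translation by \<open>x'\<close>.\<close>
    define x' where "x' = sigma (sigma (sigma x))"
    have x': "x' \<in> carrier KN_group" "sigma x' = x"
      unfolding x'_def using x by (simp_all add: sigma_closed sigma_sigma)
    have "distr ?N ?N (\<lambda>y. x \<otimes>\<^bsub>KN_group\<^esub> y) = distr ?N \<mu> (\<lambda>y. x \<otimes>\<^bsub>KN_group\<^esub> y)"
      by (intro distr_cong) auto
    also have "\<dots> = distr \<mu> \<mu> ((\<lambda>y. x \<otimes>\<^bsub>KN_group\<^esub> y) \<circ> sigma)"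
      using x by (intro distr_distr measurable_translate sigma_measurable)
    also have "(\<lambda>y. x \<otimes>\<^bsub>KN_group\<^esub> y) \<circ> sigma = sigma \<circ> (\<lambda>y. x' \<otimes>\<^bsub>KN_group\<^esub> y)"
      by (rule ext) (simp only: o_apply sigma_hom x'(2))
    also have "distr \<mu> \<mu> \<dots> = distr (distr \<mu> \<mu> (\<lambda>y. x' \<otimes>\<^bsub>KN_group\<^esub> y)) \<mu> sigma"
      using x' by (intro distr_distr[symmetric] measurable_translate sigma_measurable)
    finally show ?thesis
      by (simp only: distr_translate[OF x'(1)])
  qed
  fix x assume x: "x \<in> carrier (KN_group :: ((complex \<times> (quat^'n^'n)) \<times> 'n nalg) monoid)"
  \<comment> \<open>A right translate of the compact ball by the inverse of \<open>x\<close>: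
    compact, hence of finite measure.\<close>
  let ?E = "{t \<in> carrier KN_group. t \<otimes>\<^bsub>KN_group\<^esub> x \<in> KN_ball 1}"
  have eq: "?E = (\<lambda>c. c \<otimes>\<^bsub>KN_group\<^esub> KN_inv x) ` KN_ball 1"
  proof (intro equalityI subsetI)
    fix t assume t: "t \<in> ?E"
    then have "t = (t \<otimes>\<^bsub>KN_group\<^esub> x) \<otimes>\<^bsub>KN_group\<^esub> KN_inv x"
      using x by (simp add: KN_inv[symmetric] m_assoc)
    then show "t \<in> (\<lambda>c. c \<otimes>\<^bsub>KN_group\<^esub> KN_inv x) ` KN_ball 1"
      using t by blast
  next
    fix t assume "t \<in> (\<lambda>c. c \<otimes>\<^bsub>KN_group\<^esub> KN_inv x) ` KN_ball 1"
    then obtain c where c: "c \<in> KN_ball 1" "t = c \<otimes>\<^bsub>KN_group\<^esub> KN_inv x" by blast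
    then have "c \<in> carrier KN_group" using KN_ball_subset by blast
    with c x show "t \<in> ?E"
      by (simp add: KN_inv[symmetric] m_assoc)
  qed
  have "compact ?E"
    unfolding eq by (intro compact_continuous_image compact_KN_ball continuous_intros)
  then show "emeasure \<mu> ?E < \<infinity>"
    by (intro compact_finite) auto
  \<comment> \<open>An open set around the inverse of \<open>x\<close>, where the product is the
    identity; it makes the measure of \<open>?E\<close> positive.\<close>
  let ?U = "{t. norm (snd (t \<otimes>\<^bsub>KN_group\<^esub> x)) < 1}"
  have "open ?U"
    by (intro open_Collect_less continuous_intros)
  moreover have "norm (snd (inv\<^bsub>KN_group\<^esub> x \<otimes>\<^bsub>KN_group\<^esub> x)) < 1"
    using x by (simp only: l_inv) (simp add: semidirect_def)
  then have "?U \<inter> carrier KN_group \<noteq> {}"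
    using x by blast
  ultimately have "emeasure \<mu> (?U \<inter> carrier KN_group) > 0"
    by (rule open_positive)
  also have "emeasure \<mu> (?U \<inter> carrier KN_group) \<le> emeasure \<mu> ?E"
  proof (rule emeasure_mono)
    show "?E \<in> sets \<mu>"
      using \<open>compact ?E\<close> by (intro compact_in_sets) auto
    have "g \<in> KN_ball 1" if "g \<in> carrier KN_group" "norm (snd g) < 1" for g :: "(complex \<times> (quat^'n^'n)) \<times> 'n nalg"
      using that by (cases g) (auto simp: KN_ball_def KN_carrier)
    moreover have "t \<otimes>\<^bsub>KN_group\<^esub> x \<in> carrier KN_group" if "t \<in> carrier KN_group" for t
      using that x by simp
    ultimately show "?U \<inter> carrier KN_group \<subseteq> ?E"
      by blast
  qed
  finally show "emeasure \<mu> ?E > 0" .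
qed (intro KN.group_semidirect space_mu sigma_finite_mu distr_translate sets_distr measurable_mult
    measurable_inv; assumption)+

end

section \<open>Quaternionic reflections\<close>

definition outer_prod :: "quat^'m \<Rightarrow> quat \<Rightarrow> quat^'n \<Rightarrow> quat^'n^'m" where
  "outer_prod u a v = (\<chi> i j. u $ i * a * qcnj (v $ j))"

lemma outer_prod_nth [simp]: "outer_prod u a v $ i $ j = u $ i * a * qcnj (v $ j)"
  by (simp add: outer_prod_def)

lemma outer_prod_vector: "outer_prod u a v *v w = rmul u (a * qform v w)"
  by (simp add: vec_eq_iff matrix_vector_nth qform_def sum_distrib_left mult.assoc)

lemma matrix_outer_prod: "k ** outer_prod u a v = outer_prod (k *v u) a v"
  by (simp add: vec_eq_iff matrix_mult_nth matrix_vector_nth sum_distrib_right mult.assoc)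

lemma outer_prod_matrix: "outer_prod u a v ** k = outer_prod u a (qadj k *v v)"
  by (simp add: vec_eq_iff matrix_mult_nth matrix_vector_nth sum_distrib_left qcnj_sum qcnj_mult
      mult.assoc)

lemma outer_prod_mult: "outer_prod u a v ** outer_prod w b x = outer_prod u (a * qform v w * b) x"
  by (simp add: matrix_outer_prod outer_prod_vector) (simp add: vec_eq_iff mult.assoc)

lemma qadj_outer_prod: "qadj (outer_prod u a v) = outer_prod v (qcnj a) u"
  by (simp add: vec_eq_iff qcnj_mult mult.assoc)

lemma outer_prod_simps:
  "outer_prod u (a + b) v = outer_prod u a v + outer_prod u b v"
  "outer_prod u 0 v = 0"
  "outer_prod (r *\<^sub>R u) a v = r *\<^sub>R outer_prod u a v"
  "outer_prod u a (r *\<^sub>R v) = r *\<^sub>R outer_prod u a v"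
  "outer_prod (\<Sum>i\<in>I. f i) a v = (\<Sum>i\<in>I. outer_prod (f i) a v)"
  "outer_prod u a (\<Sum>i\<in>I. f i) = (\<Sum>i\<in>I. outer_prod u a (f i))"
  by (simp_all add: vec_eq_iff algebra_simps sum_distrib_left sum_distrib_right qcnj_sum)

lemma matrix_mult_sum_distrib:
  fixes f :: "'b \<Rightarrow> 'a::semiring_1^'n^'m"
  shows "(\<Sum>i\<in>I. f i) ** A = (\<Sum>i\<in>I. f i ** A)"
    and "B ** (\<Sum>i\<in>I. f i) = (\<Sum>i\<in>I. B ** f i)"
  by (induction I rule: infinite_finite_induct)
    (simp_all add: matrix_add_rdistrib matrix_add_ldistrib)

lemma matrix_vector_sum_distrib:
  fixes f :: "'b \<Rightarrow> 'a::semiring_1^'n^'m"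
  shows "(\<Sum>i\<in>I. f i) *v x = (\<Sum>i\<in>I. f i *v x)"
  by (induction I rule: infinite_finite_induct) (simp_all add: matrix_vector_mult_add_rdistrib)

text \<open>For orthonormal \<open>B\<close> this fixes the orthogonal complement of
  \<open>B\<close> and sends \<open>w c\<close> to \<open>w a c\<close> for \<open>w\<close> in
  \<open>B\<close>. On the real span of \<open>B\<close> it is right multiplication by
  \<open>a\<close>.\<close>

definition reflection :: "(quat^'n) set \<Rightarrow> quat \<Rightarrow> quat^'n^'n" where
  "reflection B a = mat 1 + (\<Sum>w\<in>B. outer_prod w (a - 1) w)"

definition qorthonormal :: "(quat^'n) set \<Rightarrow> bool" where
  "qorthonormal B \<longleftrightarrow> finite B \<and> (\<forall>v\<in>B. \<forall>w\<in>B. qform v w = (if v = w then 1 else 0))"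

lemma reflection_one: "reflection B 1 = mat 1"
  by (simp add: reflection_def outer_prod_simps)

lemma qadj_reflection: "qadj (reflection B a) = reflection B (qcnj a)"
proof -
  have "qadj (\<Sum>w\<in>B. outer_prod w (a - 1) w) = (\<Sum>w\<in>B. outer_prod w (qcnj a - 1) w)"
    by (induction B rule: infinite_finite_induct) (simp_all add: qadj_outer_prod)
  then show ?thesis
    by (simp add: reflection_def)
qed

text \<open>For fixed \<open>B\<close> the unit quaternions thus embed into Sp(n), and identities
  between reflections reduce to identities between multipliers.\<close>

lemma reflection_mult:
  assumes "qorthonormal B"
  shows "reflection B a ** reflection B b = reflection B (a * b)"
proof -
  let ?S = "\<lambda>c. \<Sum>w\<in>B. outer_prod w c w"
  have B: "finite B" using assms by (simp add: qorthonormal_def)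
  have "?S c ** ?S d = ?S (c * d)" for c d
  proof -
    have "?S c ** ?S d = (\<Sum>v\<in>B. \<Sum>w\<in>B. outer_prod v (c * qform v w * d) w)"
      by (simp add: matrix_mult_sum_distrib outer_prod_mult) (rule sum.swap)
    also have "\<dots> = (\<Sum>v\<in>B. \<Sum>w\<in>B. if v = w then outer_prod v (c * d) w else 0)"
      using assms by (intro sum.cong refl) (auto simp: qorthonormal_def outer_prod_simps)
    also have "\<dots> = ?S (c * d)"
      using B by (simp add: sum.delta' cong: if_cong)
    finally show ?thesis .
  qed
  then have "reflection B a ** reflection B b =
      mat 1 + ?S (a - 1) + ?S (b - 1) + ?S ((a - 1) * (b - 1))"
    by (simp add: reflection_def matrix_add_rdistrib matrix_add_ldistrib)
  also have "\<dots> = mat 1 + ?S ((a - 1) + (b - 1) + (a - 1) * (b - 1))"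
    by (simp add: outer_prod_simps(1) sum.distrib add.assoc)
  also have "(a - 1) + (b - 1) + (a - 1) * (b - 1) = a * b - 1"
    by (simp add: algebra_simps)
  finally show ?thesis
    by (simp add: reflection_def)
qed

lemma reflection_Sp:
  assumes "qorthonormal B" "norm a = 1"
  shows "reflection B a ** qadj (reflection B a) = mat 1"
  using assms by (simp add: qadj_reflection reflection_mult qcnj_mult_self reflection_one)

lemma orthonormal_expansion:
  assumes B: "finite B" "\<And>v w. v \<in> B \<Longrightarrow> w \<in> B \<Longrightarrow> inner v w = (if v = w then 1 else 0)"
    and "u \<in> span B"
  shows "u = (\<Sum>w\<in>B. inner u w *\<^sub>R w)"
proof -
  obtain c where u: "u = (\<Sum>w\<in>B. c w *\<^sub>R w)"
    using assms by (auto simp: span_finite)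
  have "inner u w = c w" if "w \<in> B" for w
  proof -
    have "inner u w = (\<Sum>v\<in>B. c v * inner v w)"
      by (simp add: u inner_sum_left)
    also have "\<dots> = (\<Sum>v\<in>B. if v = w then c v else 0)"
      using that by (intro sum.cong) (auto simp: B(2))
    finally show ?thesis using B(1) that by simp
  qed
  then show ?thesis
    using u by simp
qed

text \<open>The real span of the vectors \<open>A\<^sup>m v\<close> is a real form of the cyclic subspace generated by
  \<open>v\<close>: the quaternionic products of its elements are real. Since \<open>A\<close> is symmetric on this span, the
  reflection along a real orthonormal basis of it commutes with \<open>A\<close>.\<close>

lemma commuting_rotation:
  fixes A :: "quat^'n^'n"
  assumes A: "qadj A = A" and a: "norm a = 1"
  obtains k where "k ** qadj k = mat 1" "k ** A = A ** k" "k *v v = rmul v a"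
proof -
  define x where "x m = ((\<lambda>w. A *v w) ^^ m) v" for m
  have x_Suc: "x (Suc m) = A *v x m" and x_0: "x 0 = v" for m
    by (simp_all add: x_def)
  \<comment> \<open>The product depends on \<open>m + l\<close> only, so exchanging the vectors
    leaves it unchanged; since the exchange also conjugates it, it is real.\<close>
  have shift: "qform (x m) (x l) = qform (x 0) (x (m + l))" for m l
  proof (induction m arbitrary: l)
    case (Suc m)
    have "qform (x (Suc m)) (x l) = qform (x m) (x (Suc l))"
      by (simp add: x_Suc qform_adjoint A)
    then show ?case using Suc[of "Suc l"] by simp
  qed simp
  define W where "W = span (range x)"
  have real: "qcnj (qform u w) = qform u w" if "u \<in> W" "w \<in> W" for u w
  proof -
    have zero: "qform 0 w = 0" "qform w 0 = 0" for w :: "quat^'n"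
      using qform_add(3)[of 0 0 w] qform_add(4)[of w 0 0] by simp_all
    have *: "qcnj (qform (x m) w) = qform (x m) w" for m
      using \<open>w \<in> W\<close> unfolding W_def
    proof (induction rule: span_induct)
      case base
      show ?case by (auto simp: subspace_def qform_add zero)
    next
      case (step w)
      then obtain l where "w = x l" by blast
      then show ?case
        using shift[of m l] shift[of l m] by (metis qcnj_qform add.commute)
    qed
    show ?thesis
      using \<open>u \<in> W\<close> unfolding W_def
    proof (induction rule: span_induct)
      case base
      show ?case by (auto simp: subspace_def qform_add zero)
    qed (use * in auto)
  qed
  then have qform_W: "qform u w = of_real (inner u w)" if "u \<in> W" "w \<in> W" for u w
    using that qcnj_eq_self_iff[of "qform u w"] by (simp add: qRe_qform)
  have AW: "A *v w \<in> W" if "w \<in> W" for w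
    using that unfolding W_def
  proof (induction rule: span_induct)
    case base
    have *: "A *v (r *\<^sub>R y) = r *\<^sub>R (A *v y)" for r y
      by (simp add: vec_eq_iff matrix_vector_nth scaleR_sum_right)
    show ?case
      by (auto simp: subspace_def matrix_vector_right_distrib * intro: span_add span_scale span_zero)
  next
    case (step w)
    then show ?case by (metis imageE x_Suc rangeI span_base)
  qed
  have "subspace W" by (simp add: W_def)
  then obtain B where B: "B \<subseteq> W" "pairwise orthogonal B" "\<And>w. w \<in> B \<Longrightarrow> norm w = 1"
    "independent B" "span B = W"
    using orthonormal_basis_subspace[of W] by metis
  have ortho: "inner u w = (if u = w then 1 else 0)" if "u \<in> B" "w \<in> B" for u w
    using B(2,3) that by (auto simp: pairwise_def orthogonal_def norm_eq_1)
  have "finite B"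
    using B(4) by (rule independent_imp_finite)
  \<comment> \<open>All products within \<open>W\<close> are real, so real orthonormality is already
    quaternionic orthonormality.\<close>
  have orthB: "qorthonormal B"
    unfolding qorthonormal_def using \<open>finite B\<close> ortho B(1) qform_W by (auto simp: subset_iff)
  have expand: "u = (\<Sum>w\<in>B. inner u w *\<^sub>R w)" if "u \<in> W" for u
    using that ortho by (intro orthonormal_expansion \<open>finite B\<close>) (auto simp: B(5))
  have symA: "inner (A *v w) u = inner (A *v u) w" for u w
    by (metis A inner_commute inner_vec_mult)
  let ?S = "\<Sum>w\<in>B. outer_prod w (a - 1) w"
  have "A ** ?S = (\<Sum>w\<in>B. outer_prod (\<Sum>u\<in>B. inner (A *v w) u *\<^sub>R u) (a - 1) w)"
    using expand[OF AW] B(1) by (simp add: matrix_mult_sum_distrib matrix_outer_prod subset_iff)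
  also have "\<dots> = (\<Sum>w\<in>B. \<Sum>u\<in>B. inner (A *v w) u *\<^sub>R outer_prod u (a - 1) w)"
    by (simp add: outer_prod_simps)
  also have "\<dots> = (\<Sum>u\<in>B. \<Sum>w\<in>B. inner (A *v u) w *\<^sub>R outer_prod u (a - 1) w)"
    by (subst sum.swap) (intro sum.cong refl arg_cong2[where f="(*\<^sub>R)"] symA)
  also have "\<dots> = (\<Sum>u\<in>B. outer_prod u (a - 1) (\<Sum>w\<in>B. inner (A *v u) w *\<^sub>R w))"
    by (simp add: outer_prod_simps)
  also have "\<dots> = ?S ** A"
    using expand[OF AW] B(1) by (simp add: matrix_mult_sum_distrib outer_prod_matrix A subset_iff)
  finally have comm: "reflection B a ** A = A ** reflection B a"
    by (simp add: reflection_def matrix_add_rdistrib matrix_add_ldistrib)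
  have vW: "v \<in> W"
    unfolding W_def x_0[symmetric] by (intro span_base) simp
  have "?S *v v = (\<Sum>w\<in>B. rmul (inner v w *\<^sub>R w) (a - 1))"
    using vW B(1) qform_W
    by (simp add: matrix_vector_sum_distrib outer_prod_vector subset_iff)
      (intro sum.cong refl, simp add: vec_eq_iff inner_commute[of v] quat_eq_iff algebra_simps)
  also have "\<dots> = rmul (\<Sum>w\<in>B. inner v w *\<^sub>R w) (a - 1)"
    by (simp add: vec_eq_iff sum_distrib_right)
  also have "\<dots> = rmul v (a - 1)"
    using expand[OF vW] by simp
  finally have "reflection B a *v v = rmul v a"
    by (simp add: reflection_def matrix_vector_mult_add_rdistrib) (simp add: vec_eq_iff algebra_simps)
  then show ?thesis
    using that reflection_Sp[OF orthB a] comm by blast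
qed

text \<open>\<open>- \<sigma> X\<close> has hermitian part \<open>A\<close>, imaginary part
  \<open>j q j\<close> and vector part \<open>- v j\<close>. Passing from \<open>q\<close> to
  \<open>j q j\<close> negates the coordinate along \<open>j\<close>, which a rotation about the
  \<open>i\<close> axis, hence some \<open>z\<close> in the circle, can do. Then \<open>k\<close>
  must commute with \<open>A\<close> and send \<open>v\<close> to \<open>- v j z\<close>, because
  the action of \<open>z\<close> still multiplies by the conjugate of \<open>z\<close> on the
  right.\<close>

lemma sigma_n_orbit:
  fixes X :: "'n::finite nalg"
  assumes "X \<in> lie_algebra_n"
  obtains l where "l \<in> carrier K_group" "K_action l X = - sigma_n X"
proof -
  obtain A q v where X: "X = ((A, q), v)" by (metis prod.exhaust)
  have A: "qadj A = A" and q: "qRe q = 0"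
    using assms by (auto simp: X lie_algebra_n_def H0_def Im_quat_def)
  \<comment> \<open>Polar form of the part of \<open>q\<close> orthogonal to \<open>i\<close>: it is
    \<open>(t + s i) j\<close> times \<open>r\<close>, and \<open>t + s i\<close> is
    \<open>i\<close> times the conjugate of \<open>z = s + t i\<close>. Conjugation by
    \<open>z\<close> multiplies it by the square of \<open>z\<close>, giving
    \<open>i z = - t + s i\<close>.\<close>
  obtain r t s where rst: "qIm2 q = r * t" "qIm3 q = r * s" "s\<^sup>2 + t\<^sup>2 = (1::real)"
  proof (cases "(qIm2 q)\<^sup>2 + (qIm3 q)\<^sup>2 = 0")
    case True
    then show ?thesis using that[of 0 0 1] by (simp add: sum_power2_eq_zero_iff)
  next
    case False
    define r where "r = sqrt ((qIm2 q)\<^sup>2 + (qIm3 q)\<^sup>2)"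
    have "r \<noteq> 0" "r\<^sup>2 = (qIm2 q)\<^sup>2 + (qIm3 q)\<^sup>2"
      using False by (simp_all add: r_def)
    moreover have "(qIm3 q / r)\<^sup>2 + (qIm2 q / r)\<^sup>2 = ((qIm2 q)\<^sup>2 + (qIm3 q)\<^sup>2) / r\<^sup>2"
      by (simp add: power_divide add_divide_distrib)
    ultimately show ?thesis
      using that[of r "qIm2 q / r" "qIm3 q / r"] False by simp
  qed
  define z where "z = Complex s t"
  have z: "norm z = 1" by (simp add: z_def cmod_def rst)
  have eqs: "(s * s - t * t) * (r * t) - 2 * (s * t) * (r * s) = - (r * t)"
    "(s * s - t * t) * (r * s) + 2 * (s * t) * (r * t) = r * s" "s * s + t * t = 1"
    using rst(3) by (simp_all add: power2_eq_square) algebra+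
  have qz: "quat_of_complex z * q * quat_of_complex (cnj z) = qj * q * qj"
    using eqs q by (simp add: quat_eq_iff z_def rst) (simp add: algebra_simps; algebra)
  obtain k where k: "k ** qadj k = mat 1" "k ** A = A ** k" "k *v v = rmul v (- (qj * quat_of_complex z))"
  proof (rule commuting_rotation[OF A])
    show "norm (- (qj * quat_of_complex z)) = 1"
      by (simp add: norm_mult z) (simp add: norm_quat_def inner_quat_def)
  qed
  have "quat_of_complex z * quat_of_complex (cnj z) = 1"
    using cnj_mult_unit(2)[OF z] by (metis quat_of_complex_simps(2,4))
  then have "K_action (z, k) X = - sigma_n X"
    using k qz by (simp add: X K_action_simp sigma_n_def rmul_simps mult.assoc matrix_mul_assoc[symmetric])
  then show ?thesis
    using that[of "(z, k)"] z k(1) by (simp add: K_group_carrier)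
qed

section \<open>Equivariant functions\<close>

lemma cadj_simps [simp]: "cadj (cadj A) = A"
  by (simp add: vec_eq_iff)

lemma cadj_mat [simp]: "cadj (mat a) = mat (cnj a)"
  by (simp add: vec_eq_iff mat_def)

lemma cadj_mult: "cadj (A ** B) = cadj B ** cadj A"
  by (simp add: vec_eq_iff matrix_mult_nth mult.commute)

lemma unitary_left_inverse:
  fixes U :: "complex^'d^'d"
  shows "U ** cadj U = mat 1 \<Longrightarrow> cadj U ** U = mat 1"
  using matrix_left_right_inverse by blast

lemma matrix_inv_unitary:
  fixes U :: "complex^'d^'d"
  assumes "U ** cadj U = mat 1"
  shows "matrix_inv U = cadj U"
  unfolding matrix_inv_def
proof (rule some_equality)
  show "U ** cadj U = mat 1 \<and> cadj U ** U = mat 1"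
    using assms unitary_left_inverse by blast
  show "A' = cadj U" if "U ** A' = mat 1 \<and> A' ** U = mat 1" for A'
    using that assms by (metis matrix_mul_assoc matrix_mul_lid matrix_mul_rid)
qed

lemma bounded_linear_matrix_mult:
  fixes U V :: "complex^'d^'d"
  shows "bounded_linear (\<lambda>M. U ** M ** V)"
  by (rule linear_conv_bounded_linear[THEN iffD1, OF linearI])
    (simp_all add: matrix_add_rdistrib matrix_add_ldistrib matrix_scaleR_mult)

lemma (in group) mult_inv_mult:
  assumes "x \<in> carrier G" "y \<in> carrier G"
  shows "x \<otimes> (inv x \<otimes> y) = y" "inv x \<otimes> (x \<otimes> y) = y"
  using assms by (simp_all add: m_assoc[symmetric])

lemma (in group) inv_mult_cancel:
  assumes "k \<in> carrier G" "y \<in> carrier G" "x \<in> carrier G" "l \<in> carrier G"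
  shows "inv (k \<otimes> y) \<otimes> (k \<otimes> x \<otimes> l) = inv y \<otimes> x \<otimes> l"
  using assms by (simp add: inv_mult_group m_assoc mult_inv_mult)

lemma (in group) inv_mult_left_cancel:
  "x \<in> carrier G \<Longrightarrow> y \<in> carrier G \<Longrightarrow> inv (x \<otimes> y) \<otimes> x = inv y"
  by (simp add: inv_mult_group m_assoc)

lemma (in group) inv_mult_inv:
  "x \<in> carrier G \<Longrightarrow> y \<in> carrier G \<Longrightarrow> inv (inv x \<otimes> y) = inv y \<otimes> x"
  by (simp add: inv_mult_group)

locale KN_rep = KN_haar \<mu> for \<mu> :: "((complex \<times> (quat^'n^'n)) \<times> 'n::finite nalg) measure" +
  fixes \<tau> :: "complex \<times> (quat^'n^'n) \<Rightarrow> complex^'d^'d"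
  assumes rep: "unitary_rep K_group \<tau>"
begin

abbreviation "G \<equiv> (KN_group :: ((complex \<times> (quat^'n^'n)) \<times> 'n nalg) monoid)"
abbreviation "K \<equiv> (K_group :: (complex \<times> (quat^'n^'n)) monoid)"

sublocale G: group G by (rule KN.group_semidirect)

lemma tau_unitary: "k \<in> carrier K \<Longrightarrow> \<tau> k ** cadj (\<tau> k) = mat 1"
  "k \<in> carrier K \<Longrightarrow> cadj (\<tau> k) ** \<tau> k = mat 1"
proof -
  assume "k \<in> carrier K"
  then show "\<tau> k ** cadj (\<tau> k) = mat 1"
    using rep hom_in_carrier[of \<tau> K unitary_group k] by (simp add: unitary_rep_def)
  then show "cadj (\<tau> k) ** \<tau> k = mat 1"
    by (rule unitary_left_inverse)
qed

lemma tau_mult: "k \<in> carrier K \<Longrightarrow> l \<in> carrier K \<Longrightarrow> \<tau> (k \<otimes>\<^bsub>K\<^esub> l) = \<tau> k ** \<tau> l"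
  using rep hom_mult[of \<tau> K unitary_group k l] by (simp add: unitary_rep_def)

lemma tau_one: "\<tau> \<one>\<^bsub>K\<^esub> = mat 1"
proof -
  have "\<tau> \<one>\<^bsub>K\<^esub> ** \<tau> \<one>\<^bsub>K\<^esub> = \<tau> \<one>\<^bsub>K\<^esub>"
    using tau_mult[of "\<one>\<^bsub>K\<^esub>" "\<one>\<^bsub>K\<^esub>"] KN.K.one_closed KN.K.l_one by metis
  then show ?thesis
    using tau_unitary[OF KN.K.one_closed] by (metis matrix_mul_assoc matrix_mul_lid)
qed

lemma tau_inv:
  assumes "k \<in> carrier K"
  shows "\<tau> (inv\<^bsub>K\<^esub> k) = cadj (\<tau> k)"
proof -
  have "\<tau> (inv\<^bsub>K\<^esub> k) ** \<tau> k = mat 1"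
    using tau_mult[of "inv\<^bsub>K\<^esub> k" k] KN.K.inv_closed[OF assms] KN.K.l_inv[OF assms] assms tau_one by metis
  then show ?thesis
    using tau_unitary(1)[OF assms] by (metis matrix_mul_assoc matrix_mul_lid matrix_mul_rid)
qed

definition equivariant :: "((complex \<times> (quat^'n^'n)) \<times> 'n nalg \<Rightarrow> complex^'d^'d) \<Rightarrow> bool" where
  "equivariant F \<longleftrightarrow> (\<forall>k\<in>carrier K. \<forall>l\<in>carrier K. \<forall>x\<in>carrier G.
     F ((k, 0) \<otimes>\<^bsub>G\<^esub> x \<otimes>\<^bsub>G\<^esub> (l, 0)) = cadj (\<tau> l) ** F x ** cadj (\<tau> k))"

abbreviation "L1 \<equiv> L1_tau G \<mu> (carrier K \<times> {\<one>\<^bsub>N_group\<^esub>}) (\<lambda>(k, x). \<tau> k)"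

lemma L1_iff: "F \<in> L1 \<longleftrightarrow> integrable \<mu> F \<and> equivariant F"
  by (simp add: L1_tau_def equivariant_def matrix_inv_unitary tau_unitary)

lemma G_one: "\<one>\<^bsub>G\<^esub> = (\<one>\<^bsub>K\<^esub>, 0)"
  by (simp only: semidirect_def monoid.simps N_group_simps)

lemma K_in_G: "k \<in> carrier K \<Longrightarrow> (k, 0) \<in> carrier G"
  using subspace_0[OF subspace_lie_algebra_n] by (simp add: KN_carrier)

lemma equivariantD:
  "equivariant F \<Longrightarrow> k \<in> carrier K \<Longrightarrow> l \<in> carrier K \<Longrightarrow> x \<in> carrier G \<Longrightarrow>
    F ((k, 0) \<otimes>\<^bsub>G\<^esub> x \<otimes>\<^bsub>G\<^esub> (l, 0)) = cadj (\<tau> l) ** F x ** cadj (\<tau> k)"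
  unfolding equivariant_def by blast

lemma borel_matrix_mult:
  assumes "f \<in> borel_measurable M" "g \<in> borel_measurable M"
  shows "(\<lambda>x. f x ** g x :: complex^'d^'d) \<in> borel_measurable M"
  using assms by (rule borel_measurable_continuous_Pair) (intro continuous_intros)

lemma convolution_integrand_measurable:
  assumes "F\<^sub>1 \<in> L1" "F\<^sub>2 \<in> L1" "g \<in> carrier G"
  shows "(\<lambda>x. F\<^sub>2 (inv\<^bsub>G\<^esub> x \<otimes>\<^bsub>G\<^esub> g) ** F\<^sub>1 x) \<in> borel_measurable \<mu>"
proof (rule borel_matrix_mult)
  have F: "F\<^sub>1 \<in> borel_measurable \<mu>" "F\<^sub>2 \<in> borel_measurable \<mu>"
    using assms unfolding L1_iff by auto
  show "F\<^sub>1 \<in> borel_measurable \<mu>" by (rule F)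
  show "(\<lambda>x. F\<^sub>2 (inv\<^bsub>G\<^esub> x \<otimes>\<^bsub>G\<^esub> g)) \<in> borel_measurable \<mu>"
    by (rule measurable_compose[OF measurable_compose[OF measurable_inv measurable_translate(2)[OF assms(3)]] F(2)])
qed

text \<open>Replacing \<open>y\<close> by \<open>k y\<close> moves the left factor \<open>k\<close>
  into \<open>F\<^sub>1\<close>, while \<open>F\<^sub>2\<close> receives only the right factor
  \<open>l\<close>.\<close>

lemma convolution_equivariant:
  assumes F: "F\<^sub>1 \<in> L1" "F\<^sub>2 \<in> L1"
  shows "equivariant (convolution G \<mu> F\<^sub>1 F\<^sub>2)"
  unfolding equivariant_def
proof (intro ballI)
  fix k l x assume k: "k \<in> carrier K" and l: "l \<in> carrier K" and x: "x \<in> carrier G"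
  let ?k = "(k, 0)" and ?l = "(l, 0)"
  note kl = K_in_G[OF k] K_in_G[OF l]
  let ?g = "?k \<otimes>\<^bsub>G\<^esub> x \<otimes>\<^bsub>G\<^esub> ?l"
  let ?T = "\<lambda>M. cadj (\<tau> l) ** M ** cadj (\<tau> k)"
  have g: "?g \<in> carrier G" using kl x by (intro G.m_closed)
  have "convolution G \<mu> F\<^sub>1 F\<^sub>2 ?g = (LINT y|distr \<mu> \<mu> (\<lambda>y. ?k \<otimes>\<^bsub>G\<^esub> y). F\<^sub>2 (inv\<^bsub>G\<^esub> y \<otimes>\<^bsub>G\<^esub> ?g) ** F\<^sub>1 y)"
    by (simp only: convolution_def distr_translate[OF kl(1)])
  also have "\<dots> = (LINT y|\<mu>. F\<^sub>2 (inv\<^bsub>G\<^esub> (?k \<otimes>\<^bsub>G\<^esub> y) \<otimes>\<^bsub>G\<^esub> ?g) ** F\<^sub>1 (?k \<otimes>\<^bsub>G\<^esub> y))"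
    by (rule integral_distr[OF measurable_translate(1)[OF kl(1)] convolution_integrand_measurable[OF F g]])
  also have "\<dots> = (LINT y|\<mu>. ?T (F\<^sub>2 (inv\<^bsub>G\<^esub> y \<otimes>\<^bsub>G\<^esub> x) ** F\<^sub>1 y))"
  proof (rule Bochner_Integration.integral_cong[OF refl])
    fix y assume "y \<in> space \<mu>"
    then have y: "y \<in> carrier G" by (simp only: space_mu)
    have "inv\<^bsub>G\<^esub> (?k \<otimes>\<^bsub>G\<^esub> y) \<otimes>\<^bsub>G\<^esub> ?g = \<one>\<^bsub>G\<^esub> \<otimes>\<^bsub>G\<^esub> (inv\<^bsub>G\<^esub> y \<otimes>\<^bsub>G\<^esub> x) \<otimes>\<^bsub>G\<^esub> ?l"
      using G.inv_mult_cancel[OF kl(1) y x kl(2)]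
      by (simp only: G.l_one G.m_closed[OF G.inv_closed[OF y] x])
    also note G_one
    finally have "F\<^sub>2 (inv\<^bsub>G\<^esub> (?k \<otimes>\<^bsub>G\<^esub> y) \<otimes>\<^bsub>G\<^esub> ?g) =
        F\<^sub>2 ((\<one>\<^bsub>K\<^esub>, 0) \<otimes>\<^bsub>G\<^esub> (inv\<^bsub>G\<^esub> y \<otimes>\<^bsub>G\<^esub> x) \<otimes>\<^bsub>G\<^esub> ?l)"
      by (rule arg_cong)
    also have "\<dots> = cadj (\<tau> l) ** F\<^sub>2 (inv\<^bsub>G\<^esub> y \<otimes>\<^bsub>G\<^esub> x) ** cadj (\<tau> \<one>\<^bsub>K\<^esub>)"
      using F(2) unfolding L1_iff
      by (intro equivariantD KN.K.one_closed l G.m_closed[OF G.inv_closed[OF y] x]) blast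
    finally have 1: "F\<^sub>2 (inv\<^bsub>G\<^esub> (?k \<otimes>\<^bsub>G\<^esub> y) \<otimes>\<^bsub>G\<^esub> ?g) = cadj (\<tau> l) ** F\<^sub>2 (inv\<^bsub>G\<^esub> y \<otimes>\<^bsub>G\<^esub> x)"
      by (simp only: tau_one cadj_mat complex_cnj_one matrix_mul_rid)
    have "F\<^sub>1 (?k \<otimes>\<^bsub>G\<^esub> y \<otimes>\<^bsub>G\<^esub> (\<one>\<^bsub>K\<^esub>, 0)) = cadj (\<tau> \<one>\<^bsub>K\<^esub>) ** F\<^sub>1 y ** cadj (\<tau> k)"
      using F(1) unfolding L1_iff by (intro equivariantD KN.K.one_closed k y) blast
    then have "F\<^sub>1 (?k \<otimes>\<^bsub>G\<^esub> y \<otimes>\<^bsub>G\<^esub> (\<one>\<^bsub>K\<^esub>, 0)) = F\<^sub>1 y ** cadj (\<tau> k)"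
      by (simp only: tau_one cadj_mat complex_cnj_one matrix_mul_lid)
    moreover have "?k \<otimes>\<^bsub>G\<^esub> y \<otimes>\<^bsub>G\<^esub> (\<one>\<^bsub>K\<^esub>, 0) = ?k \<otimes>\<^bsub>G\<^esub> y"
      using G.r_one[OF G.m_closed[OF kl(1) y]] by (simp only: G_one)
    ultimately show "F\<^sub>2 (inv\<^bsub>G\<^esub> (?k \<otimes>\<^bsub>G\<^esub> y) \<otimes>\<^bsub>G\<^esub> ?g) ** F\<^sub>1 (?k \<otimes>\<^bsub>G\<^esub> y) =
        ?T (F\<^sub>2 (inv\<^bsub>G\<^esub> y \<otimes>\<^bsub>G\<^esub> x) ** F\<^sub>1 y)"
      using 1 by (simp only: matrix_mul_assoc)
  qed
  also have "\<dots> = ?T (LINT y|\<mu>. F\<^sub>2 (inv\<^bsub>G\<^esub> y \<otimes>\<^bsub>G\<^esub> x) ** F\<^sub>1 y)"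
  \<comment> \<open>The integrand is not known to be integrable at this point. An invertible linear
    map commutes with the Bochner integral in any case, since it preserves
    non-integrability.\<close>
  proof (rule integral_bounded_linear'[OF bounded_linear_matrix_mult bounded_linear_matrix_mult])
    have "\<tau> l ** (cadj (\<tau> l) ** M ** cadj (\<tau> k)) ** \<tau> k = M" for M
      using tau_unitary[OF k] tau_unitary[OF l]
      by (metis matrix_mul_assoc matrix_mul_lid matrix_mul_rid)
    then show "\<forall>M. \<tau> l ** ?T M ** \<tau> k = M" by blast
  qed
  finally show "convolution G \<mu> F\<^sub>1 F\<^sub>2 ?g = ?T (convolution G \<mu> F\<^sub>1 F\<^sub>2 x)"
    by (simp only: convolution_def)
qed

end

section \<open>Circle characters give commutative triples\<close>

lemma matrix_one_dim_commute:
  fixes A B :: "complex^'d^'d"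
  assumes "CARD('d) = 1"
  shows "A ** B = B ** A"
proof -
  obtain c :: 'd where c: "UNIV = {c}" using assms card_1_singletonE by blast
  have "(A ** B) $ i $ j = (B ** A) $ i $ j" for i j
  proof -
    have "i = c" "j = c" using c by auto
    then show ?thesis by (simp add: matrix_mult_nth c mult.commute)
  qed
  then show ?thesis by (simp add: vec_eq_iff)
qed

lemma cadj_mult_one_dim:
  fixes A B C :: "complex^'d^'d"
  assumes "CARD('d) = 1"
  shows "cadj A ** B ** cadj C = B ** cadj (C ** A)"
  by (simp only: matrix_one_dim_commute[OF assms, of "cadj A" B] cadj_mult matrix_mul_assoc)

context KN_rep
begin

text \<open>With \<open>g = (a, X)\<close> and \<open>b\<close> the inverse of
  \<open>sigma_K a\<close>, the inverse of \<open>\<sigma> g\<close> is \<open>(b, b l X)\<close>,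
  where \<open>l\<close> carries \<open>X\<close> to \<open>- \<sigma> X\<close>; so it lies in the
  double coset of \<open>g\<close>. The resulting factor is \<open>\<tau>\<close> at
  \<open>a\<^sup>-\<^sup>1 b\<close>. It is trivial because conjugation in \<open>sigma_K\<close>
  followed by inversion gives \<open>b\<close> the same circle component as
  \<open>a\<close>.\<close>

lemma equivariant_sigma_inv:
  assumes d: "CARD('d) = 1" and triv: "\<And>k. k \<in> carrier Sp_group \<Longrightarrow> \<tau> (1, k) = mat 1"
    and F: "equivariant F" and g: "g \<in> carrier G"
  shows "F (inv\<^bsub>G\<^esub> (sigma g)) = F g"
proof -
  obtain a X where gaX: "g = (a, X)" by (rule prod.exhaust)
  with g have a: "a \<in> carrier K" and X: "X \<in> lie_algebra_n" by (simp_all only: KN_carrier)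
  obtain l where l: "l \<in> carrier K" "K_action l X = - sigma_n X"
    using sigma_n_orbit[OF X] by blast
  define b where "b = K_inv (sigma_K a)"
  have b: "b \<in> carrier K" unfolding b_def by (intro K_inv_carrier sigma_K_closed a)
  have "inv\<^bsub>G\<^esub> (sigma g) = (b, K_action b (- sigma_n X))"
    unfolding KN_inv[OF sigma_closed[OF g]] by (simp only: KN_inv_def sigma_def gaX fst_conv snd_conv b_def)
  also have "\<dots> = (b, K_action (b \<otimes>\<^bsub>K\<^esub> l) X)"
    by (simp only: K_action_comp l(2))
  also have "\<dots> = (b \<otimes>\<^bsub>K\<^esub> l, 0) \<otimes>\<^bsub>G\<^esub> g \<otimes>\<^bsub>G\<^esub> (inv\<^bsub>K\<^esub> (b \<otimes>\<^bsub>K\<^esub> l \<otimes>\<^bsub>K\<^esub> a) \<otimes>\<^bsub>K\<^esub> b, 0)"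
  proof -
    have "(b \<otimes>\<^bsub>K\<^esub> l \<otimes>\<^bsub>K\<^esub> a) \<otimes>\<^bsub>K\<^esub> (inv\<^bsub>K\<^esub> (b \<otimes>\<^bsub>K\<^esub> l \<otimes>\<^bsub>K\<^esub> a) \<otimes>\<^bsub>K\<^esub> b) = b"
      by (intro KN.K.mult_inv_mult KN.K.m_closed a b l(1))
    then show ?thesis
      by (simp only: gaX KN_mult K_action_0 N_group_simps n_bracket_simps) simp
  qed
  also have "F \<dots> = cadj (\<tau> (inv\<^bsub>K\<^esub> (b \<otimes>\<^bsub>K\<^esub> l \<otimes>\<^bsub>K\<^esub> a) \<otimes>\<^bsub>K\<^esub> b)) ** F g ** cadj (\<tau> (b \<otimes>\<^bsub>K\<^esub> l))"
    by (intro equivariantD F g KN.K.m_closed KN.K.inv_closed a b l(1))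
  also have "\<dots> = F g ** cadj (\<tau> (b \<otimes>\<^bsub>K\<^esub> l) ** \<tau> (inv\<^bsub>K\<^esub> (b \<otimes>\<^bsub>K\<^esub> l \<otimes>\<^bsub>K\<^esub> a) \<otimes>\<^bsub>K\<^esub> b))"
    by (rule cadj_mult_one_dim[OF d])
  also have "\<tau> (b \<otimes>\<^bsub>K\<^esub> l) ** \<tau> (inv\<^bsub>K\<^esub> (b \<otimes>\<^bsub>K\<^esub> l \<otimes>\<^bsub>K\<^esub> a) \<otimes>\<^bsub>K\<^esub> b) = mat 1"
  proof -
    obtain z k where ak: "a = (z, k)" by (rule prod.exhaust)
    have z: "norm z = 1" and k: "k ** qadj k = mat 1" using a by (simp_all add: ak K_group_carrier)
    have bz: "b = (z, qadj k)" by (simp add: b_def K_inv_def sigma_K_def ak)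
    have "inv\<^bsub>K\<^esub> a \<otimes>\<^bsub>K\<^esub> b = (1, qadj k ** qadj k)"
      by (simp only: K_inv[OF a]) (simp add: ak bz K_inv_def cnj_mult_unit(1)[OF z])
    moreover have "qadj k \<in> carrier Sp_group"
      by (simp add: Sp_left_inverse k)
    then have "qadj k ** qadj k \<in> carrier Sp_group"
      using monoid.m_closed[OF group.is_monoid[OF group_Sp]] Sp_group_simps(2) by metis
    ultimately have ab: "\<tau> (inv\<^bsub>K\<^esub> a \<otimes>\<^bsub>K\<^esub> b) = mat 1"
      using triv by simp
    have bl: "b \<otimes>\<^bsub>K\<^esub> l \<in> carrier K" using b l(1) by (rule KN.K.m_closed)
    have "\<tau> (inv\<^bsub>K\<^esub> (b \<otimes>\<^bsub>K\<^esub> l \<otimes>\<^bsub>K\<^esub> a) \<otimes>\<^bsub>K\<^esub> b) = cadj (\<tau> (b \<otimes>\<^bsub>K\<^esub> l) ** \<tau> a) ** \<tau> b"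
      using a b bl by (simp only: tau_mult tau_inv KN.K.m_closed KN.K.inv_closed)
    also have "\<dots> = cadj (\<tau> (b \<otimes>\<^bsub>K\<^esub> l)) ** (cadj (\<tau> a) ** \<tau> b)"
      by (simp only: cadj_mult matrix_mul_assoc
          matrix_one_dim_commute[OF d, of "cadj (\<tau> a)" "cadj (\<tau> (b \<otimes>\<^bsub>K\<^esub> l))"])
    also have "cadj (\<tau> a) ** \<tau> b = mat 1"
      using ab a b by (simp only: tau_mult tau_inv KN.K.inv_closed)
    finally show ?thesis
      by (simp only: matrix_mul_rid tau_unitary(1)[OF bl])
  qed
  finally show ?thesis by simp
qed

text \<open>The substitution \<open>x = h \<sigma>(w)\<close> with
  \<open>h = \<sigma>(g)\<^sup>-\<^sup>1\<close>, justified by left invariance and invariance under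
  \<sigma>, turns one convolution at \<open>h\<close> into the other at \<open>g\<close>. A
  convolution is itself equivariant, so its values at \<open>h\<close> and \<open>g\<close> agree;
  in dimension one the matrix factors may be exchanged.\<close>

lemma commutative_triple_of_trivial:
  assumes d: "CARD('d) = 1" and triv: "\<And>k. k \<in> carrier Sp_group \<Longrightarrow> \<tau> (1, k) = mat 1"
  shows "commutative_triple G \<mu> (carrier K \<times> {\<one>\<^bsub>N_group\<^esub>}) (\<lambda>(k, x). \<tau> k)"
  unfolding commutative_triple_def
proof (intro ballI AE_I2)
  fix F\<^sub>1 F\<^sub>2 g assume F: "F\<^sub>1 \<in> L1" "F\<^sub>2 \<in> L1" and "g \<in> space \<mu>"
  then have g: "g \<in> carrier G" by (simp only: space_mu)
  have inv: "F (inv\<^bsub>G\<^esub> (sigma x)) = F x" if "equivariant F" "x \<in> carrier G" for F x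
    by (rule equivariant_sigma_inv[OF d _ that]) (rule triv)
  have equiv: "equivariant F\<^sub>1" "equivariant F\<^sub>2"
    using F unfolding L1_iff by blast+
  define h where "h = inv\<^bsub>G\<^esub> (sigma g)"
  have h: "h \<in> carrier G" unfolding h_def by (intro G.inv_closed sigma_closed g)
  have "sigma \<in> hom G G"
    unfolding hom_def using sigma_closed sigma_hom by blast
  then interpret sigma: group_hom G G sigma
    by unfold_locales
  let ?\<phi> = "\<lambda>w. h \<otimes>\<^bsub>G\<^esub> sigma w"
  have \<phi>: "?\<phi> \<in> measurable \<mu> \<mu>"
    by (rule measurable_compose[OF sigma_measurable measurable_translate(1)[OF h]])
  have "distr \<mu> \<mu> ?\<phi> = distr (distr \<mu> \<mu> sigma) \<mu> (\<lambda>y. h \<otimes>\<^bsub>G\<^esub> y)"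
    using distr_distr[OF measurable_translate(1)[OF h] sigma_measurable] by (simp only: o_def)
  then have "distr \<mu> \<mu> ?\<phi> = \<mu>"
    by (simp only: distr_sigma distr_translate[OF h])
  then have "convolution G \<mu> F\<^sub>1 F\<^sub>2 h = (LINT x|distr \<mu> \<mu> ?\<phi>. F\<^sub>2 (inv\<^bsub>G\<^esub> x \<otimes>\<^bsub>G\<^esub> h) ** F\<^sub>1 x)"
    by (simp only: convolution_def)
  also have "\<dots> = (LINT w|\<mu>. F\<^sub>2 (inv\<^bsub>G\<^esub> (?\<phi> w) \<otimes>\<^bsub>G\<^esub> h) ** F\<^sub>1 (?\<phi> w))"
    by (rule integral_distr[OF \<phi> convolution_integrand_measurable[OF F h]])
  also have "\<dots> = (LINT w|\<mu>. F\<^sub>1 (inv\<^bsub>G\<^esub> w \<otimes>\<^bsub>G\<^esub> g) ** F\<^sub>2 w)"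
  proof (rule Bochner_Integration.integral_cong[OF refl])
    fix w assume "w \<in> space \<mu>"
    then have w: "w \<in> carrier G" by (simp only: space_mu)
    have wg: "inv\<^bsub>G\<^esub> w \<otimes>\<^bsub>G\<^esub> g \<in> carrier G"
      by (intro G.m_closed G.inv_closed w g)
    have 1: "inv\<^bsub>G\<^esub> (?\<phi> w) \<otimes>\<^bsub>G\<^esub> h = inv\<^bsub>G\<^esub> (sigma w)"
      by (rule G.inv_mult_left_cancel[OF h sigma_closed[OF w]])
    have "sigma (inv\<^bsub>G\<^esub> w \<otimes>\<^bsub>G\<^esub> g) = inv\<^bsub>G\<^esub> (sigma w) \<otimes>\<^bsub>G\<^esub> sigma g"
      by (simp only: sigma_hom sigma.hom_inv[OF w])
    then have 2: "?\<phi> w = inv\<^bsub>G\<^esub> (sigma (inv\<^bsub>G\<^esub> w \<otimes>\<^bsub>G\<^esub> g))"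
      using G.inv_mult_inv[OF sigma_closed[OF w] sigma_closed[OF g]] by (simp only: h_def)
    have "F\<^sub>2 (inv\<^bsub>G\<^esub> (?\<phi> w) \<otimes>\<^bsub>G\<^esub> h) = F\<^sub>2 w"
      unfolding 1 by (rule inv[OF equiv(2) w])
    moreover have "F\<^sub>1 (?\<phi> w) = F\<^sub>1 (inv\<^bsub>G\<^esub> w \<otimes>\<^bsub>G\<^esub> g)"
      unfolding 2 by (rule inv[OF equiv(1) wg])
    ultimately show "F\<^sub>2 (inv\<^bsub>G\<^esub> (?\<phi> w) \<otimes>\<^bsub>G\<^esub> h) ** F\<^sub>1 (?\<phi> w) = F\<^sub>1 (inv\<^bsub>G\<^esub> w \<otimes>\<^bsub>G\<^esub> g) ** F\<^sub>2 w"
      by (simp only: matrix_one_dim_commute[OF d, of "F\<^sub>2 w"])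
  qed
  also have "\<dots> = convolution G \<mu> F\<^sub>2 F\<^sub>1 g"
    by (simp only: convolution_def)
  finally show "convolution G \<mu> F\<^sub>1 F\<^sub>2 g = convolution G \<mu> F\<^sub>2 F\<^sub>1 g"
    unfolding h_def inv[OF convolution_equivariant[OF F] g] .
qed

end

section \<open>Necessity: commutativity forces dimension one\<close>

section \<open>A point with small stabilizer\<close>

text \<open>By the parallelogram law the squared norm of \<open>p - q\<close> is four times that of
  \<open>x\<close> minus the squared norm of \<open>x + x\<close>, which is zero.\<close>

lemma norm_midpoint_unique:
  fixes p q x :: "'a::real_inner"
  assumes "p + q = x + x" "norm p = norm x" "norm q = norm x"
  shows "p = x" "q = x"
proof -
  have "inner (p + q) (p + q) = inner (x + x) (x + x)" using assms(1) by simp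
  then have "inner (p - q) (p - q) = 0"
    using assms(2,3) by (simp add: norm_eq_sqrt_inner algebra_simps inner_commute)
  then have "p = q" by simp
  with assms(1) have "2 *\<^sub>R p = 2 *\<^sub>R x" by (simp add: scaleR_2)
  then show "p = x" "q = x" using \<open>p = q\<close> by simp_all
qed

text \<open>The central coordinate can only be compared after the coordinates in \<open>V\<close> are known to
  agree, because the bracket then vanishes.\<close>

lemma K_action_product_extremal:
  fixes X :: "'n::finite nalg"
  assumes a: "a \<in> carrier K_group" and b: "b \<in> carrier K_group"
    and eq: "K_action a X \<otimes>\<^bsub>N_group\<^esub> K_action b X = X + X"
  shows "K_action a X = X" "K_action b X = X"
proof -
  let ?p = "K_action a X" and ?q = "K_action b X"
  have snd_bracket: "snd (n_bracket Y Z) = 0" for Y Z :: "'n nalg"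
    by (simp add: n_bracket_alt)
  have "snd ?p + snd ?q = snd X + snd X"
    using arg_cong[OF eq, of snd] by (simp add: snd_bracket)
  note v = norm_midpoint_unique[OF this norm_K_action(1)[OF a] norm_K_action(1)[OF b]]
  have "n_bracket ?p ?q = n_bracket X X"
    by (simp only: n_bracket_alt v)
  then have sum: "?p + ?q = X + X"
    using eq by simp
  have "fst (fst ?p) + fst (fst ?q) = fst (fst X) + fst (fst X)"
    using arg_cong[OF sum, of "\<lambda>Y. fst (fst Y)"] by simp
  note A = norm_midpoint_unique[OF this norm_K_action(2)[OF a] norm_K_action(2)[OF b]]
  have "snd (fst ?p) + snd (fst ?q) = snd (fst X) + snd (fst X)"
    using arg_cong[OF sum, of "\<lambda>Y. snd (fst Y)"] by simp
  note q = norm_midpoint_unique[OF this norm_K_action(3)[OF a] norm_K_action(3)[OF b]]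
  show "?p = X" "?q = X"
    by (simp_all only: prod_eq_iff v A q simp_thms)
qed

text \<open>Each coordinate removes one freedom: a diagonal \<open>A\<close> with distinct real
  entries makes \<open>k\<close> diagonal, \<open>q = j\<close> leaves \<open>z = 1\<close> or
  \<open>z = - 1\<close>, and the all-ones vector makes every diagonal entry of \<open>k\<close>
  equal to \<open>z\<close>.\<close>

lemma exists_regular_point:
  obtains X :: "'n::finite nalg" where "X \<in> lie_algebra_n"
    "\<And>a. a \<in> carrier K_group \<Longrightarrow> K_action a X = X \<Longrightarrow>
      a = (1, mat 1) \<or> a = (- 1, mat (- 1))"
proof -
  obtain f :: "'n \<Rightarrow> nat" and m where f: "inj f"
    using finite_imp_inj_to_nat_seg[of "UNIV :: 'n set"] by auto
  \<comment> \<open>Subtracting the mean achieves trace zero and keeps the entries distinct.\<close>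
  define d where "d i = real (f i) - (\<Sum>j\<in>UNIV. real (f j)) / real CARD('n)" for i
  have d_inj: "d i = d j \<longleftrightarrow> i = j" for i j
    using f by (auto simp: d_def inj_def)
  have d_sum: "(\<Sum>i\<in>UNIV. d i) = 0"
    by (simp add: d_def sum_subtractf)
  define A :: "quat^'n^'n" where "A = (\<chi> i j. if i = j then of_real (d i) else 0)"
  define X where "X = ((A, qj), (\<chi> i. 1) :: quat^'n)"
  have "trace A = of_real (\<Sum>i\<in>UNIV. d i)"
    by (simp add: trace_def A_def)
  then have "A \<in> H0"
    by (auto simp: H0_def d_sum vec_eq_iff A_def)
  then have X: "X \<in> lie_algebra_n"
    by (simp add: X_def lie_algebra_n_def Im_quat_def)
  have "a = (1, mat 1) \<or> a = (- 1, mat (- 1))"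
    if a: "a \<in> carrier K_group" and fixed: "K_action a X = X" for a
  proof -
    obtain z k where ak: "a = (z, k)" by (rule prod.exhaust)
    have z: "norm z = 1" and k: "k ** qadj k = mat 1"
      using a by (simp_all add: ak K_group_carrier)
    have eqs: "k ** A ** qadj k = A" "quat_of_complex z * qj * quat_of_complex (cnj z) = qj"
      "rmul (k *v (\<chi> i. 1)) (quat_of_complex (cnj z)) = (\<chi> i. 1)"
      using fixed by (simp_all add: ak X_def K_action_simp)
    have "k ** A = A ** k"
      using eqs(1) Sp_left_inverse[OF k] by (metis matrix_mul_assoc matrix_mul_rid)
    have offdiag: "k $ i $ j = 0" if "i \<noteq> j" for i j
    proof -
      have "(k ** A) $ i $ j = k $ i $ j * of_real (d j)"
        by (simp add: matrix_mult_nth A_def if_distrib cong: if_cong)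
      moreover have "(A ** k) $ i $ j = of_real (d i) * k $ i $ j"
        by (simp add: matrix_mult_nth A_def if_distrib if_distribR cong: if_cong)
      ultimately have "of_real (d j) * k $ i $ j = of_real (d i) * k $ i $ j"
        using \<open>k ** A = A ** k\<close> quat_of_real_commute[of "d j"] by metis
      then have "of_real (d j) = (of_real (d i) :: quat) \<or> k $ i $ j = 0"
        by auto
      then show ?thesis
        using that d_inj by (metis of_real_eq_iff)
    qed
    have "(Re z)\<^sup>2 - (Im z)\<^sup>2 = 1"
      using eqs(2) by (simp add: quat_eq_iff power2_eq_square)
    moreover have "(Re z)\<^sup>2 + (Im z)\<^sup>2 = 1"
      using z by (simp add: cmod_def)
    ultimately have "(Im z)\<^sup>2 = 0" "(Re z)\<^sup>2 = 1"
      by linarith+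
    then have z': "z = 1 \<or> z = - 1"
      by (auto simp: complex_eq_iff power2_eq_1_iff)
    have diag: "k $ i $ i * quat_of_complex (cnj z) = 1" for i
    proof -
      have "(k *v (\<chi> i. 1)) $ i = (\<Sum>j\<in>UNIV. if j = i then k $ i $ i else 0)"
        unfolding matrix_vector_nth by (intro sum.cong) (auto simp: offdiag)
      then have "(k *v (\<chi> i. 1)) $ i = k $ i $ i" by simp
      then show ?thesis
        using arg_cong[OF eqs(3), of "\<lambda>v. v $ i"] by simp
    qed
    then have "k = mat (quat_of_complex z)"
      using z' by (auto simp: vec_eq_iff mat_def offdiag) (metis add.inverse_inverse)
    then show ?thesis
      using z' by (auto simp: ak)
  qed
  then show ?thesis
    using that X by blast
qed

section \<open>Averages over the compact group\<close>

context KN_haar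
begin

text \<open>A Haar measure of \<open>K\<close> up to scaling, cut out of the given measure by the
  compact set \<open>K\<close> times the unit ball.\<close>

definition kappa :: "(complex \<times> (quat^'n^'n)) measure" where
  "kappa = distr (restrict_space \<mu> (KN_ball 1)) (restrict_space borel (carrier K_group)) fst"

lemma sets_kappa: "sets kappa = sets (restrict_space borel (carrier K_group))"
  by (simp add: kappa_def)

lemma space_kappa: "space kappa = carrier K_group"
  by (simp add: kappa_def space_restrict_space)

lemma fst_measurable:
  "fst \<in> measurable (restrict_space \<mu> (KN_ball 1)) (restrict_space borel (carrier K_group))"
proof (rule measurable_restrict_space2)
  show "fst \<in> space (restrict_space \<mu> (KN_ball 1)) \<rightarrow> carrier K_group"
    by (auto simp only: space_restrict_space KN_ball_def fst_conv)
  show "fst \<in> measurable (restrict_space \<mu> (KN_ball 1)) borel"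
    by (intro measurable_restrict_space1 measurable_continuous continuous_intros)
qed

lemma emeasure_kappa:
  assumes "A \<in> sets kappa"
  shows "emeasure kappa A = emeasure \<mu> {g \<in> KN_ball 1. fst g \<in> A}"
proof -
  have "KN_ball 1 \<subseteq> space \<mu>"
    unfolding space_mu by (rule KN_ball_subset)
  then have sp: "space (restrict_space \<mu> (KN_ball 1)) = KN_ball 1"
    by (auto simp only: space_restrict_space)
  have "emeasure kappa A = emeasure (restrict_space \<mu> (KN_ball 1)) (fst -` A \<inter> KN_ball 1)"
    using assms unfolding kappa_def
    by (subst emeasure_distr[OF fst_measurable]) (simp_all only: sets_distr sp)
  also have "\<dots> = emeasure \<mu> (fst -` A \<inter> KN_ball 1)"
    using KN_ball_sets sets.sets_into_space[OF KN_ball_sets]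
    by (intro emeasure_restrict_space) (auto simp only: Int_absorb2)
  also have "fst -` A \<inter> KN_ball 1 = {g \<in> KN_ball 1. fst g \<in> A}"
    by blast
  finally show ?thesis .
qed

lemma kappa_set_measurable:
  assumes "A \<in> sets kappa"
  shows "{g \<in> KN_ball 1. fst g \<in> A} \<in> sets \<mu>"
proof -
  have "KN_ball 1 \<subseteq> space \<mu>"
    unfolding space_mu by (rule KN_ball_subset)
  then have sp: "space (restrict_space \<mu> (KN_ball 1)) = KN_ball 1"
    by (auto simp only: space_restrict_space)
  have "fst -` A \<inter> KN_ball 1 \<in> sets (restrict_space \<mu> (KN_ball 1))"
    using measurable_sets[OF fst_measurable, of A] assms by (simp only: sets_kappa sp)
  moreover have "fst -` A \<inter> KN_ball 1 = {g \<in> KN_ball 1. fst g \<in> A}"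
    by blast
  ultimately show ?thesis
    using KN_ball_sets sets.sets_into_space[OF KN_ball_sets]
    by (subst (asm) sets_restrict_space_iff) (auto simp only: Int_absorb2)
qed

sublocale kappa: finite_measure kappa
proof
  have "emeasure kappa (space kappa) \<le> emeasure \<mu> (KN_ball 1)"
    by (subst emeasure_kappa) (auto intro!: emeasure_mono KN_ball_sets)
  then show "emeasure kappa (space kappa) \<noteq> \<infinity>"
    using KN_ball_finite[of 1] neq_top_trans by auto
qed

lemma kappa_measurable_continuous:
  fixes f :: "_ \<Rightarrow> 'b::topological_space"
  assumes "continuous_on (carrier K_group) f"
  shows "f \<in> borel_measurable kappa"
  unfolding measurable_cong_sets[OF sets_kappa refl]
  by (rule borel_measurable_continuous_on_restrict[OF assms])

lemma kappa_measurable_translate: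
  assumes l: "l \<in> carrier K_group"
  shows "(\<lambda>k. l \<otimes>\<^bsub>K_group\<^esub> k) \<in> measurable kappa kappa"
  unfolding measurable_cong_sets[OF refl sets_kappa]
proof (rule measurable_restrict_space2)
  show "(\<lambda>k. l \<otimes>\<^bsub>K_group\<^esub> k) \<in> space kappa \<rightarrow> carrier K_group"
    unfolding space_kappa using KN.K.m_closed[OF l] by blast
  show "(\<lambda>k. l \<otimes>\<^bsub>K_group\<^esub> k) \<in> borel_measurable kappa"
    by (intro kappa_measurable_continuous continuous_intros)
qed

text \<open>Left translation by \<open>(l, 0)\<close> covers translation by \<open>l\<close> on
  \<open>K\<close> and acts on the Lie algebra by an isometry, so it preserves the ball used to
  define \<open>kappa\<close>.\<close>

lemma kappa_translate:
  assumes l: "l \<in> carrier K_group"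
  shows "distr kappa kappa (\<lambda>k. l \<otimes>\<^bsub>K_group\<^esub> k) = kappa"
proof (rule measure_eqI)
  fix A assume "A \<in> sets (distr kappa kappa (\<lambda>k. l \<otimes>\<^bsub>K_group\<^esub> k))"
  then have A: "A \<in> sets kappa" by simp
  have l0: "(l, 0) \<in> carrier KN_group"
    using l subspace_0[OF subspace_lie_algebra_n] by (simp only: KN_carrier simp_thms)
  let ?A' = "(\<lambda>k. l \<otimes>\<^bsub>K_group\<^esub> k) -` A \<inter> space kappa"
  have "emeasure (distr kappa kappa (\<lambda>k. l \<otimes>\<^bsub>K_group\<^esub> k)) A = emeasure kappa ?A'"
    by (rule emeasure_distr[OF kappa_measurable_translate[OF l] A])
  also have "\<dots> = emeasure \<mu> {g \<in> KN_ball 1. fst g \<in> ?A'}"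
    by (intro emeasure_kappa measurable_sets[OF kappa_measurable_translate[OF l] A])
  also have "{g \<in> KN_ball 1. fst g \<in> ?A'} =
      (\<lambda>g. (l, 0) \<otimes>\<^bsub>KN_group\<^esub> g) -` {g \<in> KN_ball 1. fst g \<in> A} \<inter> space \<mu>"
  proof -
    have 1: "(l, 0) \<otimes>\<^bsub>KN_group\<^esub> (k, Y) = (l \<otimes>\<^bsub>K_group\<^esub> k, K_action l Y)" for k and Y :: "'n nalg"
      by (simp only: KN_mult N_group_simps n_bracket_simps) simp
    have 2: "l \<otimes>\<^bsub>K_group\<^esub> k \<in> carrier K_group" if "k \<in> carrier K_group" for k
      using l that by (rule KN.K.m_closed)
    show ?thesis
      unfolding space_mu space_kappa
    proof (rule Set.set_eqI)
      fix g :: "(complex \<times> (quat^'n^'n)) \<times> 'n nalg"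
      obtain k Y where g: "g = (k, Y)" by (rule prod.exhaust)
      show "g \<in> {g \<in> KN_ball 1. fst g \<in> (\<lambda>k. l \<otimes>\<^bsub>K_group\<^esub> k) -` A \<inter> carrier K_group} \<longleftrightarrow>
        g \<in> (\<lambda>g. (l, 0) \<otimes>\<^bsub>KN_group\<^esub> g) -` {g \<in> KN_ball 1. fst g \<in> A} \<inter> carrier KN_group"
        unfolding g vimage_def Int_iff mem_Collect_eq 1 fst_conv KN_carrier KN_ball_def mem_Times_iff
          snd_conv mem_cball dist_0_norm norm_K_action(4)[OF l]
        using 2 K_action_closed[OF l] by blast
    qed
  qed
  also have "emeasure \<mu> \<dots> = emeasure (distr \<mu> \<mu> (\<lambda>g. (l, 0) \<otimes>\<^bsub>KN_group\<^esub> g)) {g \<in> KN_ball 1. fst g \<in> A}"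
    by (rule emeasure_distr[OF measurable_translate(1)[OF l0] kappa_set_measurable[OF A], symmetric])
  also have "\<dots> = emeasure kappa A"
    by (simp only: distr_translate[OF l0] emeasure_kappa[OF A])
  finally show "emeasure (distr kappa kappa (\<lambda>k. l \<otimes>\<^bsub>K_group\<^esub> k)) A = emeasure kappa A" .
qed simp

lemma kappa_open_positive:
  assumes U: "open U" and ne: "U \<inter> carrier K_group \<noteq> {}"
  shows "emeasure kappa (U \<inter> carrier K_group) > 0"
proof -
  have A: "U \<inter> carrier K_group \<in> sets kappa"
    unfolding sets_kappa using U compact_imp_closed[OF compact_K]
    by (subst sets_restrict_space_iff) (auto intro: borel_closed sets.Int borel_open)
  have "open (U \<times> ball (0 :: 'n nalg) 1)"
    using U by (intro open_Times) auto
  moreover obtain k where "k \<in> U" "k \<in> carrier K_group"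
    using ne by blast
  then have "(k, 0) \<in> (U \<times> ball (0 :: 'n nalg) 1) \<inter> carrier KN_group"
    using subspace_0[OF subspace_lie_algebra_n] by (simp add: KN_carrier)
  then have "(U \<times> ball (0 :: 'n nalg) 1) \<inter> carrier KN_group \<noteq> {}"
    by blast
  ultimately have "0 < emeasure \<mu> ((U \<times> ball 0 1) \<inter> carrier KN_group)"
    by (rule open_positive)
  also have "\<dots> \<le> emeasure \<mu> {g \<in> KN_ball 1. fst g \<in> U \<inter> carrier K_group}"
  proof (rule emeasure_mono[OF _ kappa_set_measurable[OF A]], rule subsetI)
    fix g assume "g \<in> (U \<times> ball (0 :: 'n nalg) 1) \<inter> carrier KN_group"
    then show "g \<in> {g \<in> KN_ball 1. fst g \<in> U \<inter> carrier K_group}"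
      by (cases g) (simp add: KN_ball_def KN_carrier)
  qed
  finally show ?thesis
    by (simp only: emeasure_kappa[OF A])
qed

end

section \<open>Equivariant bump functions\<close>

lemma bounded_bilinear_matrix_mult:
  "bounded_bilinear ((**) :: complex^'d^'d \<Rightarrow> complex^'d^'d \<Rightarrow> complex^'d^'d)"
  unfolding bilinear_conv_bounded_bilinear[symmetric] bilinear_def
  by (auto intro!: linearI simp: matrix_add_rdistrib matrix_add_ldistrib matrix_scaleR_mult)

lemma matrix_mult_norm_bound:
  "\<exists>c>0. \<forall>P Q. norm ((P :: complex^'d^'d) ** (Q :: complex^'d^'d)) \<le> norm P * norm Q * c"
  by (rule bounded_bilinear.pos_bounded[OF bounded_bilinear_matrix_mult])

context KN_rep
begin

lemma tau_continuous: "continuous_on (carrier K) \<tau>"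
  using rep by (simp add: unitary_rep_def)

definition Ad :: "complex \<times> (quat^'n^'n) \<Rightarrow> complex^'d^'d \<Rightarrow> complex^'d^'d" where
  "Ad k M = \<tau> k ** M ** cadj (\<tau> k)"

lemma Ad_continuous: "continuous_on (carrier K) (\<lambda>k. Ad k M)"
  unfolding Ad_def by (intro continuous_intros tau_continuous)

lemma Ad_mult: "k \<in> carrier K \<Longrightarrow> l \<in> carrier K \<Longrightarrow> Ad (k \<otimes>\<^bsub>K\<^esub> l) M = \<tau> k ** Ad l M ** cadj (\<tau> k)"
  by (simp add: Ad_def tau_mult cadj_mult matrix_mul_assoc)

lemma Ad_bounded:
  obtains C where "\<And>k. k \<in> carrier K \<Longrightarrow> norm (Ad k M) \<le> C"
proof -
  have "compact ((\<lambda>k. Ad k M) ` carrier K)"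
    by (intro compact_continuous_image Ad_continuous compact_K)
  then show ?thesis
    using that by (meson bounded_iff compact_imp_bounded imageI)
qed

text \<open>Equals one exactly when \<open>x\<close> lies in the translate of \<open>B\<close> by
  \<open>k\<close>.\<close>

definition bump :: "'n nalg set \<Rightarrow> 'n nalg \<Rightarrow> complex \<times> (quat^'n^'n) \<Rightarrow> real" where
  "bump B x k = indicator B (K_action (K_inv k) x)"

definition weight :: "'n nalg set \<Rightarrow> 'n nalg \<Rightarrow> real" where
  "weight B x = (LINT k|kappa. bump B x k)"

text \<open>For a small \<open>B\<close> around \<open>X\<close>, only those \<open>k\<close> with
  \<open>k X\<close> near \<open>x\<close> contribute. Conjugating the value along with the point
  makes the average equivariant under \<open>K\<close>.\<close>

definition smear :: "'n nalg set \<Rightarrow> complex^'d^'d \<Rightarrow> 'n nalg \<Rightarrow> complex^'d^'d" where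
  "smear B M x = (LINT k|kappa. bump B x k *\<^sub>R Ad k M)"

text \<open>An equivariant function on \<open>K \<ltimes> N\<close> is determined by its restriction
  to \<open>N\<close>, since \<open>(k, x)\<close> is \<open>(1, x)\<close> times
  \<open>(k, 0)\<close>; this is the corresponding extension of \<open>smear\<close>.\<close>

definition lift :: "'n nalg set \<Rightarrow> complex^'d^'d \<Rightarrow> (complex \<times> (quat^'n^'n)) \<times> 'n nalg \<Rightarrow> complex^'d^'d" where
  "lift B M g = cadj (\<tau> (fst g)) ** smear B M (snd g)"

lemma bump_bounds: "0 \<le> bump B x k" "bump B x k \<le> 1" "norm (bump B x k) \<le> 1"
  by (simp_all add: bump_def indicator_def)

lemma bump_measurable_pair:
  assumes "open B"
  shows "(\<lambda>p. bump B (snd (fst p)) (snd p)) \<in> borel_measurable (\<mu> \<Otimes>\<^sub>M kappa)"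
proof -
  have kappa_id: "(\<lambda>k. k) \<in> measurable kappa borel"
    by (intro kappa_measurable_continuous continuous_intros)
  have "(\<lambda>p. (fst p, snd p)) \<in> measurable (\<mu> \<Otimes>\<^sub>M kappa) (borel \<Otimes>\<^sub>M borel)"
    by (intro measurable_Pair measurable_compose[OF measurable_fst measurable_id_borel]
        measurable_compose[OF measurable_snd kappa_id])
  then have "(\<lambda>p. (fst p, snd p)) \<in> measurable (\<mu> \<Otimes>\<^sub>M kappa) borel"
    by (simp only: borel_prod)
  moreover have "(\<lambda>p :: ((complex \<times> (quat^'n^'n)) \<times> 'n nalg) \<times> (complex \<times> (quat^'n^'n)).
      K_action (K_inv (snd p)) (snd (fst p))) \<in> borel_measurable borel"
    by (intro borel_measurable_continuous_onI continuous_intros)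
  ultimately have "(\<lambda>p. K_action (K_inv (snd p)) (snd (fst p))) \<in> measurable (\<mu> \<Otimes>\<^sub>M kappa) borel"
    using measurable_compose by fastforce
  then show ?thesis
    unfolding bump_def by (rule measurable_compose) (use assms in auto)
qed

lemma bump_measurable:
  assumes "open B" shows "bump B x \<in> borel_measurable kappa"
proof -
  have "(\<lambda>k. K_action (K_inv k) x) \<in> measurable kappa borel"
    by (intro kappa_measurable_continuous continuous_intros)
  then show ?thesis
    unfolding bump_def by (rule measurable_compose) (use assms in auto)
qed

lemma bump_integrable: "open B \<Longrightarrow> integrable kappa (bump B x)"
  using bump_bounds by (intro kappa.integrable_const_bound[of _ 1] bump_measurable) auto

lemma bump_Ad_integrable:
  assumes "open B" shows "integrable kappa (\<lambda>k. bump B x k *\<^sub>R Ad k M)"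
proof -
  obtain C where C: "\<And>k. k \<in> carrier K \<Longrightarrow> norm (Ad k M) \<le> C"
    using Ad_bounded by blast
  show ?thesis
  proof (rule kappa.integrable_const_bound[of _ C])
    show "AE k in kappa. norm (bump B x k *\<^sub>R Ad k M) \<le> C"
    proof (rule AE_I2)
      fix k assume "k \<in> space kappa"
      then have "norm (Ad k M) \<le> C" unfolding space_kappa by (rule C)
      moreover have "norm (bump B x k *\<^sub>R Ad k M) \<le> 1 * norm (Ad k M)"
        unfolding norm_scaleR by (intro mult_right_mono) (use bump_bounds(3) in auto)
      ultimately show "norm (bump B x k *\<^sub>R Ad k M) \<le> C" by simp
    qed
    show "(\<lambda>k. bump B x k *\<^sub>R Ad k M) \<in> borel_measurable kappa"
      by (intro borel_measurable_scaleR bump_measurable assms kappa_measurable_continuous Ad_continuous)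
  qed
qed

lemma weight_nonneg: "0 \<le> weight B x"
  unfolding weight_def using bump_bounds by (intro Bochner_Integration.integral_nonneg) auto

text \<open>Elements \<open>k\<close> close to the identity keep \<open>x\<close> inside the open
  set \<open>B\<close>, and open sets meeting \<open>K\<close> have positive mass.\<close>

lemma weight_pos:
  assumes B: "open B" and x: "x \<in> B"
  shows "0 < weight B x"
proof -
  let ?U = "(\<lambda>k. K_action (K_inv k) x) -` B"
  have U: "open ?U"
    using B by (intro open_vimage continuous_intros)
  have "K_inv \<one>\<^bsub>K\<^esub> = \<one>\<^bsub>K\<^esub>"
    by (simp add: K_group_one K_inv_def)
  then have "\<one>\<^bsub>K\<^esub> \<in> ?U \<inter> carrier K"
    using x KN.K.one_closed by (simp only: vimage_eq Int_iff K_action_one simp_thms)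
  then have pos: "0 < emeasure kappa (?U \<inter> carrier K)"
    using U by (intro kappa_open_positive) auto
  have sets: "?U \<inter> carrier K \<in> sets kappa"
    unfolding sets_kappa using U compact_imp_closed[OF compact_K]
    by (subst sets_restrict_space_iff) (auto intro: borel_closed sets.Int borel_open)
  have "weight B x = (LINT k|kappa. indicator (?U \<inter> carrier K) k)"
    unfolding weight_def bump_def
    by (rule Bochner_Integration.integral_cong[OF refl]) (simp add: space_kappa indicator_def)
  also have "\<dots> = measure kappa (?U \<inter> carrier K)"
    using sets.sets_into_space[OF sets] by (simp add: Int_absorb2)
  finally show ?thesis
    using pos by (simp add: kappa.emeasure_eq_measure)
qed

lemma smear_norm_bounded:
  assumes "open B"
  obtains C where "\<And>x. norm (smear B M x) \<le> C"
proof -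
  obtain C where C: "\<And>k. k \<in> carrier K \<Longrightarrow> norm (Ad k M) \<le> C"
    using Ad_bounded by blast
  have "norm (smear B M x) \<le> C * measure kappa (space kappa)" for x
  proof -
    have "norm (smear B M x) \<le> (LINT k|kappa. norm (bump B x k *\<^sub>R Ad k M))"
      unfolding smear_def by (rule integral_norm_bound)
    also have "\<dots> \<le> (LINT k|kappa. C)"
    proof (rule Bochner_Integration.integral_mono)
      show "integrable kappa (\<lambda>k. norm (bump B x k *\<^sub>R Ad k M))"
        by (intro integrable_norm bump_Ad_integrable assms)
      fix k assume "k \<in> space kappa"
      then have "norm (Ad k M) \<le> C" unfolding space_kappa by (rule C)
      moreover have "norm (bump B x k *\<^sub>R Ad k M) \<le> 1 * norm (Ad k M)"
        unfolding norm_scaleR by (intro mult_right_mono) (use bump_bounds(3) in auto)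
      ultimately show "norm (bump B x k *\<^sub>R Ad k M) \<le> C" by simp
    qed simp
    finally show ?thesis by (simp add: mult.commute)
  qed
  then show ?thesis using that by blast
qed

lemma smear_equivariant:
  assumes l: "l \<in> carrier K" and B: "open B"
  shows "smear B M (K_action l x) = \<tau> l ** smear B M x ** cadj (\<tau> l)"
proof -
  have meas: "(\<lambda>k. bump B (K_action l x) k *\<^sub>R Ad k M) \<in> borel_measurable kappa"
    using bump_Ad_integrable[OF B] by (rule borel_measurable_integrable)
  have "smear B M (K_action l x) =
      (LINT k|distr kappa kappa (\<lambda>k. l \<otimes>\<^bsub>K\<^esub> k). bump B (K_action l x) k *\<^sub>R Ad k M)"
    by (simp only: smear_def kappa_translate[OF l])
  also have "\<dots> = (LINT k|kappa. bump B (K_action l x) (l \<otimes>\<^bsub>K\<^esub> k) *\<^sub>R Ad (l \<otimes>\<^bsub>K\<^esub> k) M)"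
    by (rule integral_distr[OF kappa_measurable_translate[OF l] meas])
  also have "\<dots> = (LINT k|kappa. \<tau> l ** (bump B x k *\<^sub>R Ad k M) ** cadj (\<tau> l))"
  proof (rule Bochner_Integration.integral_cong[OF refl])
    fix k assume "k \<in> space kappa"
    then have k: "k \<in> carrier K" by (simp only: space_kappa)
    have "inv\<^bsub>K\<^esub> (l \<otimes>\<^bsub>K\<^esub> k) \<otimes>\<^bsub>K\<^esub> l = inv\<^bsub>K\<^esub> k"
      by (rule KN.K.inv_mult_left_cancel[OF l k])
    then have "K_action (K_inv (l \<otimes>\<^bsub>K\<^esub> k)) (K_action l x) = K_action (K_inv k) x"
      by (simp only: K_action_comp[symmetric] K_inv[symmetric] KN.K.m_closed l k)
    then show "bump B (K_action l x) (l \<otimes>\<^bsub>K\<^esub> k) *\<^sub>R Ad (l \<otimes>\<^bsub>K\<^esub> k) M =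
        \<tau> l ** (bump B x k *\<^sub>R Ad k M) ** cadj (\<tau> l)"
      by (simp only: bump_def Ad_mult[OF l k] matrix_scaleR_mult)
  qed
  also have "\<dots> = \<tau> l ** smear B M x ** cadj (\<tau> l)"
    unfolding smear_def
    by (rule integral_bounded_linear[OF bounded_linear_matrix_mult bump_Ad_integrable[OF B]])
  finally show ?thesis .
qed

lemma KN_mult_K_left: "(k, 0) \<otimes>\<^bsub>G\<^esub> (l, x) = (k \<otimes>\<^bsub>K\<^esub> l, K_action k x)"
  by (simp only: KN_mult N_group_simps n_bracket_simps) simp

lemma KN_mult_K_right: "(l, x) \<otimes>\<^bsub>G\<^esub> (k, 0) = (l \<otimes>\<^bsub>K\<^esub> k, x)"
  by (simp only: KN_mult N_group_simps n_bracket_simps K_action_0) simp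

lemma lift_equivariant:
  assumes B: "open B"
  shows "equivariant (lift B M)"
  unfolding equivariant_def
proof (intro ballI)
  fix k l g assume k: "k \<in> carrier K" and l: "l \<in> carrier K" and g: "g \<in> carrier G"
  obtain a x where gax: "g = (a, x)" by (rule prod.exhaust)
  have a: "a \<in> carrier K" using g by (simp only: gax KN_carrier)
  have "lift B M ((k, 0) \<otimes>\<^bsub>G\<^esub> g \<otimes>\<^bsub>G\<^esub> (l, 0)) =
      cadj (\<tau> k ** \<tau> a ** \<tau> l) ** (\<tau> k ** smear B M x ** cadj (\<tau> k))"
    by (simp only: gax KN_mult_K_left KN_mult_K_right lift_def fst_conv snd_conv
        smear_equivariant[OF k B] tau_mult KN.K.m_closed k l a)
  also have "\<dots> = cadj (\<tau> l) ** cadj (\<tau> a) ** (cadj (\<tau> k) ** \<tau> k) ** smear B M x ** cadj (\<tau> k)"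
    by (simp only: cadj_mult matrix_mul_assoc)
  also have "\<dots> = cadj (\<tau> l) ** lift B M g ** cadj (\<tau> k)"
    by (simp only: tau_unitary(2)[OF k] matrix_mul_rid lift_def gax fst_conv snd_conv matrix_mul_assoc)
  finally show "lift B M ((k, 0) \<otimes>\<^bsub>G\<^esub> g \<otimes>\<^bsub>G\<^esub> (l, 0)) = cadj (\<tau> l) ** lift B M g ** cadj (\<tau> k)" .
qed

lemma smear_measurable:
  assumes B: "open B"
  shows "(\<lambda>g. smear B M (snd g)) \<in> borel_measurable \<mu>"
  unfolding smear_def
proof (rule kappa.borel_measurable_lebesgue_integral)
  have "(\<lambda>p. bump B (snd (fst p)) (snd p) *\<^sub>R Ad (snd p) M) \<in> borel_measurable (\<mu> \<Otimes>\<^sub>M kappa)"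
    by (intro borel_measurable_scaleR bump_measurable_pair B
        measurable_compose[OF measurable_snd kappa_measurable_continuous[OF Ad_continuous]])
  then show "(\<lambda>(g, k). bump B (snd g) k *\<^sub>R Ad k M) \<in> borel_measurable (\<mu> \<Otimes>\<^sub>M kappa)"
    by (simp only: case_prod_unfold)
qed

lemma smear_support:
  assumes R: "B \<subseteq> cball 0 R" and x: "norm x > R"
  shows "smear B M x = 0"
proof -
  have "smear B M x = (LINT k|kappa. 0)"
    unfolding smear_def
  proof (rule Bochner_Integration.integral_cong[OF refl])
    fix k assume "k \<in> space kappa"
    then have "norm (K_action (K_inv k) x) = norm x"
      unfolding space_kappa by (intro norm_K_action(4) K_inv_carrier)
    then have "K_action (K_inv k) x \<notin> B"
      using R x by (metis leD mem_cball_0 subsetD)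
    then show "bump B x k *\<^sub>R Ad k M = 0"
      by (simp add: bump_def)
  qed
  then show ?thesis by simp
qed

lemma integrable_bounded_support:
  fixes f :: "_ \<Rightarrow> 'b::{banach, second_countable_topology}"
  assumes f: "f \<in> borel_measurable \<mu>"
    and C: "\<And>g. g \<in> carrier G \<Longrightarrow> norm (f g) \<le> C"
    and R: "\<And>g. g \<in> carrier G \<Longrightarrow> norm (snd g) > R \<Longrightarrow> f g = 0"
  shows "integrable \<mu> f"
proof (rule integrableI_bounded_set[of "KN_ball R" _ f C])
  show "KN_ball R \<in> sets \<mu>" by (rule KN_ball_sets)
  show "emeasure \<mu> (KN_ball R) < \<infinity>" using KN_ball_finite[of R] by (simp add: less_top)
  show "AE g in \<mu>. g \<in> KN_ball R \<longrightarrow> norm (f g) \<le> C"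
    using C by (intro AE_I2) (simp add: space_mu)
  show "AE g in \<mu>. g \<notin> KN_ball R \<longrightarrow> f g = 0"
  proof (intro AE_I2 impI R)
    fix g assume "g \<in> space \<mu>" and notin: "g \<notin> KN_ball R"
    then show g: "g \<in> carrier G" by (simp only: space_mu)
    show "norm (snd g) > R"
      using g notin by (cases g) (simp add: KN_carrier KN_ball_def)
  qed
qed (rule f)

lemma lift_L1:
  assumes B: "open B" and R: "B \<subseteq> cball 0 R"
  shows "lift B M \<in> L1"
  unfolding L1_iff
proof
  obtain c where c: "c > 0" "\<And>P Q. norm ((P :: complex^'d^'d) ** (Q :: complex^'d^'d)) \<le> norm P * norm Q * c"
    using matrix_mult_norm_bound[where 'd='d] by blast
  obtain C where C: "\<And>x. norm (smear B M x) \<le> C"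
    using smear_norm_bounded[OF B] by blast
  have cont: "continuous_on (carrier K) (\<lambda>k. cadj (\<tau> k))"
    by (intro continuous_intros tau_continuous)
  have "bounded ((\<lambda>k. cadj (\<tau> k)) ` carrier K)"
    by (intro compact_imp_bounded compact_continuous_image cont compact_K)
  then obtain D where D: "\<And>k. k \<in> carrier K \<Longrightarrow> norm (cadj (\<tau> k)) \<le> D"
    by (meson bounded_iff imageI)
  have cont': "continuous_on (carrier G) (\<lambda>g. cadj (\<tau> (fst g)))"
    by (rule continuous_on_compose2[OF cont]) (auto intro!: continuous_intros simp: semidirect_def)
  have meas: "lift B M \<in> borel_measurable \<mu>"
    unfolding lift_def
    by (intro borel_matrix_mult smear_measurable B measurable_continuous cont')
  show "integrable \<mu> (lift B M)"
  proof (rule integrable_bounded_support[OF meas])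
    fix g assume g: "g \<in> carrier G"
    have "fst g \<in> carrier K" using g by (cases g) (simp only: KN_carrier fst_conv)
    then have "norm (cadj (\<tau> (fst g))) * norm (smear B M (snd g)) \<le> D * C"
      using norm_ge_zero[of "smear B M (snd g)"] D by (intro mult_mono' C) auto
    then show "norm (lift B M g) \<le> D * C * c"
      using c unfolding lift_def by (meson dual_order.trans less_imp_le mult_right_mono)
    show "lift B M g = 0" if "norm (snd g) > R"
      by (simp add: lift_def smear_support[OF R that])
  qed
  show "equivariant (lift B M)" by (rule lift_equivariant[OF B])
qed

text \<open>The factors of \<tau> cancel and the variable \<open>k\<close> disappears, leaving the
  integrand of a matrix-valued convolution on \<open>N\<close>. The factor at
  \<open>y\<^sup>-\<^sup>1 g\<close> stands on the left, hence \<open>M\<^sub>2\<close> precedes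
  \<open>M\<^sub>1\<close>.\<close>

lemma convolution_lift_integrand:
  assumes B: "open B" and g: "g \<in> lie_algebra_n" and k: "k \<in> carrier K" and y: "y \<in> lie_algebra_n"
  shows "lift B M\<^sub>2 (inv\<^bsub>G\<^esub> (k, y) \<otimes>\<^bsub>G\<^esub> (\<one>\<^bsub>K\<^esub>, g)) ** lift B M\<^sub>1 (k, y) =
    smear B M\<^sub>2 (- y \<otimes>\<^bsub>N_group\<^esub> g) ** smear B M\<^sub>1 y"
proof -
  have ky: "(k, y) \<in> carrier G" using k y by (simp only: KN_carrier simp_thms)
  let ?k = "K_inv k"
  have k': "?k \<in> carrier K" by (rule K_inv_carrier[OF k])
  have "inv\<^bsub>G\<^esub> (k, y) \<otimes>\<^bsub>G\<^esub> (\<one>\<^bsub>K\<^esub>, g) = (?k \<otimes>\<^bsub>K\<^esub> \<one>\<^bsub>K\<^esub>, K_action ?k (- y) \<otimes>\<^bsub>N_group\<^esub> K_action ?k g)"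
    unfolding KN_inv[OF ky] KN_inv_def fst_conv snd_conv KN_mult ..
  also have "\<dots> = (?k, K_action ?k (- y \<otimes>\<^bsub>N_group\<^esub> g))"
    by (simp only: KN.K.r_one[OF k'] K_action_mult[OF k'])
  finally have "lift B M\<^sub>2 (inv\<^bsub>G\<^esub> (k, y) \<otimes>\<^bsub>G\<^esub> (\<one>\<^bsub>K\<^esub>, g)) =
      cadj (\<tau> ?k) ** (\<tau> ?k ** smear B M\<^sub>2 (- y \<otimes>\<^bsub>N_group\<^esub> g) ** cadj (\<tau> ?k))"
    by (simp only: lift_def fst_conv snd_conv smear_equivariant[OF k' B])
  also have "\<dots> = smear B M\<^sub>2 (- y \<otimes>\<^bsub>N_group\<^esub> g) ** \<tau> k"
    using tau_unitary(2)[OF k'] tau_inv[OF k] K_inv[OF k]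
    by (simp only: matrix_mul_assoc matrix_mul_lid cadj_simps)
  finally show ?thesis
    by (simp only: lift_def fst_conv snd_conv) (metis matrix_mul_assoc matrix_mul_rid tau_unitary(1)[OF k])
qed

end

section \<open>Only one-dimensional representations are commutative\<close>

lemma continuous_on_N_mult [continuous_intros]:
  "continuous_on S f \<Longrightarrow> continuous_on S g \<Longrightarrow> continuous_on S (\<lambda>x. f x \<otimes>\<^bsub>N_group\<^esub> g x)"
  unfolding N_group_simps by (intro continuous_intros)

lemma K_action_inv_cancel:
  assumes "a \<in> carrier K_group"
  shows "K_action a (K_action (K_inv a) x) = x"
  by (simp only: K_action_comp[symmetric] K_inv[OF assms, symmetric] KN.K.r_inv[OF assms] K_action_one)

text \<open>A nonempty open part of the group has positive measure, so it cannot consist of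
  exceptions. This turns almost everywhere statements into statements at a point near a chosen
  one.\<close>

lemma (in KN_haar) AE_open_witness:
  assumes "AE x in \<mu>. P x" "open U" "U \<inter> carrier KN_group \<noteq> {}"
  obtains x where "x \<in> U" "x \<in> carrier KN_group" "P x"
proof (rule ccontr)
  assume "\<not> thesis"
  then have *: "\<And>x. x \<in> U \<inter> carrier KN_group \<Longrightarrow> \<not> P x" using that by blast
  have ae: "AE x in \<mu>. x \<notin> U \<inter> carrier KN_group"
    using assms(1) by (rule AE_mp) (rule AE_I2, use * in blast)
  have "{x \<in> space \<mu>. \<not> x \<notin> U \<inter> carrier KN_group} = U \<inter> carrier KN_group"
    unfolding space_mu by blast
  then have "emeasure \<mu> (U \<inter> carrier KN_group) = 0"
    by (rule AE_iff_measurable[OF open_in_sets[OF assms(2)], THEN iffD1]) (rule ae)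
  with open_positive[OF assms(2,3)] show False by simp
qed

context KN_rep
begin

text \<open>Violations for \<epsilon> tending to zero would have, by compactness of
  \<open>K\<close>, a limit pair \<open>(a', b')\<close> with
  \<open>a' X \<cdot> b' X = 2 X\<close>. Extremality puts both in the stabilizer of
  \<open>X\<close>, where the sum of the four norms is zero; by continuity it would have to be at
  least \<eta>.\<close>

lemma stabilizer_compactness:
  assumes stab: "\<And>a. a \<in> carrier K \<Longrightarrow> K_action a X = X \<Longrightarrow> Ad a M\<^sub>1 = M\<^sub>1 \<and> Ad a M\<^sub>2 = M\<^sub>2"
    and \<eta>: "\<eta> > 0"
  obtains \<epsilon> where "\<epsilon> > 0" "\<And>a b p q. a \<in> carrier K \<Longrightarrow> b \<in> carrier K \<Longrightarrow> dist p X < \<epsilon> \<Longrightarrow>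
    dist q X < \<epsilon> \<Longrightarrow> dist (K_action a p \<otimes>\<^bsub>N_group\<^esub> K_action b q) (X + X) < \<epsilon> \<Longrightarrow>
    norm (Ad a M\<^sub>1 - M\<^sub>1) + norm (Ad a M\<^sub>2 - M\<^sub>2) + (norm (Ad b M\<^sub>1 - M\<^sub>1) + norm (Ad b M\<^sub>2 - M\<^sub>2)) < \<eta>"
proof -
  define D where "D a = norm (Ad a M\<^sub>1 - M\<^sub>1) + norm (Ad a M\<^sub>2 - M\<^sub>2)" for a
  define bad where "bad \<epsilon> a b p q \<longleftrightarrow> a \<in> carrier K \<and> b \<in> carrier K \<and> dist p X < \<epsilon> \<and> dist q X < \<epsilon> \<and>
    dist (K_action a p \<otimes>\<^bsub>N_group\<^esub> K_action b q) (X + X) < \<epsilon> \<and> D a + D b \<ge> \<eta>" for \<epsilon> a b p q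
  have "\<exists>\<epsilon>>0. \<forall>a b p q. \<not> bad \<epsilon> a b p q"
  proof (rule ccontr)
    assume neg: "\<not> ?thesis"
    have "\<exists>a b p q. bad (inverse (real (Suc n))) a b p q" for n
      using neg by (metis inverse_positive_iff_positive of_nat_0_less_iff zero_less_Suc)
    then obtain a b p q where bad: "\<And>n. bad (inverse (real (Suc n))) (a n) (b n) (p n) (q n)"
      by metis
    have ab: "(a n, b n) \<in> carrier K \<times> carrier K" for n
      using bad[of n] unfolding bad_def by blast
    have lim: "f \<longlonglongrightarrow> x" if "\<And>n. dist (f n) x < inverse (real (Suc n))" for f and x :: "'n nalg"
      unfolding tendsto_dist_iff[of f]
      by (rule real_tendsto_sandwich[OF _ _ tendsto_const LIMSEQ_inverse_real_of_nat])
        (use that less_imp_le in \<open>auto intro!: always_eventually\<close>)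
    have p: "p \<longlonglongrightarrow> X" and q: "q \<longlonglongrightarrow> X"
      and prod: "(\<lambda>n. K_action (a n) (p n) \<otimes>\<^bsub>N_group\<^esub> K_action (b n) (q n)) \<longlonglongrightarrow> X + X"
      using bad unfolding bad_def by (auto intro!: lim simp del: N_group_simps)
    have sc: "seq_compact (carrier K \<times> carrier K)"
      by (intro compact_imp_seq_compact compact_Times compact_K)
    then obtain l r where l: "l \<in> carrier K \<times> carrier K" and r: "strict_mono r"
      and conv: "((\<lambda>n. (a n, b n)) \<circ> r) \<longlonglongrightarrow> l"
      using seq_compactE[OF sc, of "\<lambda>n. (a n, b n)"] ab by blast
    obtain a' b' where l_eq: "l = (a', b')" by (rule prod.exhaust)
    have a': "a' \<in> carrier K" and b': "b' \<in> carrier K" using l by (simp_all add: l_eq)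
    have ar: "(\<lambda>n. a (r n)) \<longlonglongrightarrow> a'" and br: "(\<lambda>n. b (r n)) \<longlonglongrightarrow> b'"
      using tendsto_fst[OF conv] tendsto_snd[OF conv] by (simp_all add: l_eq o_def)
    have pr: "(\<lambda>n. p (r n)) \<longlonglongrightarrow> X" and qr: "(\<lambda>n. q (r n)) \<longlonglongrightarrow> X"
      and prodr: "(\<lambda>n. K_action (a (r n)) (p (r n)) \<otimes>\<^bsub>N_group\<^esub> K_action (b (r n)) (q (r n))) \<longlonglongrightarrow> X + X"
      using LIMSEQ_subseq_LIMSEQ[OF p r] LIMSEQ_subseq_LIMSEQ[OF q r] LIMSEQ_subseq_LIMSEQ[OF prod r]
      by (simp_all only: o_def)
    let ?H = "\<lambda>u. K_action (fst (fst u)) (fst (snd u)) \<otimes>\<^bsub>N_group\<^esub> K_action (snd (fst u)) (snd (snd u))"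
    have H: "continuous_on UNIV ?H" by (intro continuous_intros)
    have "(\<lambda>n. ?H ((a (r n), b (r n)), (p (r n), q (r n)))) \<longlonglongrightarrow> ?H ((a', b'), (X, X))"
      by (intro continuous_on_tendsto_compose[OF H] tendsto_Pair ar br pr qr) auto
    then have "K_action a' X \<otimes>\<^bsub>N_group\<^esub> K_action b' X = X + X"
      using LIMSEQ_unique[OF prodr] by (simp only: fst_conv snd_conv)
    note fixed = K_action_product_extremal[OF a' b' this]
    have Dcont: "continuous_on (carrier K) D"
      unfolding D_def by (intro continuous_intros Ad_continuous)
    have "(\<lambda>n. D (a (r n)) + D (b (r n))) \<longlonglongrightarrow> D a' + D b'"
      using ab by (intro tendsto_add continuous_on_tendsto_compose[OF Dcont] ar br a' b') auto
    moreover have "D a' + D b' = 0"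
      using stab[OF a' fixed(1)] stab[OF b' fixed(2)] by (simp add: D_def)
    moreover have "\<eta> \<le> D (a (r n)) + D (b (r n))" for n
      using bad[of "r n"] unfolding bad_def by blast
    ultimately have "\<eta> \<le> 0"
      using LIMSEQ_le_const by fastforce
    then show False using \<eta> by simp
  qed
  then obtain \<epsilon> where "\<epsilon> > 0" "\<And>a b p q. \<not> bad \<epsilon> a b p q" by blast
  then show ?thesis
    using that[of \<epsilon>] unfolding bad_def D_def by (meson not_le)
qed

text \<open>Only those \<open>k\<close> with \<open>k\<^sup>-\<^sup>1 x\<close> in \<open>B\<close>
  contribute, and \<open>weight B x\<close> is exactly their total mass.\<close>

lemma smear_close:
  assumes B: "open B"
    and close: "\<And>k. k \<in> carrier K \<Longrightarrow> K_action (K_inv k) x \<in> B \<Longrightarrow> norm (Ad k M - M) \<le> \<eta>"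
  shows "norm (smear B M x - weight B x *\<^sub>R M) \<le> weight B x * \<eta>"
proof -
  have i1: "integrable kappa (\<lambda>k. bump B x k *\<^sub>R M)"
    using bump_integrable[OF B] by simp
  have "smear B M x - weight B x *\<^sub>R M = (LINT k|kappa. bump B x k *\<^sub>R Ad k M) - (LINT k|kappa. bump B x k *\<^sub>R M)"
    unfolding smear_def weight_def using bump_integrable[OF B] by simp
  also have "\<dots> = (LINT k|kappa. bump B x k *\<^sub>R Ad k M - bump B x k *\<^sub>R M)"
    by (intro Bochner_Integration.integral_diff[symmetric] bump_Ad_integrable[OF B] i1)
  finally have "norm (smear B M x - weight B x *\<^sub>R M) \<le> (LINT k|kappa. norm (bump B x k *\<^sub>R Ad k M - bump B x k *\<^sub>R M))"
    by (simp only: integral_norm_bound)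
  also have "\<dots> \<le> (LINT k|kappa. bump B x k * \<eta>)"
  proof (rule Bochner_Integration.integral_mono)
    show "integrable kappa (\<lambda>k. norm (bump B x k *\<^sub>R Ad k M - bump B x k *\<^sub>R M))"
      by (intro integrable_norm Bochner_Integration.integrable_diff bump_Ad_integrable[OF B] i1)
    show "integrable kappa (\<lambda>k. bump B x k * \<eta>)"
      using bump_integrable[OF B] by simp
    fix k assume "k \<in> space kappa"
    then have k: "k \<in> carrier K" by (simp only: space_kappa)
    show "norm (bump B x k *\<^sub>R Ad k M - bump B x k *\<^sub>R M) \<le> bump B x k * \<eta>"
      using close[OF k] by (simp add: bump_def indicator_def)
  qed
  also have "\<dots> = weight B x * \<eta>"
    unfolding weight_def using bump_integrable[OF B] by simp
  finally show ?thesis .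
qed

lemma smear_zero:
  assumes "\<And>k. k \<in> carrier K \<Longrightarrow> K_action (K_inv k) x \<notin> B"
  shows "smear B M x = 0" "weight B x = 0"
proof -
  have "bump B x k = 0" if "k \<in> space kappa" for k
    using assms that by (simp add: bump_def space_kappa)
  then have "smear B M x = (LINT k|kappa. 0)" "weight B x = (LINT k|kappa. 0)"
    unfolding smear_def weight_def by (intro Bochner_Integration.integral_cong[OF refl]; simp)+
  then show "smear B M x = 0" "weight B x = 0" by simp_all
qed

text \<open>If \<open>y w\<close> is close to \<open>2 X\<close>, every pair of group elements contributing to the product of the
  two averages almost stabilizes \<open>X\<close>, so conjugation by it almost fixes \<open>M\<^sub>1\<close> and \<open>M\<^sub>2\<close>.\<close>

lemma smear_product_close:
  fixes M\<^sub>1 M\<^sub>2 :: "complex^'d^'d"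
  assumes \<eta>: "0 \<le> \<eta>" "\<eta> \<le> 1"
    and \<epsilon>: "\<And>a b p q. a \<in> carrier K \<Longrightarrow> b \<in> carrier K \<Longrightarrow> dist p X < \<epsilon> \<Longrightarrow>
      dist q X < \<epsilon> \<Longrightarrow> dist (K_action a p \<otimes>\<^bsub>N_group\<^esub> K_action b q) (X + X) < \<epsilon> \<Longrightarrow>
      norm (Ad a M\<^sub>1 - M\<^sub>1) + norm (Ad a M\<^sub>2 - M\<^sub>2) + (norm (Ad b M\<^sub>1 - M\<^sub>1) + norm (Ad b M\<^sub>2 - M\<^sub>2)) < \<eta>"
    and c: "c > 0" "\<And>P Q. norm ((P :: complex^'d^'d) ** (Q :: complex^'d^'d)) \<le> norm P * norm Q * c"
    and yw: "dist (y \<otimes>\<^bsub>N_group\<^esub> w) (X + X) < \<epsilon>"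
    and M: "(P = M\<^sub>1 \<and> Q = M\<^sub>2) \<or> (P = M\<^sub>2 \<and> Q = M\<^sub>1)"
  defines "B \<equiv> ball X \<epsilon>"
  shows "norm (smear B P w ** smear B Q y - (weight B w * weight B y) *\<^sub>R (P ** Q))
    \<le> weight B w * weight B y * (c * \<eta> * (norm M\<^sub>1 + norm M\<^sub>2 + 1))"
proof -
  have B: "open B" by (simp add: B_def)
  \<comment> \<open>If either orbit misses \<open>B\<close>, both the product and the weights
    vanish. Otherwise each average has a contributing element.\<close>
  consider "\<And>k. k \<in> carrier K \<Longrightarrow> K_action (K_inv k) y \<notin> B"
    | "\<And>k. k \<in> carrier K \<Longrightarrow> K_action (K_inv k) w \<notin> B"
    | a b where "a \<in> carrier K" "K_action (K_inv a) y \<in> B" "b \<in> carrier K" "K_action (K_inv b) w \<in> B"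
    by blast
  then show ?thesis
  proof cases
    case 1
    then show ?thesis using smear_zero[of y B] by simp
  next
    case 2
    then show ?thesis using smear_zero[of w B] by simp
  next
    case (3 a\<^sub>0 b\<^sub>0)
    have close: "norm (Ad a M\<^sub>1 - M\<^sub>1) + norm (Ad a M\<^sub>2 - M\<^sub>2) + (norm (Ad b M\<^sub>1 - M\<^sub>1) + norm (Ad b M\<^sub>2 - M\<^sub>2)) < \<eta>"
      if a: "a \<in> carrier K" "K_action (K_inv a) y \<in> B" and b: "b \<in> carrier K" "K_action (K_inv b) w \<in> B" for a b
    proof (rule \<epsilon>[OF a(1) b(1)])
      show "dist (K_action (K_inv a) y) X < \<epsilon>" "dist (K_action (K_inv b) w) X < \<epsilon>"
        using a(2) b(2) by (simp_all only: B_def mem_ball dist_commute)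
      show "dist (K_action a (K_action (K_inv a) y) \<otimes>\<^bsub>N_group\<^esub> K_action b (K_action (K_inv b) w)) (X + X) < \<epsilon>"
        using yw by (simp only: K_action_inv_cancel a(1) b(1))
    qed
    \<comment> \<open>The hypothesis concerns pairs, so the fixed \<open>a\<^sub>0\<close> serves as
      the partner of \<open>b\<close>; symmetrically \<open>b\<^sub>0\<close> for
      \<open>closeQ\<close>.\<close>
    have closeP: "norm (Ad b P - P) \<le> \<eta>" if "b \<in> carrier K" "K_action (K_inv b) w \<in> B" for b
      using close[OF 3(1,2) that] M norm_ge_zero by (smt (verit))
    have closeQ: "norm (Ad a Q - Q) \<le> \<eta>" if "a \<in> carrier K" "K_action (K_inv a) y \<in> B" for a
      using close[OF that 3(3,4)] M norm_ge_zero by (smt (verit))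
    let ?w = "weight B w" and ?y = "weight B y"
    let ?P = "smear B P w" and ?Q = "smear B Q y"
    have P: "norm (?P - ?w *\<^sub>R P) \<le> ?w * \<eta>"
      by (rule smear_close[OF B closeP])
    have Q: "norm (?Q - ?y *\<^sub>R Q) \<le> ?y * \<eta>"
      by (rule smear_close[OF B closeQ])
    have wy: "0 \<le> ?w" "0 \<le> ?y" by (rule weight_nonneg)+
    \<comment> \<open>Here \<open>\<eta> \<le> 1\<close> absorbs the error in the bound on
      \<open>?Q\<close>, so that the final estimate stays linear in \<eta>.\<close>
    have "norm ?Q \<le> norm (?Q - ?y *\<^sub>R Q) + norm (?y *\<^sub>R Q)"
      using norm_triangle_ineq[of "?Q - ?y *\<^sub>R Q" "?y *\<^sub>R Q"] by simp
    also have "\<dots> \<le> ?y * 1 + ?y * norm Q"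
      using Q \<eta> wy mult_left_mono[OF \<eta>(2) wy(2)] by simp
    finally have Qn: "norm ?Q \<le> ?y * (norm Q + 1)"
      by (simp add: algebra_simps)
    have "?P ** ?Q - (?w * ?y) *\<^sub>R (P ** Q) = (?P - ?w *\<^sub>R P) ** ?Q + (?w *\<^sub>R P) ** (?Q - ?y *\<^sub>R Q)"
      by (simp add: matrix_diff_distrib matrix_scaleR_mult)
    then have "norm (?P ** ?Q - (?w * ?y) *\<^sub>R (P ** Q)) \<le>
        norm ((?P - ?w *\<^sub>R P) ** ?Q) + norm ((?w *\<^sub>R P) ** (?Q - ?y *\<^sub>R Q))"
      by (simp only: norm_triangle_ineq)
    also have "\<dots> \<le> norm (?P - ?w *\<^sub>R P) * norm ?Q * c + norm (?w *\<^sub>R P) * norm (?Q - ?y *\<^sub>R Q) * c"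
      by (intro add_mono c(2))
    also have "\<dots> \<le> (?w * \<eta>) * (?y * (norm Q + 1)) * c + (?w * norm P) * (?y * \<eta>) * c"
      using c(1) wy \<eta> P Q Qn
      by (intro add_mono mult_right_mono mult_mono mult_nonneg_nonneg) auto
    also have "\<dots> = ?w * ?y * (c * \<eta> * (norm P + norm Q + 1))"
      by (simp add: algebra_simps)
    also have "norm P + norm Q = norm M\<^sub>1 + norm M\<^sub>2"
      using M by auto
    finally show ?thesis .
  qed
qed

end

context KN_rep
begin

lemma convolution_lift_integrable:
  assumes B: "open B" and R: "B \<subseteq> cball 0 R" and g: "g \<in> lie_algebra_n"
  shows "integrable \<mu> (\<lambda>x. lift B M\<^sub>2 (inv\<^bsub>G\<^esub> x \<otimes>\<^bsub>G\<^esub> (\<one>\<^bsub>K\<^esub>, g)) ** lift B M\<^sub>1 x)"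
proof -
  obtain c where c: "c > 0" "\<And>P Q. norm ((P :: complex^'d^'d) ** (Q :: complex^'d^'d)) \<le> norm P * norm Q * c"
    using matrix_mult_norm_bound[where 'd='d] by blast
  obtain C\<^sub>1 where C1: "\<And>x. norm (smear B M\<^sub>1 x) \<le> C\<^sub>1"
    using smear_norm_bounded[OF B] by blast
  obtain C\<^sub>2 where C2: "\<And>x. norm (smear B M\<^sub>2 x) \<le> C\<^sub>2"
    using smear_norm_bounded[OF B] by blast
  have g': "(\<one>\<^bsub>K\<^esub>, g) \<in> carrier G"
    using g KN.K.one_closed by (simp only: KN_carrier simp_thms)
  show ?thesis
  proof (rule integrable_bounded_support)
    show "(\<lambda>x. lift B M\<^sub>2 (inv\<^bsub>G\<^esub> x \<otimes>\<^bsub>G\<^esub> (\<one>\<^bsub>K\<^esub>, g)) ** lift B M\<^sub>1 x) \<in> borel_measurable \<mu>"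
      by (intro convolution_integrand_measurable lift_L1[OF B R] g')
    fix x assume "x \<in> carrier G"
    moreover obtain k y where x: "x = (k, y)" by (rule prod.exhaust)
    ultimately have k: "k \<in> carrier K" and y: "y \<in> lie_algebra_n" by (simp_all only: KN_carrier)
    note eq = convolution_lift_integrand[OF B g k y]
    show "norm (lift B M\<^sub>2 (inv\<^bsub>G\<^esub> x \<otimes>\<^bsub>G\<^esub> (\<one>\<^bsub>K\<^esub>, g)) ** lift B M\<^sub>1 x) \<le> C\<^sub>2 * C\<^sub>1 * c"
      unfolding x eq
    proof (rule order_trans[OF c(2)])
      have "0 \<le> C\<^sub>2" using order_trans[OF norm_ge_zero C2] .
      then show "norm (smear B M\<^sub>2 (- y \<otimes>\<^bsub>N_group\<^esub> g)) * norm (smear B M\<^sub>1 y) * c \<le> C\<^sub>2 * C\<^sub>1 * c"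
        using c(1) C1 C2 by (intro mult_right_mono mult_mono) auto
    qed
    show "lift B M\<^sub>2 (inv\<^bsub>G\<^esub> x \<otimes>\<^bsub>G\<^esub> (\<one>\<^bsub>K\<^esub>, g)) ** lift B M\<^sub>1 x = 0" if "norm (snd x) > R"
      using smear_support[OF R, of y M\<^sub>1] that unfolding x eq by simp
  qed
qed

text \<open>A point obtained from an almost everywhere statement has an arbitrary component in
  \<open>K\<close>; the right action of \<open>K\<close> removes it.\<close>

lemma equivariant_eq_at_one:
  assumes F: "equivariant F\<^sub>1" "equivariant F\<^sub>2" and k: "k \<in> carrier K" and g: "g \<in> lie_algebra_n"
    and eq: "F\<^sub>1 (k, g) = F\<^sub>2 (k, g)"
  shows "F\<^sub>1 (\<one>\<^bsub>K\<^esub>, g) = F\<^sub>2 (\<one>\<^bsub>K\<^esub>, g)"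
proof -
  have g': "(\<one>\<^bsub>K\<^esub>, g) \<in> carrier G"
    using g KN.K.one_closed by (simp only: KN_carrier simp_thms)
  have "(\<one>\<^bsub>K\<^esub>, 0) \<otimes>\<^bsub>G\<^esub> (\<one>\<^bsub>K\<^esub>, g) \<otimes>\<^bsub>G\<^esub> (k, 0) = (k, g)"
    by (simp only: KN_mult_K_left KN_mult_K_right KN.K.l_one KN.K.one_closed k K_action_one)
  then have *: "F (k, g) = cadj (\<tau> k) ** F (\<one>\<^bsub>K\<^esub>, g)" if "equivariant F" for F
    using equivariantD[OF that KN.K.one_closed k g']
    by (simp only: tau_one cadj_mat complex_cnj_one matrix_mul_rid)
  have "\<tau> k ** (cadj (\<tau> k) ** F\<^sub>1 (\<one>\<^bsub>K\<^esub>, g)) = \<tau> k ** (cadj (\<tau> k) ** F\<^sub>2 (\<one>\<^bsub>K\<^esub>, g))"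
    using eq *[OF F(1)] *[OF F(2)] by (simp only:)
  then show ?thesis
    by (simp only: matrix_mul_assoc tau_unitary(1)[OF k] matrix_mul_lid)
qed

text \<open>The two convolution integrands differ by the commutator \<open>E\<close> times a
  nonnegative weight, with an error of at most half that size. Their difference paired with
  \<open>E\<close> is thus at least the weight times half the squared norm of \<open>E\<close>.
  Equality of the convolutions makes its integral vanish, so it is zero almost everywhere, against
  positivity of the weight on an open set.\<close>

lemma noncommutative_triple:
  fixes M\<^sub>1 M\<^sub>2 :: "complex^'d^'d"
  assumes X: "X \<in> lie_algebra_n"
    and stab: "\<And>a M. a \<in> carrier K \<Longrightarrow> K_action a X = X \<Longrightarrow> Ad a M = M"
    and M: "M\<^sub>2 ** M\<^sub>1 \<noteq> M\<^sub>1 ** M\<^sub>2"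
  shows "\<not> commutative_triple G \<mu> (carrier K \<times> {\<one>\<^bsub>N_group\<^esub>}) (\<lambda>(k, x). \<tau> k)"
proof
  assume comm: "commutative_triple G \<mu> (carrier K \<times> {\<one>\<^bsub>N_group\<^esub>}) (\<lambda>(k, x). \<tau> k)"
  define E where "E = M\<^sub>2 ** M\<^sub>1 - M\<^sub>1 ** M\<^sub>2"
  have E: "norm E > 0" using M by (simp add: E_def)
  obtain c where c: "c > 0" "\<And>P Q. norm ((P :: complex^'d^'d) ** (Q :: complex^'d^'d)) \<le> norm P * norm Q * c"
    using matrix_mult_norm_bound[where 'd='d] by blast
  define m where "m = norm M\<^sub>1 + norm M\<^sub>2 + 1"
  have m: "m > 0" unfolding m_def by (simp add: add_nonneg_pos)
  \<comment> \<open>Each of the two products may be off by a quarter of \<open>norm E\<close>, hence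
    their difference by half.\<close>
  define \<eta> where "\<eta> = min 1 (norm E / (4 * c * m))"
  have \<eta>: "0 < \<eta>" "\<eta> \<le> 1" "c * \<eta> * m \<le> norm E / 4"
  proof -
    show "0 < \<eta>" "\<eta> \<le> 1" using E c(1) m by (simp_all add: \<eta>_def)
    have "\<eta> \<le> norm E / (4 * c * m)" by (simp add: \<eta>_def)
    then have "\<eta> * (4 * c * m) \<le> norm E"
      using c(1) m by (simp add: pos_le_divide_eq)
    then show "c * \<eta> * m \<le> norm E / 4" by (simp add: algebra_simps)
  qed
  have stab': "Ad a M\<^sub>1 = M\<^sub>1 \<and> Ad a M\<^sub>2 = M\<^sub>2" if "a \<in> carrier K" "K_action a X = X" for a
    using stab[OF that] by blast
  obtain \<epsilon> where \<epsilon>0: "\<epsilon> > 0" and \<epsilon>: "\<And>a b p q. a \<in> carrier K \<Longrightarrow> b \<in> carrier K \<Longrightarrow> dist p X < \<epsilon> \<Longrightarrow>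
      dist q X < \<epsilon> \<Longrightarrow> dist (K_action a p \<otimes>\<^bsub>N_group\<^esub> K_action b q) (X + X) < \<epsilon> \<Longrightarrow>
      norm (Ad a M\<^sub>1 - M\<^sub>1) + norm (Ad a M\<^sub>2 - M\<^sub>2) + (norm (Ad b M\<^sub>1 - M\<^sub>1) + norm (Ad b M\<^sub>2 - M\<^sub>2)) < \<eta>"
    using stabilizer_compactness[OF stab' \<eta>(1)] by blast
  define B where "B = ball X \<epsilon>"
  have B: "open B" by (simp add: B_def)
  have R: "B \<subseteq> cball 0 (norm X + \<epsilon>)"
  proof
    fix x assume "x \<in> B"
    then have "norm (x - X) < \<epsilon>" by (simp add: B_def dist_norm norm_minus_commute)
    then show "x \<in> cball 0 (norm X + \<epsilon>)"
      using norm_triangle_ineq[of "x - X" X] by simp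
  qed
  let ?F1 = "lift B M\<^sub>1" and ?F2 = "lift B M\<^sub>2"
  have L1: "?F1 \<in> L1" "?F2 \<in> L1" by (intro lift_L1[OF B R])+
  have ae: "AE h in \<mu>. convolution G \<mu> ?F1 ?F2 h = convolution G \<mu> ?F2 ?F1 h"
    using comm L1 unfolding commutative_triple_def by blast

  \<comment> \<open>The second condition keeps \<open>X\<^sup>-\<^sup>1 g\<close> inside
    \<open>B\<close>, so that \<open>y = X\<close> will have positive weight in the
    integral.\<close>
  let ?U = "{h. dist (snd h) (X + X) < \<epsilon> \<and> - X \<otimes>\<^bsub>N_group\<^esub> snd h \<in> B}"
  have "open ?U"
    unfolding B_def mem_ball by (intro open_Collect_conj open_Collect_less continuous_intros)
  moreover have "(\<one>\<^bsub>K\<^esub>, X + X) \<in> ?U \<inter> carrier G"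
  proof -
    have "- X \<otimes>\<^bsub>N_group\<^esub> (X + X) = X" by (simp add: n_bracket_bilinear)
    moreover have "(\<one>\<^bsub>K\<^esub>, X + X) \<in> carrier G"
      using KN.K.one_closed subspace_add[OF subspace_lie_algebra_n X X] by (simp only: KN_carrier simp_thms)
    ultimately show ?thesis
      using \<epsilon>0 by (simp only: Int_iff mem_Collect_eq snd_conv B_def) simp
  qed
  then have "?U \<inter> carrier G \<noteq> {}" by blast
  ultimately obtain h where h: "h \<in> ?U" "h \<in> carrier G"
    and conv_h: "convolution G \<mu> ?F1 ?F2 h = convolution G \<mu> ?F2 ?F1 h"
    using AE_open_witness[OF ae] by blast
  obtain k\<^sub>0 g where h_eq: "h = (k\<^sub>0, g)" by (rule prod.exhaust)
  have k0: "k\<^sub>0 \<in> carrier K" and g: "g \<in> lie_algebra_n"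
    using h(2) by (simp_all only: h_eq KN_carrier)
  have g_close: "dist g (X + X) < \<epsilon>" and gB: "- X \<otimes>\<^bsub>N_group\<^esub> g \<in> B"
    using h(1) by (simp_all only: h_eq mem_Collect_eq snd_conv)
  have conv_eq: "convolution G \<mu> ?F1 ?F2 (\<one>\<^bsub>K\<^esub>, g) = convolution G \<mu> ?F2 ?F1 (\<one>\<^bsub>K\<^esub>, g)"
    using equivariant_eq_at_one[OF convolution_equivariant[OF L1] convolution_equivariant[OF L1(2,1)] k0 g]
      conv_h unfolding h_eq by blast

  define \<phi> where "\<phi> P Q x = lift B P (inv\<^bsub>G\<^esub> x \<otimes>\<^bsub>G\<^esub> (\<one>\<^bsub>K\<^esub>, g)) ** lift B Q x" for P Q x
  have \<phi>_int: "integrable \<mu> (\<phi> P Q)" for P Q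
    unfolding \<phi>_def by (rule convolution_lift_integrable[OF B R g])
  \<comment> \<open>Pairing with the commutator replaces a matrix identity by a real function whose
    sign can be controlled.\<close>
  define \<psi> where "\<psi> x = inner (\<phi> M\<^sub>2 M\<^sub>1 x - \<phi> M\<^sub>1 M\<^sub>2 x) E" for x
  have \<psi>_int: "integrable \<mu> \<psi>"
    unfolding \<psi>_def by (intro integrable_inner_left Bochner_Integration.integrable_diff \<phi>_int)
  have "(LINT x|\<mu>. \<psi> x) = inner ((LINT x|\<mu>. \<phi> M\<^sub>2 M\<^sub>1 x) - (LINT x|\<mu>. \<phi> M\<^sub>1 M\<^sub>2 x)) E"
    unfolding \<psi>_def using \<phi>_int by simp
  also have "\<dots> = 0"
    using conv_eq unfolding convolution_def \<phi>_def by simp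
  finally have \<psi>_zero: "(LINT x|\<mu>. \<psi> x) = 0" .
  have \<psi>_lower: "\<psi> (k, y) \<ge> weight B (- y \<otimes>\<^bsub>N_group\<^esub> g) * weight B y * ((norm E)\<^sup>2 / 2)"
    if k: "k \<in> carrier K" and y: "y \<in> lie_algebra_n" for k y
  proof -
    let ?w = "- y \<otimes>\<^bsub>N_group\<^esub> g"
    let ?c = "weight B ?w * weight B y"
    have c0: "0 \<le> ?c" by (intro mult_nonneg_nonneg weight_nonneg)
    have "y \<otimes>\<^bsub>N_group\<^esub> ?w = g"
      using KN.N.mult_inv_mult(1)[of y g] y g N_inv[OF y] by simp
    then have yw: "dist (y \<otimes>\<^bsub>N_group\<^esub> ?w) (X + X) < \<epsilon>" using g_close by (simp only:)
    have near: "norm (\<phi> P Q (k, y) - ?c *\<^sub>R (P ** Q)) \<le> ?c * (norm E / 4)"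
      if PQ: "(P = M\<^sub>1 \<and> Q = M\<^sub>2) \<or> (P = M\<^sub>2 \<and> Q = M\<^sub>1)" for P Q
    proof -
      have "\<phi> P Q (k, y) = smear B P ?w ** smear B Q y"
        unfolding \<phi>_def by (rule convolution_lift_integrand[OF B g k y])
      then have "norm (\<phi> P Q (k, y) - ?c *\<^sub>R (P ** Q)) \<le> ?c * (c * \<eta> * m)"
        unfolding m_def B_def
        using smear_product_close[OF less_imp_le[OF \<eta>(1)] \<eta>(2) \<epsilon> c yw PQ] by (simp only:)
      also have "\<dots> \<le> ?c * (norm E / 4)"
        by (rule mult_left_mono[OF \<eta>(3) c0])
      finally show ?thesis .
    qed
    let ?D = "\<phi> M\<^sub>2 M\<^sub>1 (k, y) - \<phi> M\<^sub>1 M\<^sub>2 (k, y)"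
    have "?D - ?c *\<^sub>R E = (\<phi> M\<^sub>2 M\<^sub>1 (k, y) - ?c *\<^sub>R (M\<^sub>2 ** M\<^sub>1)) - (\<phi> M\<^sub>1 M\<^sub>2 (k, y) - ?c *\<^sub>R (M\<^sub>1 ** M\<^sub>2))"
      unfolding E_def scaleR_diff_right by simp
    then have "norm (?D - ?c *\<^sub>R E) \<le> ?c * (norm E / 4) + ?c * (norm E / 4)"
      using norm_triangle_ineq4 near[of M\<^sub>2 M\<^sub>1] near[of M\<^sub>1 M\<^sub>2] by (smt (verit))
    moreover have "r * (s / 4) + r * (s / 4) = r * (s / 2)" for r s :: real
      by (simp add: algebra_simps)
    ultimately have D: "norm (?D - ?c *\<^sub>R E) \<le> ?c * (norm E / 2)" by (simp only:)
    have "\<bar>inner (?D - ?c *\<^sub>R E) E\<bar> \<le> norm (?D - ?c *\<^sub>R E) * norm E"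
      by (rule Cauchy_Schwarz_ineq2)
    also have "\<dots> \<le> ?c * (norm E / 2) * norm E"
      by (rule mult_right_mono[OF D norm_ge_zero])
    finally have "inner (?D - ?c *\<^sub>R E) E \<ge> - (?c * ((norm E)\<^sup>2 / 2))"
      by (simp add: power2_eq_square)
    moreover have "inner (?D - ?c *\<^sub>R E) E = \<psi> (k, y) - ?c * (norm E)\<^sup>2"
      by (simp add: \<psi>_def inner_diff_left power2_norm_eq_inner)
    ultimately show ?thesis by (simp add: algebra_simps)
  qed
  have "AE x in \<mu>. 0 \<le> \<psi> x"
  proof (rule AE_I2)
    fix x assume "x \<in> space \<mu>"
    moreover obtain k y where x: "x = (k, y)" by (rule prod.exhaust)
    ultimately have k: "k \<in> carrier K" and y: "y \<in> lie_algebra_n"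
      by (simp_all only: space_mu KN_carrier)
    have "0 \<le> weight B (- y \<otimes>\<^bsub>N_group\<^esub> g) * weight B y * ((norm E)\<^sup>2 / 2)"
      by (intro mult_nonneg_nonneg weight_nonneg) simp
    also note \<psi>_lower[OF k y]
    finally show "0 \<le> \<psi> x" by (simp only: x)
  qed
  then have ae0: "AE x in \<mu>. \<psi> x = 0"
    using integral_nonneg_eq_0_iff_AE[OF \<psi>_int] \<psi>_zero by blast
  \<comment> \<open>Both weights are positive here, and the choice of \<open>?U\<close> ensures that
    the point with identity component in \<open>K\<close> and \<open>y = X\<close> belongs to
    it.\<close>
  let ?V = "{x. snd x \<in> B \<and> - snd x \<otimes>\<^bsub>N_group\<^esub> g \<in> B}"
  have "open ?V"
    unfolding B_def mem_ball by (intro open_Collect_conj open_Collect_less continuous_intros)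
  moreover have "(\<one>\<^bsub>K\<^esub>, X) \<in> ?V \<inter> carrier G"
    using KN.K.one_closed X gB \<epsilon>0
    by (simp only: Int_iff mem_Collect_eq snd_conv KN_carrier simp_thms B_def centre_in_ball)
  then have "?V \<inter> carrier G \<noteq> {}" by blast
  ultimately obtain x where xV: "x \<in> ?V" and xG: "x \<in> carrier G" and x0: "\<psi> x = 0"
    using AE_open_witness[OF ae0] by blast
  obtain k y where x: "x = (k, y)" by (rule prod.exhaust)
  have k: "k \<in> carrier K" and y: "y \<in> lie_algebra_n"
    using xG by (simp_all only: x KN_carrier)
  have "0 < weight B (- y \<otimes>\<^bsub>N_group\<^esub> g) * weight B y * ((norm E)\<^sup>2 / 2)"
    using xV E by (intro mult_pos_pos weight_pos[OF B]) (simp_all only: x mem_Collect_eq snd_conv, simp)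
  also note \<psi>_lower[OF k y]
  finally show False using x0 by (simp only: x)
qed

end

section \<open>Scalars commuting with an irreducible representation\<close>

section \<open>Central elements and Schur's lemma\<close>

lemma mat_nth: "mat t $ i $ j = (if i = j then t else 0)"
  by (simp add: mat_def)

lemma mat_mult_nth [simp]:
  fixes A :: "'a::semiring_1^'n^'n"
  shows "(mat t ** A) $ i $ j = t * A $ i $ j" "(A ** mat t) $ i $ j = A $ i $ j * t"
    "(mat t *v w) $ i = t * (w $ i :: 'a)"
proof -
  have "(mat t ** A) $ i $ j = (\<Sum>k\<in>UNIV. if k = i then t * A $ k $ j else 0)"
    unfolding matrix_mult_nth by (intro sum.cong) (auto simp: mat_def)
  then show "(mat t ** A) $ i $ j = t * A $ i $ j" by simp
  have "(A ** mat t) $ i $ j = (\<Sum>k\<in>UNIV. if k = j then A $ i $ k * t else 0)"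
    unfolding matrix_mult_nth by (intro sum.cong) (auto simp: mat_def)
  then show "(A ** mat t) $ i $ j = A $ i $ j * t" by simp
  have "(mat t *v w) $ i = (\<Sum>k\<in>UNIV. if k = i then t * w $ k else 0)"
    unfolding matrix_vector_nth by (intro sum.cong) (auto simp: mat_def)
  then show "(mat t *v w) $ i = t * w $ i" by simp
qed

lemma inner_cadj: "inner ((A :: complex^'n^'m) *v v) w = inner v (cadj A *v w)"
proof -
  have c: "inner (x * y) z = inner y (cnj x * z)" for x y z :: complex
    by (simp add: inner_complex_def algebra_simps)
  have "inner (A *v v) w = (\<Sum>i\<in>UNIV. \<Sum>j\<in>UNIV. inner (A $ i $ j * v $ j) (w $ i))"
    by (simp add: inner_vec_def matrix_vector_nth inner_sum_left)
  also have "\<dots> = (\<Sum>j\<in>UNIV. \<Sum>i\<in>UNIV. inner (v $ j) (cnj (A $ i $ j) * w $ i))"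
    by (subst sum.swap) (simp add: c)
  finally show ?thesis
    by (simp add: inner_vec_def matrix_vector_nth inner_sum_right)
qed

text \<open>The maximum of the quadratic form of \<open>A\<close> on the unit sphere is an eigenvalue.\<close>

lemma self_adjoint_eigenvector:
  fixes A :: "complex^'d^'d"
  assumes A: "cadj A = A"
  obtains r :: real and w where "w \<noteq> 0" "A *v w = r *\<^sub>R w"
proof -
  have lin: "A *v (s *\<^sub>R u) = s *\<^sub>R (A *v u)" for s u
    by (simp add: vec_eq_iff matrix_vector_nth scaleR_sum_right)
  have ne: "sphere (0 :: complex^'d) 1 \<noteq> {}"
    by (simp add: sphere_eq_empty)
  have cont: "continuous_on (sphere (0 :: complex^'d) 1) (\<lambda>w. inner (A *v w) w)"
    by (intro continuous_intros)
  obtain w where w_sphere: "w \<in> sphere 0 1"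
    and max: "\<forall>v\<in>sphere 0 1. inner (A *v v) v \<le> inner (A *v w) w"
    by (rule bexE[OF continuous_attains_sup[OF compact_sphere ne cont]])
  have w: "norm w = 1" using w_sphere by simp
  define r where "r = inner (A *v w) w"
  \<comment> \<open>Maximality of \<open>w\<close> makes \<open>P\<close> positive semidefinite with
    \<open>inner (P w) w = 0\<close>, which forces \<open>P w = 0\<close>.\<close>
  define P where "P v = r *\<^sub>R v - A *v v" for v
  have P_diff: "P (u - v) = P u - P v" and P_scale: "P (s *\<^sub>R u) = s *\<^sub>R P u" for u v s
    by (simp_all add: P_def lin matrix_vector_mult_diff_distrib algebra_simps)
  have P_sym: "inner (P u) v = inner u (P v)" for u v
    by (simp add: P_def inner_diff_left inner_diff_right inner_cadj A)
  have P_nonneg: "0 \<le> inner (P v) v" for v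
  proof (cases "v = 0")
    case False
    have "inner (A *v (v /\<^sub>R norm v)) (v /\<^sub>R norm v) \<le> r"
      unfolding r_def by (rule bspec[OF max]) (use False in simp)
    then have "inner (A *v v) v / (norm v)\<^sup>2 \<le> r"
      by (simp add: lin power2_eq_square divide_simps)
    then have "inner (A *v v) v \<le> r * (norm v)\<^sup>2"
      using False by (simp add: divide_simps)
    then show ?thesis by (simp add: P_def inner_diff_left power2_norm_eq_inner)
  qed simp
  have Pw: "inner (P w) w = 0"
    using w by (simp add: P_def r_def inner_diff_left flip: power2_norm_eq_inner)
  define a where "a = inner (P w) (P w)"
  define b where "b = inner (P (P w)) (P w)"
  \<comment> \<open>Nonnegativity of the form at \<open>w - s *\<^sub>R P w\<close>, divided by
    \<open>s\<close>; small \<open>s\<close> then excludes \<open>a > 0\<close>.\<close>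
  have bound: "2 * a \<le> s * b" if "s > 0" for s
  proof -
    have "0 \<le> inner (P (w - s *\<^sub>R P w)) (w - s *\<^sub>R P w)" by (rule P_nonneg)
    also have "\<dots> = s * (s * b - 2 * a)"
      using P_sym[of "P w" w]
      by (simp add: P_diff P_scale inner_diff_left inner_diff_right Pw a_def b_def algebra_simps)
    finally show ?thesis using that by (simp add: zero_le_mult_iff)
  qed
  have "a \<le> 0"
  proof (rule ccontr)
    assume "\<not> a \<le> 0"
    then have a: "a > 0" by simp
    \<comment> \<open>Small enough that \<open>t * b \<le> a\<close>, whereas the bound demands at
      least \<open>2 * a\<close>.\<close>
    define t where "t = a / (\<bar>b\<bar> + 1)"
    have t: "t > 0" "t * (\<bar>b\<bar> + 1) = a"
      using a by (simp_all add: t_def divide_pos_pos add_nonneg_pos)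
    have "2 * a \<le> t * b" by (rule bound[OF t(1)])
    also have "\<dots> \<le> t * (\<bar>b\<bar> + 1)"
      using t(1) by (intro mult_left_mono) auto
    finally show False using t(2) a by simp
  qed
  then have "P w = 0" unfolding a_def by (metis inner_gt_zero_iff not_le)
  then have "A *v w = r *\<^sub>R w" by (simp add: P_def)
  moreover have "w \<noteq> 0" using w by auto
  ultimately show ?thesis using that by blast
qed

locale KN_irrep = KN_rep \<mu> \<tau> for \<mu> and \<tau> :: "complex \<times> (quat^'n::finite^'n) \<Rightarrow> complex^'d^'d" +
  assumes irred: "irreducible_unitary_rep K_group \<tau>"
begin

lemma invariant_subspace:
  assumes "vec.subspace S" "\<And>k w. k \<in> carrier K \<Longrightarrow> w \<in> S \<Longrightarrow> \<tau> k *v w \<in> S" "w \<in> S" "w \<noteq> 0"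
  shows "S = UNIV"
  using irred assms unfolding irreducible_unitary_rep_def by blast

text \<open>The kernel of \<open>A - r\<close> for an eigenvalue \<open>r\<close> is nonzero, and it
  is invariant because \<open>A\<close> commutes with the representation; by irreducibility it is
  everything.\<close>

lemma self_adjoint_scalar:
  assumes A: "cadj A = A" and comm: "\<And>k. k \<in> carrier K \<Longrightarrow> A ** \<tau> k = \<tau> k ** A"
  obtains r :: real where "A = mat (of_real r)"
proof -
  obtain r w where w: "w \<noteq> 0" "A *v w = r *\<^sub>R w"
    using self_adjoint_eigenvector[OF A] by blast
  define P where "P = A - mat (of_real r)"
  have P_comm: "P ** \<tau> k = \<tau> k ** P" if "k \<in> carrier K" for k
    using comm[OF that]
    by (simp add: P_def matrix_diff_distrib)
      (simp add: vec_eq_iff mult.commute)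
  have Pw: "P *v w = 0"
    using w(2) by (simp add: P_def matrix_vector_mult_diff_rdistrib)
      (simp add: vec_eq_iff, simp add: scaleR_conv_of_real)
  have "{w. P *v w = 0} = UNIV"
  proof (rule invariant_subspace[OF _ _ _ w(1)])
    show "vec.subspace {w. P *v w = 0}"
      by (auto simp: vec.subspace_def matrix_vector_right_distrib vector_scalar_commute)
    show "\<tau> k *v u \<in> {w. P *v w = 0}" if "k \<in> carrier K" "u \<in> {w. P *v w = 0}" for k u
      using that(2) by (simp add: matrix_vector_mul_assoc P_comm[OF that(1)])
        (simp flip: matrix_vector_mul_assoc)
    show "w \<in> {w. P *v w = 0}" using Pw by simp
  qed
  then have "P *v w = 0 *v w" for w by auto
  then have "P = 0" unfolding matrix_eq[of P] by blast
  then show ?thesis using that by (simp add: P_def)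
qed

text \<open>The sum of \<open>\<tau> c\<close> and its adjoint, and \<open>i\<close> times their
  difference, are self-adjoint, so both are real scalars and \<open>\<tau> c\<close> is recovered
  from them. The adjoint commutes with every \<open>\<tau> k\<close> because the adjoint of
  \<open>\<tau> k\<close> is the value at the inverse of \<open>k\<close>.\<close>

lemma central_scalar:
  assumes c: "c \<in> carrier K" and comm: "\<And>k. k \<in> carrier K \<Longrightarrow> \<tau> c ** \<tau> k = \<tau> k ** \<tau> c"
  obtains t where "\<tau> c = mat t"
proof -
  let ?T = "\<tau> c"
  have comm': "cadj ?T ** \<tau> k = \<tau> k ** cadj ?T" if k: "k \<in> carrier K" for k
    using arg_cong[OF comm[OF KN.K.inv_closed[OF k]], of cadj]
    by (simp add: cadj_mult tau_inv[OF k])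
  have i: "mat \<i> ** A = A ** mat \<i>" for A :: "complex^'d^'d"
    by (simp add: vec_eq_iff mult.commute)
  obtain r where r: "?T + cadj ?T = mat (of_real r)"
  proof (rule self_adjoint_scalar)
    show "cadj (?T + cadj ?T) = ?T + cadj ?T"
      by (simp add: vec_eq_iff add.commute)
    show "(?T + cadj ?T) ** \<tau> k = \<tau> k ** (?T + cadj ?T)" if "k \<in> carrier K" for k
      using comm[OF that] comm'[OF that] by (simp add: matrix_add_rdistrib matrix_add_ldistrib)
  qed
  obtain s where s: "mat \<i> ** (?T - cadj ?T) = mat (of_real s)"
  proof (rule self_adjoint_scalar)
    show "cadj (mat \<i> ** (?T - cadj ?T)) = mat \<i> ** (?T - cadj ?T)"
      by (simp add: vec_eq_iff algebra_simps)
    show "(mat \<i> ** (?T - cadj ?T)) ** \<tau> k = \<tau> k ** (mat \<i> ** (?T - cadj ?T))"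
      if "k \<in> carrier K" for k
    proof -
      have "(?T - cadj ?T) ** \<tau> k = \<tau> k ** (?T - cadj ?T)"
        using comm[OF that] comm'[OF that] by (simp add: matrix_diff_distrib)
      then show ?thesis by (metis i matrix_mul_assoc)
    qed
  qed
  have "?T = mat ((of_real r - \<i> * of_real s) / 2)"
  proof -
    have "?T $ i $ j = mat ((of_real r - \<i> * of_real s) / 2) $ i $ j" for i j
    proof -
      have "?T $ i $ j + cnj (?T $ j $ i) = (if i = j then of_real r else 0)"
        using arg_cong[OF r, of "\<lambda>A. A $ i $ j"] by (simp add: mat_nth)
      moreover have "\<i> * (?T $ i $ j - cnj (?T $ j $ i)) = (if i = j then of_real s else 0)"
        using arg_cong[OF s, of "\<lambda>A. A $ i $ j"]
        by (simp add: mat_nth)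
      then have "?T $ i $ j - cnj (?T $ j $ i) = (if i = j then - \<i> * of_real s else 0)"
        by (auto simp: complex_eq_iff split: if_splits)
      ultimately have "?T $ i $ j + ?T $ i $ j = (if i = j then of_real r - \<i> * of_real s else 0)"
        by (auto simp: algebra_simps split: if_splits)
      then show ?thesis
        by (auto simp: mat_nth complex_eq_iff split: if_splits)
    qed
    then show ?thesis by (simp add: vec_eq_iff)
  qed
  then show ?thesis by (rule that)
qed

text \<open>Scalars preserve every line, so the line through one basis vector is the whole space; as
  it contains the all-ones vector, there is no second index.\<close>

lemma dim_one_of_scalar:
  assumes scalar: "\<And>k. k \<in> carrier K \<Longrightarrow> \<exists>t. \<tau> k = mat t"
  shows "CARD('d) = 1"
proof -
  fix i :: 'd
  have "{w :: complex^'d. \<forall>j. j \<noteq> i \<longrightarrow> w $ j = 0} = UNIV"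
  proof (rule invariant_subspace)
    show "vec.subspace {w :: complex^'d. \<forall>j. j \<noteq> i \<longrightarrow> w $ j = 0}"
      by (auto simp: vec.subspace_def)
    show "\<tau> k *v w \<in> {w. \<forall>j. j \<noteq> i \<longrightarrow> w $ j = 0}"
      if "k \<in> carrier K" "w \<in> {w. \<forall>j. j \<noteq> i \<longrightarrow> w $ j = 0}" for k w
      using scalar[OF that(1)] that(2) by auto
    show "axis i 1 \<in> {w :: complex^'d. \<forall>j. j \<noteq> i \<longrightarrow> w $ j = 0}"
      by (simp add: axis_def)
    show "axis i 1 \<noteq> (0 :: complex^'d)" by (simp add: axis_eq_0_iff)
  qed
  then have "(\<chi> j. (1 :: complex)) \<in> {w :: complex^'d. \<forall>j. j \<noteq> i \<longrightarrow> w $ j = 0}"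
    by blast
  then have "UNIV = {i}" by auto
  then show ?thesis by (metis card_1_singleton_iff One_nat_def)
qed

text \<open>\<open>(- 1, - I)\<close> acts trivially on \<open>N\<close> and is central, so it acts on matrices trivially as well.\<close>

lemma commutative_imp_dim_one:
  assumes comm: "commutative_triple G \<mu> (carrier K \<times> {\<one>\<^bsub>N_group\<^esub>}) (\<lambda>(k, x). \<tau> k)"
  shows "CARD('d) = 1"
proof (rule ccontr)
  assume "CARD('d) \<noteq> 1"
  then obtain i j :: 'd where ij: "i \<noteq> j"
    by (metis card_1_singleton_iff One_nat_def UNIV_eq_I singletonI)
  \<comment> \<open>Two opposite matrix units: their products in the two orders are different
    diagonal units.\<close>
  define M\<^sub>1 :: "complex^'d^'d" where "M\<^sub>1 = (\<chi> a b. if a = i \<and> b = j then 1 else 0)"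
  define M\<^sub>2 :: "complex^'d^'d" where "M\<^sub>2 = (\<chi> a b. if a = j \<and> b = i then 1 else 0)"
  have "(M\<^sub>2 ** M\<^sub>1) $ j $ j = 1"
    by (simp add: matrix_mult_nth M\<^sub>1_def M\<^sub>2_def if_distrib if_distribR cong: if_cong)
  moreover have "(M\<^sub>1 ** M\<^sub>2) $ j $ j = 0"
    using ij by (simp add: matrix_mult_nth M\<^sub>1_def M\<^sub>2_def)
  ultimately have M: "M\<^sub>2 ** M\<^sub>1 \<noteq> M\<^sub>1 ** M\<^sub>2" by (metis zero_neq_one)
  obtain X :: "'n nalg" where X: "X \<in> lie_algebra_n"
    and stab: "\<And>a. a \<in> carrier K \<Longrightarrow> K_action a X = X \<Longrightarrow> a = (1, mat 1) \<or> a = (- 1, mat (- 1))"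
    using exists_regular_point by blast
  have mat_neg: "mat (- 1) = - (mat 1 :: quat^'n^'n)"
    by (simp add: vec_eq_iff mat_nth)
  have c: "(- 1, mat (- 1)) \<in> carrier K"
    by (simp add: K_group_carrier mat_neg matrix_uminus_mult)
  have central: "(- 1, mat (- 1)) \<otimes>\<^bsub>K\<^esub> k = k \<otimes>\<^bsub>K\<^esub> (- 1, mat (- 1))" for k
    by (cases k) (simp add: K_group_mult mat_neg matrix_uminus_mult)
  obtain t where t: "\<tau> (- 1, mat (- 1)) = mat t"
  proof (rule central_scalar[OF c])
    show "\<tau> (- 1, mat (- 1)) ** \<tau> k = \<tau> k ** \<tau> (- 1, mat (- 1))" if "k \<in> carrier K" for k
      using tau_mult[OF c that] tau_mult[OF that c] central[of k] by simp
  qed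
  have "Ad a M = M" if "a \<in> carrier K" "K_action a X = X" for a M
    using stab[OF that]
  proof
    assume a: "a = (1, mat 1)"
    then have "\<tau> a = mat 1" using tau_one by (simp add: K_group_one)
    then show ?thesis by (simp add: Ad_def)
  next
    assume a: "a = (- 1, mat (- 1))"
    have "Ad a M = M ** (mat t ** mat (cnj t))"
      unfolding Ad_def a t by (simp add: vec_eq_iff matrix_mul_assoc mult.commute)
    also have "mat t ** mat (cnj t) = (mat 1 :: complex^'d^'d)"
      using tau_unitary(1)[OF c] by (simp only: t cadj_mat)
    finally show ?thesis by simp
  qed
  from noncommutative_triple[OF X this M] comm show False by blast
qed

end

section \<open>One-dimensional representations are trivial on Sp(n)\<close>

section \<open>Characters of the symplectic group\<close>

text \<open>The normalised sum \<open>1 + a\<close> bisects the angle between \<open>1\<close> and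
  \<open>a\<close>: its square is a positive multiple of \<open>a\<close>. For
  \<open>a = - 1\<close> it vanishes, and \<open>i\<close> is a root.\<close>

lemma quat_square_root:
  assumes "norm (a :: quat) = 1"
  obtains b where "norm b = 1" "b * b = a"
proof (cases "a = - 1")
  case True
  have "quat_of_complex \<i> * quat_of_complex \<i> = a"
    by (simp add: True quat_eq_iff)
  then show ?thesis using that[of "quat_of_complex \<i>"] by simp
next
  case False
  define n where "n = norm (1 + a)"
  have n: "n \<noteq> 0" using False by (simp add: n_def add_eq_0_iff)
  have "qcnj a * a = 1" using assms by (simp add: qcnj_mult_self)
  have "(1 + a) * (1 + a) = (1 + qcnj a) * (1 + a) * a"
  proof -
    have "(1 + qcnj a) * (1 + a) * a = a + a * a + qcnj a * a + (qcnj a * a) * a"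
      by (simp add: algebra_simps)
    then show ?thesis by (simp add: \<open>qcnj a * a = 1\<close> algebra_simps)
  qed
  also have "(1 + qcnj a) * (1 + a) = of_real (n\<^sup>2)"
    using qcnj_mult_self(1)[of "1 + a"] by (simp only: n_def qcnj_simps)
  finally have sq: "(1 + a) * (1 + a) = n\<^sup>2 *\<^sub>R a"
    by (simp add: scaleR_conv_of_real)
  show ?thesis
  proof (rule that)
    show "norm ((1 / n) *\<^sub>R (1 + a)) = 1"
      using n by (simp add: n_def)
    show "(1 / n) *\<^sub>R (1 + a) * (1 / n) *\<^sub>R (1 + a) = a"
      using n by (simp add: sq power2_eq_square)
  qed
qed

text \<open>An imaginary \<open>q\<close> orthogonal to the imaginary part of \<open>b\<close>
  anticommutes with it, so conjugation by \<open>q\<close> reverses exactly that part.\<close>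

lemma quat_conjugate_qcnj:
  obtains q where "norm q = 1" "q * b = qcnj b * q"
proof (cases "qIm1 b = 0 \<and> qIm2 b = 0")
  case True
  then have "quat_of_complex \<i> * b = qcnj b * quat_of_complex \<i>"
    by (simp add: quat_eq_iff)
  then show ?thesis using that[of "quat_of_complex \<i>"] by simp
next
  case False
  define r where "r = Quat 0 (qIm2 b) (- qIm1 b) 0"
  have r: "r \<noteq> 0" using False by (auto simp: r_def quat_eq_iff)
  have "r * b = qcnj b * r"
    by (simp add: r_def quat_eq_iff)
  then have "(r /\<^sub>R norm r) * b = qcnj b * (r /\<^sub>R norm r)"
    by simp
  then show ?thesis using that[of "r /\<^sub>R norm r"] r by simp
qed

lemma qform_axis: "qform (axis i 1) (axis j 1) = (if i = j then 1 else 0)"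
proof -
  have "qform (axis i 1) (axis j 1) = (\<Sum>a\<in>UNIV. if a = i then (if i = j then 1 else 0) else 0)"
    unfolding qform_def by (intro sum.cong) (auto simp: axis_def)
  then show ?thesis by simp
qed

lemma qform_Sp:
  fixes k :: "quat^'n^'n"
  shows "k ** qadj k = mat 1 \<Longrightarrow> qform (k *v u) (k *v v) = qform u v"
  by (simp add: qform_adjoint matrix_vector_mul_assoc Sp_left_inverse)

lemma reflection_vector: "reflection {w} a *v u = u + rmul w ((a - 1) * qform w u)"
  by (simp add: reflection_def matrix_vector_mult_add_rdistrib outer_prod_vector)

lemma qform_diff: "qform (u - u') v = qform u v - qform u' v" "qform u (v - v') = qform u v - qform u v'"
  by (simp_all add: qform_def algebra_simps sum_subtractf)

text \<open>The reflection along \<open>u - e\<close> with multiplier \<open>- t\<^sup>* t\<^sup>-\<^sup>1\<close>, where \<open>t = 1 - e\<^sup>* u\<close>.\<close>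

lemma reflection_exchange:
  fixes u e :: "quat^'n"
  assumes u: "qform u u = 1" and e: "qform e e = 1" and ne: "u \<noteq> e"
  obtains w a where "qform w w = 1" "norm a = 1" "reflection {w} a *v u = e"
    "\<And>v. qform u v = 0 \<Longrightarrow> qform e v = 0 \<Longrightarrow> reflection {w} a *v v = v"
proof -
  define n where "n = norm (u - e)"
  have n: "n \<noteq> 0" using ne by (simp add: n_def)
  define t where "t = qform (u - e) u"
  have t_eq: "t = 1 - qform e u" by (simp add: t_def qform_diff u)
  have "qform (u - e) (u - e) = t + qcnj t"
    by (simp add: t_eq qform_diff u e qcnj_qform)
  moreover have "qform (u - e) (u - e) = of_real (n\<^sup>2)"
  proof -
    have "qcnj (qform (u - e) (u - e)) = qform (u - e) (u - e)" by (rule qcnj_qform)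
    then have "qform (u - e) (u - e) = of_real (qRe (qform (u - e) (u - e)))"
      by (simp only: qcnj_eq_self_iff)
    then show ?thesis by (simp only: qRe_qform n_def power2_norm_eq_inner)
  qed
  ultimately have tt: "t + qcnj t = of_real (n\<^sup>2)" and nn: "qform (u - e) (u - e) = of_real (n\<^sup>2)"
    by simp_all
  have t: "t \<noteq> 0"
  proof
    assume "t = 0"
    then have "of_real (n\<^sup>2) = (0 :: quat)" using tt by simp
    then have "n\<^sup>2 = 0" by (simp only: of_real_eq_0_iff)
    then show False using n by simp
  qed
  \<comment> \<open>Chosen so that \<open>(a - 1) * t\<close> is minus the squared length of
    \<open>u - e\<close>. The reflection then subtracts \<open>u - e\<close> from \<open>u\<close>.
    Here \<open>t\<close> is invertible since \<open>t + qcnj t\<close> is that squared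
    length.\<close>
  define a where "a = - (qcnj t * inverse t)"
  define w where "w = (1 / n) *\<^sub>R (u - e)"
  have at: "(a - 1) * t = - (n\<^sup>2 *\<^sub>R 1)"
  proof -
    have "(a - 1) * t = - (t + qcnj t)"
      using t by (simp add: a_def algebra_simps)
    then show ?thesis by (simp only: tt) (simp add: scaleR_conv_of_real)
  qed
  show ?thesis
  proof (rule that)
    show "norm a = 1" using t by (simp add: a_def norm_mult norm_inverse)
    show "qform w w = 1"
      using n by (simp add: w_def qform_add nn) (simp add: quat_eq_iff power2_eq_square)
    have "rmul w ((a - 1) * qform w u) = (1 / n) *\<^sub>R (1 / n) *\<^sub>R rmul (u - e) ((a - 1) * t)"
      by (simp add: w_def qform_add t_def vec_eq_iff)
    also have "\<dots> = - (u - e)"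
      unfolding at using n by (simp add: vec_eq_iff power2_eq_square)
    finally show "reflection {w} a *v u = e"
      by (simp add: reflection_vector)
    show "reflection {w} a *v v = v" if "qform u v = 0" "qform e v = 0" for v
    proof -
      have "qform w v = 0" by (simp add: w_def qform_add qform_diff that)
      then show ?thesis by (simp add: reflection_vector vec_eq_iff)
    qed
  qed
qed

context KN_rep
begin

lemma Sp_in_K: "k ** qadj k = mat 1 \<Longrightarrow> (1, k) \<in> carrier K"
  by (simp add: K_group_carrier)

lemma tau_Sp_mult:
  assumes "k ** qadj k = mat 1" "l ** qadj l = mat 1"
  shows "\<tau> (1, k ** l) = \<tau> (1, k) ** \<tau> (1, l)"
  using tau_mult[OF assms[THEN Sp_in_K]] by (simp add: K_group_mult)

text \<open>If \<open>a = b\<^sup>2\<close> with \<open>b\<close> a unit, then \<open>b\<close> is conjugate to \<open>qcnj b = b\<^sup>-\<^sup>1\<close>, so \<open>a\<close> is a commutator.\<close>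

lemma tau_reflection:
  assumes d: "CARD('d) = 1" and w: "qform w w = 1" and a: "norm a = 1"
  shows "\<tau> (1, reflection {w} a) = mat 1"
proof -
  have qw: "qorthonormal {w}" using w by (simp add: qorthonormal_def)
  let ?r = "\<lambda>a. \<tau> (1, reflection {w} a)"
  have r_mult: "?r (b * c) = ?r b ** ?r c" if "norm b = 1" "norm c = 1" for b c
    using tau_Sp_mult[OF reflection_Sp[OF qw that(1)] reflection_Sp[OF qw that(2)]]
    by (simp only: reflection_mult[OF qw])
  have r_one: "?r 1 = mat 1"
    using tau_one by (simp add: reflection_one K_group_one)
  obtain b where b: "norm b = 1" "b * b = a"
    using quat_square_root[OF a] by blast
  obtain q where q: "norm q = 1" "q * b = qcnj b * q"
    using quat_conjugate_qcnj by blast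
  have cb: "norm (qcnj b) = 1" using b(1) by simp
  have "?r q ** ?r b = ?r (qcnj b) ** ?r q"
    using r_mult[OF q(1) b(1)] r_mult[OF cb q(1)] by (simp only: q(2))
  also have "\<dots> = ?r q ** ?r (qcnj b)"
    by (rule matrix_one_dim_commute[OF d])
  finally have "cadj (?r q) ** (?r q ** ?r b) = cadj (?r q) ** (?r q ** ?r (qcnj b))"
    by (simp only:)
  then have "?r b = ?r (qcnj b)"
    by (simp only: matrix_mul_assoc tau_unitary(2)[OF Sp_in_K[OF reflection_Sp[OF qw q(1)]]] matrix_mul_lid)
  then have "?r (b * b) = ?r (b * qcnj b)"
    by (simp only: r_mult[OF b(1) b(1)] r_mult[OF b(1) cb])
  also have "b * qcnj b = 1"
    using b(1) by (simp add: qcnj_mult_self)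
  finally show ?thesis by (simp only: b(2) r_one)
qed

text \<open>Induction on a set of basis vectors outside of which \<open>k\<close> fixes them all. A
  reflection carrying \<open>k e\<close> back to \<open>e\<close> enlarges the fixed part, and its
  own image is trivial, so \<open>k\<close> and its product with the reflection have the same
  image.\<close>

lemma tau_Sp_trivial:
  fixes k :: "quat^'n^'n"
  assumes d: "CARD('d) = 1" and k: "k ** qadj k = mat 1"
  shows "\<tau> (1, k) = mat 1"
proof -
  have "\<tau> (1, k) = mat 1"
    if "finite S" "k ** qadj k = mat 1" "\<forall>i. i \<notin> S \<longrightarrow> k *v axis i 1 = axis i 1" for S and k :: "quat^'n^'n"
    using that
  proof (induction S arbitrary: k rule: finite_induct)
    case empty
    have "k $ i $ j = mat 1 $ i $ j" for i j
    proof -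
      have "(k *v axis j 1) $ i = (\<Sum>l\<in>UNIV. if l = j then k $ i $ j else 0)"
        unfolding matrix_vector_nth by (intro sum.cong) (auto simp: axis_def)
      then have "(k *v axis j 1) $ i = k $ i $ j" by simp
      then show ?thesis using empty.prems(2) by (auto simp: axis_def mat_nth)
    qed
    then have "k = mat 1" by (simp add: vec_eq_iff)
    then show ?case using tau_one by (simp add: K_group_one)
  next
    case (insert i S)
    let ?e = "axis i 1 :: quat^'n" and ?u = "k *v axis i 1"
    show ?case
    proof (cases "?u = ?e")
      case True
      have "\<forall>j. j \<notin> S \<longrightarrow> k *v axis j 1 = axis j 1"
      proof (intro allI impI)
        show "k *v axis j 1 = axis j 1" if "j \<notin> S" for j
          using True insert.prems(2) that by (cases "j = i") simp_all
      qed
      then show ?thesis by (rule insert.IH[OF insert.prems(1)])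
    next
      case False
      have uu: "qform ?u ?u = 1" "qform ?e ?e = 1"
        by (simp_all add: qform_Sp[OF insert.prems(1)] qform_axis)
      obtain w a where w: "qform w w = 1" and a: "norm a = 1"
        and ru: "reflection {w} a *v ?u = ?e"
        and fixed: "\<And>v. qform ?u v = 0 \<Longrightarrow> qform ?e v = 0 \<Longrightarrow> reflection {w} a *v v = v"
        using reflection_exchange[OF uu False] by blast
      have r: "reflection {w} a ** qadj (reflection {w} a) = mat 1"
        using w a by (intro reflection_Sp) (simp add: qorthonormal_def)
      have "(reflection {w} a ** k) ** qadj (reflection {w} a ** k) =
          reflection {w} a ** (k ** qadj k) ** qadj (reflection {w} a)"
        by (simp only: qadj_mult matrix_mul_assoc)
      then have rk: "(reflection {w} a ** k) ** qadj (reflection {w} a ** k) = mat 1"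
        by (simp add: insert.prems(1) r)
      have "(reflection {w} a ** k) *v axis j 1 = axis j 1" if "j \<notin> S" for j
      proof (cases "j = i")
        case True
        then show ?thesis using ru by (simp flip: matrix_vector_mul_assoc)
      next
        case False
        then have kj: "k *v axis j 1 = axis j 1" using insert.prems(2) that by blast
        \<comment> \<open>An already fixed basis vector equals its image under \<open>k\<close>, so
          it is orthogonal to \<open>?u\<close> as well as to \<open>?e\<close>, and the reflection
          leaves it alone.\<close>
        have "qform ?u (axis j 1) = qform ?u (k *v axis j 1)" by (simp only: kj)
        also have "\<dots> = 0" using False by (simp add: qform_Sp[OF insert.prems(1)] qform_axis)
        finally have "reflection {w} a *v axis j 1 = axis j 1"
          using False by (intro fixed) (simp_all add: qform_axis)
        then show ?thesis by (simp add: kj flip: matrix_vector_mul_assoc)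
      qed
      then have "\<tau> (1, reflection {w} a ** k) = mat 1"
        by (intro insert.IH[OF rk]) simp
      then show ?thesis
        by (simp add: tau_Sp_mult[OF r insert.prems(1)] tau_reflection[OF d w a])
    qed
  qed
  then show ?thesis using k by (metis UNIV_I finite)
qed

end

context KN_irrep
begin

text \<open>The representation then factors through the abelian circle, so each of its values
  commutes with all others and is scalar.\<close>

lemma dim_one_of_Sp_trivial:
  assumes triv: "\<And>k. k \<in> carrier Sp_group \<Longrightarrow> \<tau> (1, k) = mat 1"
  shows "CARD('d) = 1"
proof (rule dim_one_of_scalar)
  have factor: "\<tau> (z, k) = \<tau> (z, mat 1)" "(z, mat 1) \<in> carrier K" if "(z, k) \<in> carrier K" for z k
  proof -
    have k: "k ** qadj k = mat 1" using that by (simp add: K_group_carrier)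
    show z: "(z, mat 1) \<in> carrier K" using that by (simp add: K_group_carrier)
    show "\<tau> (z, k) = \<tau> (z, mat 1)"
      using tau_mult[OF z Sp_in_K[OF k]] triv[of k] k by (simp add: K_group_mult)
  qed
  have comm: "\<tau> (z, k) ** \<tau> (w, l) = \<tau> (w, l) ** \<tau> (z, k)"
    if k: "(z, k) \<in> carrier K" and l: "(w, l) \<in> carrier K" for z k w l
    using tau_mult[OF factor(2)[OF k] factor(2)[OF l]] tau_mult[OF factor(2)[OF l] factor(2)[OF k]]
    by (simp add: factor(1)[OF k] factor(1)[OF l] K_group_mult mult.commute)
  fix c assume c: "c \<in> carrier K"
  show "\<exists>t. \<tau> c = mat t"
  proof (rule central_scalar[OF c])
    show "\<tau> c ** \<tau> k = \<tau> k ** \<tau> c" if "k \<in> carrier K" for k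
      using comm[of "fst c" "snd c" "fst k" "snd k"] c that by (simp only: prod.collapse)
  qed blast
qed

text \<open>The character is the single entry of \<open>\<tau> (z, mat 1)\<close>. From right to
  left, irreducibility supplies dimension one.\<close>

lemma in_circle_dual_iff: "in_circle_dual \<tau> \<longleftrightarrow> (\<forall>k\<in>carrier Sp_group. \<tau> (1, k) = mat 1)"
proof
  assume "in_circle_dual \<tau>"
  then obtain \<psi> where \<psi>: "\<And>z k. (z, k) \<in> carrier K \<Longrightarrow> \<tau> (z, k) = mat (\<psi> z)"
    unfolding in_circle_dual_def by blast
  show "\<forall>k\<in>carrier Sp_group. \<tau> (1, k) = mat 1"
  proof
    fix k :: "quat^'n^'n" assume "k \<in> carrier Sp_group"
    then have "(1, k) \<in> carrier K" "(1, mat 1) \<in> carrier K" by (simp_all add: K_group_carrier)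
    then have "\<tau> (1, k) = \<tau> (1, mat 1)" using \<psi> by metis
    then show "\<tau> (1, k) = mat 1" using tau_one by (simp add: K_group_one)
  qed
next
  assume triv: "\<forall>k\<in>carrier Sp_group. \<tau> (1, k) = mat 1"
  then have d: "CARD('d) = 1" by (intro dim_one_of_Sp_trivial) blast
  obtain c :: 'd where c: "UNIV = {c}" using d card_1_singletonE by blast
  define \<psi> where "\<psi> z = \<tau> (z, mat 1) $ c $ c" for z
  have eq_c: "i = c" for i using c by auto
  have scalar: "A = mat (A $ c $ c)" for A :: "complex^'d^'d"
  proof -
    have "A $ i $ j = mat (A $ c $ c) $ i $ j" for i j
      unfolding eq_c[of i] eq_c[of j] by (simp add: mat_nth)
    then show ?thesis unfolding vec_eq_iff by blast
  qed
  have z: "(z, mat 1) \<in> carrier K" if "norm z = 1" for z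
    using that by (simp add: K_group_carrier)
  have \<psi>: "\<tau> (z, k) = mat (\<psi> z)" if "(z, k) \<in> carrier K" for z k
  proof -
    have z': "norm z = 1" and k: "k ** qadj k = mat 1" using that by (simp_all add: K_group_carrier)
    have "\<tau> (z, k) = \<tau> (z, mat 1)"
      using tau_mult[OF z[OF z'] Sp_in_K[OF k]] triv k by (simp add: K_group_mult)
    from trans[OF this scalar] show ?thesis unfolding \<psi>_def .
  qed
  have mat_mult: "(A ** B) $ c $ c = A $ c $ c * B $ c $ c" for A B :: "complex^'d^'d"
    by (simp add: matrix_mult_nth c)
  have "\<psi> (z * w) = \<psi> z * \<psi> w" if "norm z = 1" "norm w = 1" for z w
    using tau_mult[OF z[OF that(1)] z[OF that(2)]] mat_mult by (simp add: \<psi>_def K_group_mult)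
  moreover have "norm (\<psi> x) = 1" if "norm x = 1" for x
  proof -
    have "(\<tau> (x, mat 1) ** cadj (\<tau> (x, mat 1))) $ c $ c = 1"
      using tau_unitary(1)[OF z[OF that]] by (simp add: mat_nth)
    then have "\<psi> x * cnj (\<psi> x) = 1" by (simp add: mat_mult \<psi>_def)
    then have "(norm (\<psi> x))\<^sup>2 = 1"
      by (metis complex_norm_square of_real_eq_1_iff)
    then show ?thesis
      using norm_ge_zero[of "\<psi> x"] by (simp only: power2_eq_1_iff) linarith
  qed
  ultimately have "\<psi> \<in> hom circle_group circle_group"
    by (auto simp: hom_def)
  moreover have "continuous_on (carrier circle_group) \<psi>"
    unfolding \<psi>_def
    by (intro continuous_intros continuous_on_compose2[OF tau_continuous]) (auto simp: K_group_carrier)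
  ultimately have "circle_character \<psi>" by (simp add: circle_character_def)
  then show "in_circle_dual \<tau>"
    unfolding in_circle_dual_def using d \<psi> by blast
qed

lemma commutative_triple_iff:
  "commutative_triple G \<mu> (carrier K \<times> {\<one>\<^bsub>N_group\<^esub>}) (\<lambda>(k, x). \<tau> k) \<longleftrightarrow> in_circle_dual \<tau>"
proof
  assume "commutative_triple G \<mu> (carrier K \<times> {\<one>\<^bsub>N_group\<^esub>}) (\<lambda>(k, x). \<tau> k)"
  then have "CARD('d) = 1" by (rule commutative_imp_dim_one)
  then show "in_circle_dual \<tau>"
    unfolding in_circle_dual_iff using tau_Sp_trivial by simp
next
  assume "in_circle_dual \<tau>"
  then have "CARD('d) = 1" "\<And>k. k \<in> carrier Sp_group \<Longrightarrow> \<tau> (1, k) = mat 1"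
    using in_circle_dual_iff unfolding in_circle_dual_def by blast+
  then show "commutative_triple G \<mu> (carrier K \<times> {\<one>\<^bsub>N_group\<^esub>}) (\<lambda>(k, x). \<tau> k)"
    by (rule commutative_triple_of_trivial)
qed

end

theorem theorem4:
  fixes \<tau> :: "complex \<times> (quat ^ 'n ^ 'n) \<Rightarrow> complex ^ 'd ^ 'd"
    and \<mu> :: "((complex \<times> (quat ^ 'n ^ 'n)) \<times> 'n::finite nalg) measure"
  assumes "irreducible_unitary_rep K_group \<tau>"
    and "haar_measure KN_group \<mu>"
  shows "(commutative_triple KN_group \<mu> (carrier K_group \<times> {\<one>\<^bsub>N_group\<^esub>}) (\<lambda>(k, x). \<tau> k)
            \<longleftrightarrow> in_circle_dual \<tau>)
       \<and> (in_circle_dual \<tau> \<longleftrightarrow> (\<forall>k\<in>carrier Sp_group. \<tau> (1, k) = mat 1))"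
proof -
  interpret KN_irrep \<mu> \<tau>
    using assms by unfold_locales (simp_all add: irreducible_unitary_rep_def)
  show ?thesis
    using commutative_triple_iff in_circle_dual_iff by blast
qed

end
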